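(* Let $N\ge 2$ identical nonlinear circuits, each consisting of the parallel connection of a passive LTI impedance $z_{\mathrm{osc}}(s)$ and a voltage-dependent current source $i_{\mathrm g}=-g(v)$ with $\sigma:=\sup_{v\in\mathbb R}\left|\frac{\mathrm d}{\mathrm dv}g(v)\right|<\infty$, be coupled through a passive, connected LTI electrical network whose Kron-reduced admittance matrix is of the form $$Y(s)=y_{\mathrm{shunt}}(s)\,I+y_{\mathrm{series}}(s)\,L,$$ where $L\in\mathbb R^{N\times N}$ is the real symmetric weighted Laplacian matrix of a connected graph (so the network corresponding to $y_{\mathrm{series}}L$ has uniform line characteristics and no shunt elements). Let $\lambda_2,\dots,\lambda_N$ be the nonzero eigenvalues of $L$, let $z_{\mathrm{shunt}}:=y_{\mathrm{shunt}}^{-1}$, and let $$z_{\mathrm{eq}}:=\frac{z_{\mathrm{shunt}}\,z_{\mathrm{osc}}}{z_{\mathrm{shunt}}+z_{\mathrm{osc}}}.$$ If for all $j\in\{2,\dots,N\}$ $$\left\Vert \mathcal F\big(z_{\mathrm{eq}}(\mathrm j\omega),\,y_{\mathrm{series}}(\mathrm j\omega)\lambda_j\big)\right\Vert_\infty\,\sigma<1,$$ then the terminal voltages synchronize globally asymptotically, i.e. (for all initial conditions) $$\lim_{t\to\infty}\big(v_j(t)-v_k(t)\big)=0\qquad\forall\, j,k\in\{1,\dots,N\}.$$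
   Context: Coupled system. Circuit $j$ has terminal voltage $v_j$, injects current $i_j$ into the network, and has source current $i_{\mathrm gj}=-g(v_j)$; $g:\mathbb R\to\mathbb R$ may be piecewise linear (then the supremum defining $\sigma$ is over its slopes). In the Laplace domain the linear part obeys $v_j=z_{\mathrm{osc}}\,(i_{\mathrm gj}-i_j)$, where $z_{\mathrm{osc}}(s)$ is the impedance of an interconnection of passive LTI circuit elements, and the network imposes $i=Yv$ with $i=[i_1,\dots,i_N]^{\mathrm T}$, $v=[v_1,\dots,v_N]^{\mathrm T}$, where $Y$ is the Kron-reduced admittance matrix. Initial conditions refer to the states of the energy-storage elements. Kron-reduced admittance matrix: if the full network has admittance matrix $Y_{\mathcal A}$, partitioned into blocks for the boundary nodes $\mathcal N=\{1,\dots,N\}$ (where the circuits are connected) and the interior nodes $\mathcal I$ (zero current injection), then $Y=Y_{\mathcal{NN}}-Y_{\mathcal{NI}}Y_{\mathcal{II}}^{-1}Y_{\mathcal{NI}}^{\mathrm T}$ ($Y_{\mathcal{II}}$ is assumed nonsingular). $Y_{\mathcal A}$ has diagonal entries $y_m+\sum_k y_{mk}$ (shunt admittance to ground plus branch admittances at $m$) and off-diagonal entries $-y_{mn}$ for branches, $0$ otherwise. The Laplacian of a symmetric nonnegative weight matrix $A=(a_{nm})$ has off-diagonal entries $-a_{nm}$ and diagonal entries $\sum_m a_{nm}$; for a connected graph its zero eigenvalue $\lambda_1=0$ is simple. Linear fractional transformation: $\mathcal F(A,B):=(I+AB)^{-1}A$; for scalars $\mathcal F(a,b)=a/(1+ab)$.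 For a scalar transfer function $h$ all of whose poles have strictly negative real part, $\Vert h\Vert_\infty:=\sup_{\omega\in\mathbb R}|h(\mathrm j\omega)|$ (the condition on the norm includes that it is defined in this sense). *)

theory Defs
  imports
    "Jordan_Normal_Form.Gauss_Jordan_Elimination"
    "Jordan_Normal_Form.Char_Poly"
    "HOL-Computational_Algebra.Normalized_Fraction"
    "HOL-Computational_Algebra.Field_as_Ring"
    "HOL-Computational_Algebra.Polynomial_Factorial"
begin

section \<open>Transfer functions\<close>

text \<open>Elements of the field of real rational functions in the Laplace variable s, so that
  cancellations and identities between impedances hold in the field and not pointwise.\<close>

type_synonym tf = "real poly fract"

definition tf_const :: "real \<Rightarrow> tf" where
  "tf_const a = Fract [:a:] 1"

definition tf_s :: tf where
  "tf_s = Fract [:0, 1:] 1"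

text \<open>Numerator and denominator below are those of the representation in lowest terms.\<close>

definition tf_poles :: "tf \<Rightarrow> complex set" where
  "tf_poles h = {s. poly (map_poly complex_of_real (snd (quot_of_fract h))) s = 0}"

definition tf_eval :: "tf \<Rightarrow> complex \<Rightarrow> complex" where
  "tf_eval h s = poly (map_poly complex_of_real (fst (quot_of_fract h))) s /
                 poly (map_poly complex_of_real (snd (quot_of_fract h))) s"

definition hinf_defined :: "tf \<Rightarrow> bool" where
  "hinf_defined h \<longleftrightarrow> (\<forall>s\<in>tf_poles h. Re s < 0) \<and>
     bdd_above (range (\<lambda>\<omega>::real. cmod (tf_eval h (\<i> * complex_of_real \<omega>))))"

text \<open>Meaningful only under \<^const>\<open>hinf_defined\<close>.\<close>

definition hinf_norm :: "tf \<Rightarrow> real" where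
  "hinf_norm h = (SUP \<omega>::real. cmod (tf_eval h (\<i> * complex_of_real \<omega>)))"

definition lft :: "tf \<Rightarrow> tf \<Rightarrow> tf" where
  "lft a b = a / (1 + a * b)"

text \<open>\<open>z_shunt z_osc / (z_shunt + z_osc)\<close> with \<open>z_shunt = 1 / y_shunt\<close>.  A vanishing shunt
  admittance is an infinite \<open>z_shunt\<close>, for which the parallel connection is \<open>z_osc\<close>; the division
  convention \<open>1 / 0 = 0\<close> would turn it into a short circuit instead.\<close>

definition z_equiv :: "tf \<Rightarrow> tf \<Rightarrow> tf" where
  "z_equiv y_shunt z_osc =
     (if y_shunt = 0 then z_osc
      else let z_shunt = inverse y_shunt in (z_shunt * z_osc) / (z_shunt + z_osc))"


section \<open>Interconnections of passive LTI circuit elements\<close>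

datatype element = Resistor real | Inductor real | Capacitor real

fun element_passive :: "element \<Rightarrow> bool" where
  "element_passive (Resistor r) \<longleftrightarrow> r > 0"
| "element_passive (Inductor l) \<longleftrightarrow> l > 0"
| "element_passive (Capacitor c) \<longleftrightarrow> c > 0"

fun element_adm :: "element \<Rightarrow> tf" where
  "element_adm (Resistor r) = inverse (tf_const r)"
| "element_adm (Inductor l) = inverse (tf_s * tf_const l)"
| "element_adm (Capacitor c) = tf_s * tf_const c"

text \<open>A node is \<open>Some m\<close>, or \<open>None\<close> for the ground.  An element occupies one list position, so
  parallel elements are allowed; its reference direction is from the first to the second node.
  A composite branch, such as a resistor and an inductor in series, is written with additional
  interior nodes.\<close>

type_synonym circuit = "(nat option \<times> nat option \<times> element) list"

definition passive_circuit :: "nat \<Rightarrow> circuit \<Rightarrow> bool" where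
  "passive_circuit n cs \<longleftrightarrow>
     (\<forall>(a, b, el)\<in>set cs. a \<noteq> b \<and> element_passive el \<and>
        {a, b} \<subseteq> insert None (Some ` {..<n}))"

definition connected_circuit :: "nat \<Rightarrow> circuit \<Rightarrow> bool" where
  "connected_circuit n cs \<longleftrightarrow>
     (\<forall>m<n. \<forall>k<n. (m, k) \<in>
        {(p, q). \<exists>el. (Some p, Some q, el) \<in> set cs \<or> (Some q, Some p, el) \<in> set cs}\<^sup>*)"

text \<open>\<open>branch_adm cs (Some m) (Some k)\<close> is the branch admittance \<open>y\<^sub>m\<^sub>k\<close>, and
  \<open>branch_adm cs (Some m) None\<close> the shunt admittance \<open>y\<^sub>m\<close>.\<close>

definition branch_adm :: "circuit \<Rightarrow> nat option \<Rightarrow> nat option \<Rightarrow> tf" where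
  "branch_adm cs m k = (\<Sum>(a, b, el) \<leftarrow> cs. if {a, b} = {m, k} then element_adm el else 0)"

definition nodal_adm :: "nat \<Rightarrow> circuit \<Rightarrow> tf mat" where
  "nodal_adm n cs = mat n n (\<lambda>(m, k).
     if m = k
     then branch_adm cs (Some m) None + (\<Sum>p\<in>{..<n} - {m}. branch_adm cs (Some m) (Some p))
     else - branch_adm cs (Some m) (Some k))"

text \<open>Of the \<open>n\<close> nodes, \<open>{..<b}\<close> are the boundary nodes and \<open>{b..<n}\<close> the (possibly absent) interior
  nodes.\<close>

definition interior_adm :: "nat \<Rightarrow> nat \<Rightarrow> circuit \<Rightarrow> tf mat" where
  "interior_adm b n cs =
     (case split_block (nodal_adm n cs) b b of (Ybb, Ybi, Yib, Yii) \<Rightarrow> Yii)"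

definition kron_reduced :: "nat \<Rightarrow> nat \<Rightarrow> circuit \<Rightarrow> tf mat" where
  "kron_reduced b n cs =
     (case split_block (nodal_adm n cs) b b of (Ybb, Ybi, Yib, Yii) \<Rightarrow>
        Ybb - Ybi * the (mat_inverse Yii) * Ybi\<^sup>T)"

text \<open>Two-terminal circuit between node \<open>0\<close> and ground.\<close>

definition terminal_adm :: "nat \<Rightarrow> circuit \<Rightarrow> tf" where
  "terminal_adm n cs = kron_reduced 1 n cs $$ (0, 0)"

definition terminal_imp :: "nat \<Rightarrow> circuit \<Rightarrow> tf" where
  "terminal_imp n cs = inverse (terminal_adm n cs)"


section \<open>Trajectories\<close>

text \<open>Constitutive law of an element with voltage \<open>u\<close> and current \<open>c\<close>.\<close>

fun element_law :: "element \<Rightarrow> (real \<Rightarrow> real) \<Rightarrow> (real \<Rightarrow> real) \<Rightarrow> bool" where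
  "element_law (Resistor r) u c \<longleftrightarrow> (\<forall>t\<ge>0. u t = r * c t)"
| "element_law (Inductor l) u c \<longleftrightarrow>
     (\<forall>t\<ge>0. (c has_real_derivative u t / l) (at t within {0..}))"
| "element_law (Capacitor k) u c \<longleftrightarrow>
     (\<forall>t\<ge>0. (u has_real_derivative c t / k) (at t within {0..}))"

fun node_pot :: "(nat \<Rightarrow> real \<Rightarrow> real) \<Rightarrow> nat option \<Rightarrow> real \<Rightarrow> real" where
  "node_pot e None t = 0"
| "node_pot e (Some m) t = e m t"

text \<open>Node potentials \<open>e\<close> and element currents \<open>c\<close> (indexed by list position) on the time axis
  \<open>{0..}\<close>, where \<open>i_in m\<close> is the current injected into node \<open>m\<close> from outside.  Nothing is required of
  the capacitor voltages and inductor currents at time \<open>0\<close>.\<close>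

definition circuit_trajectory ::
  "nat \<Rightarrow> circuit \<Rightarrow> (nat \<Rightarrow> real \<Rightarrow> real) \<Rightarrow> (nat \<Rightarrow> real \<Rightarrow> real) \<Rightarrow> (nat \<Rightarrow> real \<Rightarrow> real) \<Rightarrow> bool" where
  "circuit_trajectory n cs i_in e c \<longleftrightarrow>
     (\<forall>m<n. continuous_on {0..} (e m)) \<and>
     (\<forall>l<length cs. continuous_on {0..} (c l)) \<and>
     (\<forall>l<length cs. case cs ! l of (a, b, el) \<Rightarrow>
        element_law el (\<lambda>t. node_pot e a t - node_pot e b t) (c l)) \<and>
     (\<forall>m<n. \<forall>t\<ge>0.
        (\<Sum>l<length cs. case cs ! l of (a, b, el) \<Rightarrow>
           (if a = Some m then c l t else 0) - (if b = Some m then c l t else 0)) = i_in m t)"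

text \<open>\<open>N\<close> copies of the circuit \<open>osc\<close> (\<open>n_osc\<close> nodes, terminal \<open>0\<close>), each in parallel with the source
  current \<open>- g v\<^sub>j\<close>, at the boundary nodes \<open>{..<N}\<close> of the network \<open>net\<close> (\<open>n_net\<close> nodes).  Circuit \<open>j\<close>
  injects \<open>i j\<close> into the network, and interior nodes have zero injection.\<close>

definition coupled_trajectory ::
  "nat \<Rightarrow> nat \<Rightarrow> circuit \<Rightarrow> nat \<Rightarrow> circuit \<Rightarrow> (real \<Rightarrow> real) \<Rightarrow> (nat \<Rightarrow> real \<Rightarrow> real) \<Rightarrow> bool" where
  "coupled_trajectory N n_net net n_osc osc g v \<longleftrightarrow>
     (\<exists>i e c eo co.
        circuit_trajectory n_net net (\<lambda>m t. if m < N then i m t else 0) e c \<and>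
        (\<forall>j<N. \<forall>t\<ge>0. e j t = v j t) \<and>
        (\<forall>j<N.
           circuit_trajectory n_osc osc
             (\<lambda>m t. if m = 0 then - g (v j t) - i j t else 0) (eo j) (co j) \<and>
           (\<forall>t\<ge>0. eo j 0 t = v j t)))"


section \<open>The nonlinearity and the Laplacian\<close>

definition piecewise_diff :: "(real \<Rightarrow> real) \<Rightarrow> bool" where
  "piecewise_diff g \<longleftrightarrow> continuous_on UNIV g \<and>
     (\<forall>a b. finite {v \<in> {a..b}. \<not> g differentiable (at v)})"

text \<open>The breakpoints of a piecewise linear function are left out of the supremum.\<close>

definition slopes :: "(real \<Rightarrow> real) \<Rightarrow> real set" where
  "slopes g = {\<bar>d\<bar> | d v. (g has_real_derivative d) (at v)}"

definition connected_weights :: "nat \<Rightarrow> (nat \<Rightarrow> nat \<Rightarrow> real) \<Rightarrow> bool" where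
  "connected_weights N a \<longleftrightarrow>
     (\<forall>j<N. a j j = 0) \<and>
     (\<forall>j<N. \<forall>k<N. a j k = a k j \<and> a j k \<ge> 0) \<and>
     (\<forall>j<N. \<forall>k<N. (j, k) \<in> {(p, q). p < N \<and> q < N \<and> a p q > 0}\<^sup>*)"

definition laplacian :: "nat \<Rightarrow> (nat \<Rightarrow> nat \<Rightarrow> real) \<Rightarrow> real mat" where
  "laplacian N a = mat N N (\<lambda>(j, k). if j = k then (\<Sum>m<N. a j m) else - a j k)"

end

theory Submission
  imports "HOL-Probability.Probability" "HOL-Computational_Algebra.Fundamental_Theorem_Algebra" Defs
begin

hide_const (open) Finite_Cartesian_Product.vec Finite_Cartesian_Product.mat Determinants.det
  Finite_Cartesian_Product.row

text \<open>Projecting the voltages on a unit eigenvector \<open>u\<close> of the Laplacian with eigenvalue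
  \<open>\<lambda> \<noteq> 0\<close> turns the coupled system into the scalar loop \<open>w = h f + \<eta>\<close>, where \<open>f = - u \<bullet> g(v)\<close>,
  \<open>h = 1 / (y_osc + y_shunt + \<lambda> y_series)\<close> is the transfer function of the hypothesis, and
  \<open>\<eta>\<close> is the response to the initial states of the storage elements.  Passivity alone gives
  \<open>\<bar>\<eta>(s)\<bar>\<^sup>2 Re s \<le> C \<bar>h(s)\<bar>\<close> for \<open>Re s > 0\<close>: by reciprocity the source term in \<open>\<eta>\<close> is a sum over
  the elements of (voltage drop) times (stored initial state), and Cauchy--Schwarz compares it with
  the dissipated power \<open>Re (1/h)\<close>.  Hence \<open>\<eta>\<close> has no poles in the closed right half plane, whatever
  lossless modes are hidden in the circuits, and it is strictly proper.  Plancherel's theorem turns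
  \<open>\<parallel>h\<parallel>\<^sub>\<infinity> \<sigma> < 1\<close> into a small-gain estimate which puts all disagreement modes into \<open>L\<^sup>2\<close>; since
  \<open>w\<close> is the feedthrough \<open>h(\<infinity>) f\<close> (again of gain below \<open>1 / \<sigma>\<close>) plus a convolution of an
  \<open>L\<^sup>2\<close> function with a decaying kernel, the modes tend to zero.

  Transforms are taken over finite horizons \<open>[0, T]\<close>, so that no growth bound on the trajectories is
  needed: the final states enter exactly like the initial ones, multiplied by \<open>- exp (- s T)\<close>.\<close>

section \<open>Plancherel identity\<close>

text \<open>The source \<open>g\<close> acts on each circuit separately and mixes the modes, so no
  single scalar loop can be closed. The total over all pairs of circuits can: differences of
  voltages involve only eigenvectors with nonzero eigenvalue, the sum of squared differences is
  \<open>2 N\<close> times the sum of squared modes, and the same expansion holds for the values of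
  \<open>g\<close>. The Lipschitz bound of \<open>g\<close> on pairs of circuits thus becomes a
  bound between two families of modes, of gain \<open>\<sigma>\<close>. The feedthrough makes that
  loop algebraic, so the small-gain inequality is needed twice: integrated over
  \<open>[0, T]\<close>, uniformly in \<open>T\<close>, and again at each single time. Impedances
  are elements of a field of rational functions, whose identities can be read at a complex point
  only off a finite set, because division by zero yields zero. Hence the transform relations hold up
  to finitely many points. Such a set is null for Plancherel and leaves points arbitrarily near
  every pole, which is all that the two uses of the relations require.\<close>

text \<open>Covers truncated trajectories, which jump at 0 and \<open>T\<close>, and causal kernels,
  which jump at 0. Boundedness and integrability give square integrability; continuity off a finite
  set serves the Gaussian limit and the recovery of pointwise values.\<close>

definition tame :: "(real \<Rightarrow> complex) \<Rightarrow> bool" where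
  "tame F \<longleftrightarrow> integrable lborel F \<and> bounded (range F) \<and> (\<exists>S. finite S \<and> (\<forall>x. x \<notin> S \<longrightarrow> isCont F x))"

text \<open>With this sign the transform of a signal on the positive axis is its Laplace transform
  at \<open>s = i w\<close>. A normalising factor would cancel, as Plancherel only compares two
  signals.\<close>

definition fourier :: "(real \<Rightarrow> complex) \<Rightarrow> real \<Rightarrow> complex" where
  "fourier F w = (LINT x|lborel. iexp (-(w * x)) * F x)"

lemma integrable_iexp_mult:
  assumes "integrable lborel F"
  shows "integrable lborel (\<lambda>x. iexp (w * x) * (F x :: complex))"
proof (rule Bochner_Integration.integrable_bound[OF assms])
  show "(\<lambda>x. iexp (w * x) * F x) \<in> borel_measurable lborel"
    using assms by (intro borel_measurable_times borel_measurable_continuous_onI) (auto intro!: continuous_intros)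
qed (auto simp: norm_mult)

lemma integrable_iexp_uminus_mult: 
  assumes "integrable lborel F"
  shows "integrable lborel (\<lambda>x. iexp (- (w * x)) * (F x :: complex))"
  using integrable_iexp_mult[OF assms, of "-w"] by simp

text \<open>Written as an integral over pairs, the square can be averaged over \<open>w\<close>
  under the integral sign.\<close>

lemma fourier_norm_sq:
  assumes F: "integrable lborel F"
  shows "complex_of_real ((norm (fourier F w))\<^sup>2) =
    (LINT q|(lborel :: (real\<times>real) measure). F (fst q) * cnj (F (snd q)) * iexp (w * (snd q - fst q)))"
proof -
  let ?G = "\<lambda>x. iexp (-(w * x)) * F x"
  have G: "integrable lborel ?G" by (rule integrable_iexp_uminus_mult[OF F])
  have cG: "integrable lborel (\<lambda>y. cnj (?G y))" using G by (simp only: integrable_cnj)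
  have int2: "integrable (lborel \<Otimes>\<^sub>M lborel) (\<lambda>(x, y). ?G x * cnj (?G y))"
  proof (rule lborel_pair.Fubini_integrable)
    show "(\<lambda>(x, y). ?G x * cnj (?G y)) \<in> borel_measurable (lborel \<Otimes>\<^sub>M lborel)"
      using borel_measurable_integrable[OF G] borel_measurable_integrable[OF cG] by measurable
    show "integrable lborel (\<lambda>x. LBINT y. norm (case (x, y) of (x, y) \<Rightarrow> ?G x * cnj (?G y)))"
      using F by (simp add: norm_mult)
    show "AE x in lborel. integrable lborel (\<lambda>y. case (x, y) of (x, y) \<Rightarrow> ?G x * cnj (?G y))"
      using cG by (auto simp del: complex_cnj_mult)
  qed
  have "complex_of_real ((norm (fourier F w))\<^sup>2) = fourier F w * cnj (fourier F w)"
    by (simp only: complex_norm_square)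
  also have "\<dots> = (LINT x|lborel. LINT y|lborel. ?G x * cnj (?G y))"
    unfolding fourier_def by (simp del: complex_cnj_mult flip: integral_cnj)
  also have "\<dots> = (LINT q|(lborel \<Otimes>\<^sub>M lborel). (case q of (x, y) \<Rightarrow> ?G x * cnj (?G y)))"
    using lborel_pair.integral_fst'[OF int2] by simp
  also have "\<dots> = (LINT q|(lborel :: (real\<times>real) measure). F (fst q) * cnj (F (snd q)) * iexp (w * (snd q - fst q)))"
    unfolding lborel_prod
    by (intro Bochner_Integration.integral_cong refl)
       (auto simp: split_beta exp_cnj exp_add[symmetric] algebra_simps mult_exp_exp)
  finally show ?thesis .
qed

lemma integrable_product:
  assumes F: "integrable lborel (F :: real \<Rightarrow> complex)" and G: "integrable lborel (G :: real \<Rightarrow> complex)"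
  shows "integrable (lborel :: (real\<times>real) measure) (\<lambda>q. F (fst q) * G (snd q))"
proof -
  have "integrable (lborel \<Otimes>\<^sub>M lborel) (\<lambda>(x, y). F x * G y)"
  proof (rule lborel_pair.Fubini_integrable)
    show "(\<lambda>(x, y). F x * G y) \<in> borel_measurable (lborel \<Otimes>\<^sub>M lborel)"
      using borel_measurable_integrable[OF F] borel_measurable_integrable[OF G] by measurable
    show "integrable lborel (\<lambda>x. LBINT y. norm (case (x, y) of (x, y) \<Rightarrow> F x * G y))"
      using F by (simp add: norm_mult)
  qed (use G in auto)
  thus ?thesis unfolding lborel_prod by (simp add: case_prod_unfold)
qed

text \<open>The Gaussian is its own characteristic function up to scaling, so averaging over
  frequency leaves a kernel in \<open>y - x\<close> that concentrates on the diagonal as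
  \<open>n\<close> grows.\<close>

lemma gauss_fourier:
  assumes F: "integrable lborel F"
  shows "complex_of_real (LINT w|std_normal_distribution. (norm (fourier F (n * w)))\<^sup>2) =
    (LINT x|lborel. LINT y|lborel. F x * cnj (F y) * complex_of_real (exp (- (n * (y - x))\<^sup>2 / 2)))"
proof -
  interpret N: prob_space std_normal_distribution by (rule prob_space_normal_density) simp
  interpret P: pair_sigma_finite std_normal_distribution "lborel :: (real\<times>real) measure"
    by (intro pair_sigma_finite.intro N.sigma_finite_measure_axioms sigma_finite_lborel)
  have cF: "integrable lborel (\<lambda>y. cnj (F y))" using F by simp
  let ?H = "\<lambda>(w::real) (q::real\<times>real). F (fst q) * cnj (F (snd q)) * iexp (n * w * (snd q - fst q))"
  note P0 = integrable_product[OF F cF]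
  have mF: "F \<in> borel_measurable borel" using F by (simp add: borel_measurable_integrable)
  have m0: "(\<lambda>q. F (fst q) * cnj (F (snd q))) \<in> borel_measurable borel" using borel_measurable_integrable[OF P0] by simp
  have m1: "(\<lambda>(w, q). ?H w q) \<in> borel_measurable (std_normal_distribution \<Otimes>\<^sub>M lborel)"
  proof -
    have a: "(\<lambda>p::real\<times>real\<times>real. iexp (n * fst p * (snd (snd p) - fst (snd p)))) \<in> borel_measurable borel"
      by (intro borel_measurable_continuous_onI continuous_intros)
    have b: "(\<lambda>p::real\<times>real\<times>real. F (fst (snd p)) * cnj (F (snd (snd p)))) \<in> borel_measurable borel"
      by (rule measurable_compose[OF _ m0]) (intro borel_measurable_continuous_onI continuous_intros)
    have "(\<lambda>p::real\<times>real\<times>real. ?H (fst p) (snd p)) \<in> borel_measurable borel"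
      by (rule borel_measurable_times[OF b a])
    moreover have "sets (std_normal_distribution \<Otimes>\<^sub>M (lborel :: (real\<times>real) measure)) = sets (borel :: (real\<times>real\<times>real) measure)"
      by (subst borel_prod[symmetric]) (intro sets_pair_measure_cong, auto)
    ultimately show ?thesis by (simp add: split_beta cong: measurable_cong_sets)
  qed
  have int3: "integrable (std_normal_distribution \<Otimes>\<^sub>M lborel) (\<lambda>(w, q). ?H w q)"
  proof (rule P.Fubini_integrable[OF m1])
    show "integrable std_normal_distribution (\<lambda>w. LINT q|lborel. norm (case (w, q) of (w, q) \<Rightarrow> ?H w q))"
      by (simp add: norm_mult)
    have "integrable lborel (?H w)" for w
    proof (rule Bochner_Integration.integrable_bound[OF P0])
      have "(\<lambda>q::real\<times>real. iexp (n * w * (snd q - fst q))) \<in> borel_measurable borel"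
        by (intro borel_measurable_continuous_onI continuous_intros)
      thus "?H w \<in> borel_measurable lborel" using m0 by simp
    qed (auto simp: norm_mult)
    thus "AE w in std_normal_distribution. integrable lborel (\<lambda>q. case (w, q) of (w, q) \<Rightarrow> ?H w q)"
      by simp
  qed
  have charN: "(LINT w|std_normal_distribution. iexp (t * w)) = complex_of_real (exp (- t\<^sup>2 / 2))" for t
    using fun_cong[OF char_std_normal_distribution, of t] unfolding char_def by simp
  have "complex_of_real (LINT w|std_normal_distribution. (norm (fourier F (n * w)))\<^sup>2) =
     (LINT w|std_normal_distribution. complex_of_real ((norm (fourier F (n * w)))\<^sup>2))"
    by (rule integral_complex_of_real[symmetric])
  also have "\<dots> = (LINT w|std_normal_distribution. LINT q|lborel. ?H w q)"
    by (simp only: fourier_norm_sq[OF F] mult.assoc)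
  also have "\<dots> = (LINT q|lborel. LINT w|std_normal_distribution. ?H w q)"
    using P.Fubini_integral[OF int3] by simp
  also have "\<dots> = (LINT q|lborel. F (fst q) * cnj (F (snd q)) * complex_of_real (exp (- (n * (snd q - fst q))\<^sup>2 / 2)))" (is "_ = integral\<^sup>L _ ?K")
  proof (intro Bochner_Integration.integral_cong refl)
    fix q :: "real \<times> real"
    have "(LINT w|std_normal_distribution. ?H w q) = F (fst q) * cnj (F (snd q)) * (LINT w|std_normal_distribution. iexp (n * (snd q - fst q) * w))"
      by (simp add: mult_ac)
    thus "(LINT w|std_normal_distribution. ?H w q) = ?K q" by (simp only: charN)
  qed
  also have "\<dots> = (LINT x|lborel. LINT y|lborel. ?K (x, y))"
  proof -
    have "integrable lborel ?K"
    proof (rule Bochner_Integration.integrable_bound[OF P0])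
      have "(\<lambda>q::real\<times>real. complex_of_real (exp (- (n * (snd q - fst q))\<^sup>2 / 2))) \<in> borel_measurable borel"
        by (intro borel_measurable_continuous_onI continuous_intros) auto
      thus "?K \<in> borel_measurable lborel" using m0 by simp
    qed (auto simp: norm_mult mult_left_le)
    hence "integrable (lborel \<Otimes>\<^sub>M lborel) ?K" unfolding lborel_prod .
    from lborel_pair.integral_fst'[OF this] show ?thesis unfolding lborel_prod by simp
  qed
  finally show ?thesis by simp
qed

lemma gauss_integral:
  "integrable lborel (\<lambda>z::real. exp (- z\<^sup>2 / 2))"
  "(LINT z|lborel. exp (- z\<^sup>2 / 2)) = sqrt (2 * pi)"
proof -
  have e: "exp (- z\<^sup>2 / 2) = sqrt (2 * pi) * std_normal_density z" for z
    by (simp add: std_normal_density_def)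
  show "integrable lborel (\<lambda>z::real. exp (- z\<^sup>2 / 2))" unfolding e by simp
  show "(LINT z|lborel. exp (- z\<^sup>2 / 2)) = sqrt (2 * pi)"
    unfolding e by (subst Bochner_Integration.integral_mult_right_zero) simp
qed

lemma tameD:
  assumes "tame F"
  shows "integrable lborel F" "F \<in> borel_measurable borel" "\<exists>M>0. \<forall>x. norm (F x) \<le> M" "AE x in lborel. isCont F x"
proof -
  show i: "integrable lborel F" using assms by (simp add: tame_def)
  show "F \<in> borel_measurable borel" using borel_measurable_integrable[OF i] by simp
  show "\<exists>M>0. \<forall>x. norm (F x) \<le> M" using assms by (auto simp: tame_def bounded_pos)
  obtain S where S: "finite S" "\<And>x. x \<notin> S \<Longrightarrow> isCont F x" using assms by (auto simp: tame_def)
  have "S \<in> null_sets lborel" using S(1) by (rule finite_imp_null_set_lborel)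
  hence "AE x in lborel. x \<notin> S" by (rule AE_not_in)
  thus "AE x in lborel. isCont F x" by eventually_elim (rule S(2))
qed

lemma tame_sq_integrable:
  assumes "tame F" shows "integrable lborel (\<lambda>x. (norm (F x))\<^sup>2)"
proof -
  note [measurable] = tameD(2)[OF assms]
  obtain M where M: "\<And>x. norm (F x) \<le> M" using tameD(3)[OF assms] by blast
  show ?thesis
    by (rule Bochner_Integration.integrable_bound[of _ "\<lambda>x. M * norm (F x)"])
      (use tameD(1)[OF assms] M in \<open>auto simp: power2_eq_square intro!: mult_right_mono order_trans[OF _ abs_ge_self]\<close>)
qed

text \<open>After the substitution \<open>y = x + z / n\<close> the Gaussian average of the squared transform becomes
  an integral over pairs \<open>F x, F (x + z / n)\<close>, to which dominated convergence applies because \<open>F\<close> is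
  continuous almost everywhere.\<close>

lemma gauss_limit:
  assumes F: "tame F"
  shows "(\<lambda>n. real (Suc n) * (LINT w|std_normal_distribution. (norm (fourier F (real (Suc n) * w)))\<^sup>2))
    \<longlonglongrightarrow> sqrt (2 * pi) * (LINT x|lborel. (norm (F x))\<^sup>2)"
proof -
  note [measurable] = tameD(2)[OF F]
  note iF = tameD(1)[OF F]
  obtain M where M: "M > 0" "\<And>x. norm (F x) \<le> M" using tameD(3)[OF F] by blast
  let ?g = "\<lambda>z::real. complex_of_real (exp (- z\<^sup>2 / 2))"
  let ?K = "\<lambda>n x z. F x * cnj (F (x + z / real (Suc n))) * ?g z"
  let ?J = "\<lambda>n x. LINT z|lborel. ?K n x z"
  have mg [measurable]: "?g \<in> borel_measurable borel" by (intro borel_measurable_continuous_onI continuous_intros) auto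
  have mc [measurable]: "(\<lambda>z. cnj (F z)) \<in> borel_measurable borel" by (rule measurable_compose[OF tameD(2)[OF F]]) (intro borel_measurable_continuous_onI continuous_intros)
  have ig: "integrable lborel (\<lambda>z. exp (- z\<^sup>2 / 2) :: real)" by (rule gauss_integral)
  have igc: "integrable lborel ?g" using ig by (rule integrable_of_real)
  have Ig: "(LINT z|lborel. ?g z) = complex_of_real (sqrt (2 * pi))"
    using gauss_integral(2) by (simp only: integral_complex_of_real)
  \<comment> \<open>The Jacobian \<open>1 / Suc n\<close> of the substitution cancels the prefactor;
    \<open>Suc\<close> keeps the scale nonzero.\<close>
  have step: "complex_of_real (real (Suc n) * (LINT w|std_normal_distribution. (norm (fourier F (real (Suc n) * w)))\<^sup>2))
     = (LINT x|lborel. ?J n x)" for n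
  proof -
    have inner: "(LINT y|lborel. F x * cnj (F y) * complex_of_real (exp (- (real (Suc n) * (y - x))\<^sup>2 / 2)))
       = inverse (complex_of_real (real (Suc n))) * ?J n x" for x
    proof -
      let ?N = "real (Suc n)"
      have N: "?N \<noteq> 0" by (rule of_nat_neq_0)
      have gen: "c * (x + z / c - x) = z" "x + inverse c * z = x + z / c" if "c \<noteq> 0" for c z :: real
        using that by (simp_all add: divide_inverse mult.commute)
      have ab: "\<bar>inverse ?N\<bar> = inverse ?N" by (rule abs_of_nonneg) (rule inverse_nonnegative_iff_nonnegative[THEN iffD2], rule of_nat_0_le_iff)
      show ?thesis
        by (subst lborel_integral_real_affine[OF nonzero_imp_inverse_nonzero[OF N], of _ x])
          (simp only: gen[OF N] ab scaleR_conv_of_real of_real_inverse)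
    qed
    show ?thesis
      unfolding of_real_mult gauss_fourier[OF iF] inner
      by (simp del: of_nat_Suc)
  qed
  have lim: "(\<lambda>n. LINT x|lborel. ?J n x) \<longlonglongrightarrow> (LINT x|lborel. complex_of_real (sqrt (2 * pi)) * complex_of_real ((norm (F x))\<^sup>2))"
  proof (rule integral_dominated_convergence[where w = "\<lambda>x. norm (F x) * (M * sqrt (2 * pi))"])
    show "integrable lborel (\<lambda>x. norm (F x) * (M * sqrt (2 * pi)))" using iF by simp
    show "AE x in lborel. (\<lambda>n. ?J n x) \<longlonglongrightarrow> complex_of_real (sqrt (2 * pi)) * complex_of_real ((norm (F x))\<^sup>2)"
      using tameD(4)[OF F]
    proof eventually_elim
      fix x assume c: "isCont F x"
      have "(\<lambda>n. LINT z|lborel. ?K n x z) \<longlonglongrightarrow> (LINT z|lborel. F x * cnj (F x) * ?g z)"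
      proof (rule integral_dominated_convergence[where w = "\<lambda>z. norm (F x) * M * exp (- z\<^sup>2 / 2)"])
        show "integrable lborel (\<lambda>z. norm (F x) * M * exp (- z\<^sup>2 / 2))" using ig by simp
        have "(\<lambda>n. F (x + z / real (Suc n))) \<longlonglongrightarrow> F x" for z
        proof (rule isCont_tendsto_compose[OF c])
          have "(\<lambda>n. x + z / real (Suc n)) \<longlonglongrightarrow> x + 0"
            using LIMSEQ_Suc[OF lim_const_over_n[of z]] by (intro tendsto_add tendsto_const)
          thus "(\<lambda>n. x + z / real (Suc n)) \<longlonglongrightarrow> x" by simp
        qed
        thus "AE z in lborel. (\<lambda>n. ?K n x z) \<longlonglongrightarrow> F x * cnj (F x) * ?g z"
          by (intro AE_I2 tendsto_intros)
        show "AE z in lborel. norm (?K n x z) \<le> norm (F x) * M * exp (- z\<^sup>2 / 2)" for n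
          using M by (auto simp: norm_mult intro!: mult_right_mono mult_left_mono)
        show "(\<lambda>z. F x * cnj (F x) * ?g z) \<in> borel_measurable lborel" using mg by measurable
        show "?K n x \<in> borel_measurable lborel" for n using mg mc by measurable
      qed
      also have "(LINT z|lborel. F x * cnj (F x) * ?g z) = F x * cnj (F x) * complex_of_real (sqrt (2 * pi))"
        unfolding Ig[symmetric] by simp
      finally show "(\<lambda>n. ?J n x) \<longlonglongrightarrow> complex_of_real (sqrt (2 * pi)) * complex_of_real ((norm (F x))\<^sup>2)"
        by (simp only: complex_norm_square mult.commute)
    qed
    show "AE x in lborel. norm (?J n x) \<le> norm (F x) * (M * sqrt (2 * pi))" for n
    proof (rule AE_I2)
      fix x
      have "norm (?J n x) \<le> (LINT z|lborel. norm (?K n x z))" by (rule integral_norm_bound)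
      also have "\<dots> \<le> (LINT z|lborel. norm (F x) * M * exp (- z\<^sup>2 / 2))"
      proof (rule integral_mono_AE')
        show "integrable lborel (\<lambda>z. norm (F x) * M * exp (- z\<^sup>2 / 2))" using ig by simp
        show "AE z in lborel. norm (?K n x z) \<le> norm (F x) * M * exp (- z\<^sup>2 / 2)"
          using M by (auto simp: norm_mult intro!: mult_right_mono mult_left_mono)
      qed (use M(1) in auto)
      also have "\<dots> = norm (F x) * (M * sqrt (2 * pi))" using gauss_integral(2) by simp
      finally show "norm (?J n x) \<le> norm (F x) * (M * sqrt (2 * pi))" .
    qed
    show "?J n \<in> borel_measurable lborel" for n using mg mc by measurable
  qed measurable
  have "(\<lambda>n. complex_of_real (real (Suc n) * (LINT w|std_normal_distribution. (norm (fourier F (real (Suc n) * w)))\<^sup>2)))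
    \<longlonglongrightarrow> complex_of_real (sqrt (2 * pi) * (LINT x|lborel. (norm (F x))\<^sup>2))"
    unfolding step using lim by (simp only: integral_mult_right_zero integral_complex_of_real of_real_mult)
  thus ?thesis by (simp only: tendsto_of_real_iff)
qed

lemma fourier_bounded:
  assumes "integrable lborel F" shows "norm (fourier F w) \<le> (LINT x|lborel. norm (F x))"
  unfolding fourier_def by (rule order_trans[OF integral_norm_bound]) (simp add: norm_mult)

lemma fourier_measurable [measurable]:
  assumes [measurable]: "F \<in> borel_measurable borel" shows "fourier F \<in> borel_measurable borel"
  unfolding fourier_def by measurable

text \<open>The pointwise bound is averaged against each Gaussian before the limit is taken, so only
  boundedness of the transforms enters. \<open>B\<close> holds exceptional frequencies, a null set
  for every Gaussian.\<close>

lemma plancherel_le: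
  assumes F: "tame F" and G: "tame G" and fin: "finite B" and "\<gamma> \<ge> 0"
    and le: "\<And>w. w \<notin> B \<Longrightarrow> norm (fourier G w) \<le> \<gamma> * norm (fourier F w)"
  shows "(LINT x|lborel. (norm (G x))\<^sup>2) \<le> \<gamma>\<^sup>2 * (LINT x|lborel. (norm (F x))\<^sup>2)"
proof -
  note [measurable] = tameD(2)[OF F] tameD(2)[OF G]
  interpret N: prob_space std_normal_distribution by (rule prob_space_normal_density) simp
  let ?A = "\<lambda>n F. LINT w|std_normal_distribution. (norm (fourier F (real (Suc n) * w)))\<^sup>2"
  have int: "integrable std_normal_distribution (\<lambda>w. (norm (fourier F (n * w)))\<^sup>2)" if "tame F" for F n
  proof (rule N.integrable_const_bound)
    note [measurable] = tameD(2)[OF that]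
    show "AE w in std_normal_distribution. norm ((norm (fourier F (n * w)))\<^sup>2) \<le> (LINT x|lborel. norm (F x))\<^sup>2"
      using fourier_bounded[OF tameD(1)[OF that]] by (auto intro!: power_mono)
    show "(\<lambda>w. (norm (fourier F (n * w)))\<^sup>2) \<in> borel_measurable std_normal_distribution" by measurable
  qed
  have "?A n G \<le> \<gamma>\<^sup>2 * ?A n F" for n
  proof -
    have "(\<lambda>w. w / real (Suc n)) ` B \<in> null_sets lborel" by (intro finite_imp_null_set_lborel finite_imageI fin)
    hence "AE w in lborel. w \<notin> (\<lambda>w. w / real (Suc n)) ` B" by (rule AE_not_in)
    moreover have "real (Suc n) * w \<notin> B" if "w \<notin> (\<lambda>w. w / real (Suc n)) ` B" for w
      using that by (metis image_eqI nonzero_mult_div_cancel_left of_nat_Suc of_nat_neq_0)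
    ultimately have ae: "AE w in std_normal_distribution. real (Suc n) * w \<notin> B"
      by (subst AE_density) auto
    have "?A n G \<le> (LINT w|std_normal_distribution. \<gamma>\<^sup>2 * (norm (fourier F (real (Suc n) * w)))\<^sup>2)"
    proof (rule integral_mono_AE)
      show "integrable std_normal_distribution (\<lambda>w. \<gamma>\<^sup>2 * (norm (fourier F (real (Suc n) * w)))\<^sup>2)"
        using int[OF F] by simp
      show "AE w in std_normal_distribution. (norm (fourier G (real (Suc n) * w)))\<^sup>2 \<le> \<gamma>\<^sup>2 * (norm (fourier F (real (Suc n) * w)))\<^sup>2"
        using ae
      proof eventually_elim
        case (elim w)
        from power_mono[OF le[OF elim], of 2] show ?case by (simp add: power_mult_distrib)
      qed
    qed (rule int[OF G])
    thus ?thesis by simp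
  qed
  hence "\<gamma>\<^sup>2 * (real (Suc n) * ?A n F) \<ge> real (Suc n) * ?A n G" for n
    by (metis mult.left_commute mult_left_mono of_nat_0_le_iff)
  hence "sqrt (2 * pi) * (LINT x|lborel. (norm (G x))\<^sup>2) \<le> \<gamma>\<^sup>2 * (sqrt (2 * pi) * (LINT x|lborel. (norm (F x))\<^sup>2))"
    by (intro LIMSEQ_le[OF gauss_limit[OF G] tendsto_mult_left[OF gauss_limit[OF F]]]) blast
  thus ?thesis by (simp add: field_simps)
qed

text \<open>Plancherel with gain 0 gives \<open>F = 0\<close> almost everywhere. A nonzero value at
  a point of continuity would persist on an interval of positive length.\<close>

lemma fourier_unique:
  assumes F: "tame F" and fin: "finite B" and z: "\<And>w. w \<notin> B \<Longrightarrow> fourier F w = 0" and c: "isCont F x"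
  shows "F x = 0"
proof (rule ccontr)
  assume nz: "F x \<noteq> 0"
  note [measurable] = tameD(2)[OF F]
  have "(LINT x|lborel. (norm (F x))\<^sup>2) \<le> 0\<^sup>2 * (LINT x|lborel. (norm (F x))\<^sup>2)"
    by (rule plancherel_le[OF F F fin]) (auto simp: z)
  hence "(LINT x|lborel. (norm (F x))\<^sup>2) = 0"
    by (intro antisym) (auto intro!: integral_nonneg_AE)
  hence "AE y in lborel. F y = 0"
    by (subst (asm) integral_nonneg_eq_0_iff_AE[OF tame_sq_integrable[OF F]]) auto
  moreover obtain d where d: "d > 0" "\<And>y. dist x y < d \<Longrightarrow> F y \<noteq> 0"
    using continuous_at_avoid[OF c nz] by blast
  hence "F y \<noteq> 0" if "y \<in> {x-d<..<x+d}" for y using that by (auto simp: dist_real_def abs_less_iff)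
  ultimately have "AE y in lborel. y \<notin> {x-d<..<x+d}" by auto
  hence "{x-d<..<x+d} \<in> null_sets lborel" by (subst AE_iff_null_sets) auto
  thus False using d(1) by (simp add: null_sets_def)
qed

section \<open>Convolution with exponentially decaying kernels\<close>

definition conv :: "(real \<Rightarrow> complex) \<Rightarrow> (real \<Rightarrow> complex) \<Rightarrow> real \<Rightarrow> complex" where
  "conv k F t = (LINT u|lborel. k (t - u) * F u)"

lemma conv_integrable_fourier:
  assumes k: "integrable lborel k" and F: "integrable lborel F"
  shows "integrable lborel (conv k F)" "fourier (conv k F) w = fourier k w * fourier F w"
proof -
  have [measurable]: "k \<in> borel_measurable borel" "F \<in> borel_measurable borel"
    using k F by (simp_all add: borel_measurable_integrable)
  have kt: "integrable lborel (\<lambda>t. k (t - u))" for u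
    using lborel_integrable_real_affine[OF k, of 1 "-u"] by simp
  have It: "(LINT t|lborel. G (t - u)) = (LINT t|lborel. G t)" for u and G :: "real \<Rightarrow> 'b :: {banach, second_countable_topology}"
    by (subst (2) lborel_integral_real_affine[of 1 _ "-u"]) simp_all
  have int: "integrable (lborel \<Otimes>\<^sub>M lborel) (\<lambda>(u, t). k (t - u) * F u)"
  proof (rule lborel_pair.Fubini_integrable)
    show "integrable lborel (\<lambda>u. LBINT t. norm (case (u, t) of (u, t) \<Rightarrow> k (t - u) * F u))"
      using F It[of "\<lambda>t. norm (k t)"] by (simp add: norm_mult)
    show "AE u in lborel. integrable lborel (\<lambda>t. case (u, t) of (u, t) \<Rightarrow> k (t - u) * F u)"
      using kt by simp
  qed measurable
  have int': "integrable (lborel \<Otimes>\<^sub>M lborel) (\<lambda>(u, t). iexp (-(w * t)) * (k (t - u) * F u))"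
  proof (rule Bochner_Integration.integrable_bound[OF int])
    have "(\<lambda>p::real\<times>real. iexp (-(w * snd p))) \<in> borel_measurable borel"
      by (intro borel_measurable_continuous_onI continuous_intros)
    hence [measurable]: "(\<lambda>p::real\<times>real. iexp (-(w * snd p))) \<in> borel_measurable (lborel \<Otimes>\<^sub>M lborel)"
      by (simp add: lborel_prod)
    show "(\<lambda>(u, t). iexp (-(w * t)) * (k (t - u) * F u)) \<in> borel_measurable (lborel \<Otimes>\<^sub>M lborel)"
      unfolding case_prod_unfold by measurable
  qed (auto simp: norm_mult)
  show "integrable lborel (conv k F)"
    using lborel_pair.integrable_snd[OF int] unfolding conv_def[abs_def] by simp
  have "fourier (conv k F) w = (LINT t|lborel. LINT u|lborel. iexp (-(w * t)) * (k (t - u) * F u))"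
    unfolding fourier_def conv_def by simp
  also have "\<dots> = (LINT u|lborel. LINT t|lborel. iexp (-(w * t)) * (k (t - u) * F u))"
    by (rule lborel_pair.Fubini_integral[OF int'])
  also have "\<dots> = (LINT u|lborel. fourier k w * (iexp (-(w * u)) * F u))"
  proof (intro Bochner_Integration.integral_cong refl)
    fix u
    have e: "iexp (-(w * t)) = iexp (-(w * (t - u))) * iexp (-(w * u))" for t
      unfolding mult_exp_exp by (simp add: algebra_simps)
    have "iexp (-(w * t)) * (k (t - u) * F u) = iexp (-(w * (t - u))) * k (t - u) * (iexp (-(w * u)) * F u)" for t
      by (subst e) (simp only: mult_ac)
    hence c: "(\<lambda>t. iexp (-(w * t)) * (k (t - u) * F u)) = (\<lambda>t. iexp (-(w * (t - u))) * k (t - u) * (iexp (-(w * u)) * F u))" by (rule ext)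
    have "(LINT t|lborel. iexp (-(w * t)) * (k (t - u) * F u))
      = (LINT t|lborel. (\<lambda>t. iexp (-(w * t)) * k t) (t - u)) * (iexp (-(w * u)) * F u)"
      unfolding c by (rule integral_mult_left_zero)
    also have "\<dots> = fourier k w * (iexp (-(w * u)) * F u)" by (simp only: It[of "\<lambda>t. iexp (-(w * t)) * k t" u] fourier_def)
    finally show "(LINT t|lborel. iexp (-(w * t)) * (k (t - u) * F u)) = fourier k w * (iexp (-(w * u)) * F u)" .
  qed
  also have "\<dots> = fourier k w * fourier F w" unfolding fourier_def by simp
  finally show "fourier (conv k F) w = fourier k w * fourier F w" .
qed

text \<open>The finitely many discontinuities of the kernel are met on a null set of
  \<open>u\<close> only, so dominated convergence makes the convolution continuous
  everywhere.\<close>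

lemma tame_conv:
  assumes k: "tame k" and F: "tame F"
  shows "tame (conv k F)" "isCont (conv k F) t"
proof -
  note [measurable] = tameD(2)[OF k] tameD(2)[OF F]
  note ik = tameD(1)[OF k] and iF = tameD(1)[OF F]
  obtain M where M: "M > 0" "\<And>x. norm (k x) \<le> M" using tameD(3)[OF k] by blast
  obtain S where S: "finite S" "\<And>x. x \<notin> S \<Longrightarrow> isCont k x" using k by (auto simp: tame_def)
  have bd: "norm (conv k F t) \<le> M * (LINT u|lborel. norm (F u))" for t
  proof -
    have "norm (conv k F t) \<le> (LINT u|lborel. norm (k (t - u) * F u))"
      unfolding conv_def by (rule integral_norm_bound)
    also have "\<dots> \<le> (LINT u|lborel. M * norm (F u))"
      by (rule integral_mono_AE') (use iF M in \<open>auto simp: norm_mult intro!: mult_right_mono\<close>)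
    finally show ?thesis by simp
  qed
  have cont: "isCont (conv k F) t" for t
  proof (rule continuous_at_sequentiallyI)
    fix x assume x: "x \<longlonglongrightarrow> t"
    show "(\<lambda>n. conv k F (x n)) \<longlonglongrightarrow> conv k F t" unfolding conv_def
    proof (rule integral_dominated_convergence[where w = "\<lambda>u. M * norm (F u)"])
      have "(\<lambda>s. t - s) ` S \<in> null_sets lborel" by (intro finite_imp_null_set_lborel finite_imageI S(1))
      hence "AE u in lborel. u \<notin> (\<lambda>s. t - s) ` S" by (rule AE_not_in)
      thus "AE u in lborel. (\<lambda>n. k (x n - u) * F u) \<longlonglongrightarrow> k (t - u) * F u"
      proof eventually_elim
        case (elim u)
        have "isCont k (t - u)" by (rule S(2)) (use elim in \<open>auto simp: image_iff algebra_simps\<close>)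
        thus ?case by (intro tendsto_intros isCont_tendsto_compose[of _ k] x)
      qed
    qed (use iF M in \<open>auto simp: norm_mult intro!: mult_right_mono\<close>)
  qed
  show "isCont (conv k F) t" by (rule cont)
  show "tame (conv k F)" unfolding tame_def
    using conv_integrable_fourier(1)[OF ik iF] bd cont by (auto simp: bounded_iff intro!: exI[of _ "{}"])
qed

section \<open>Causal kernels with exponential decay\<close>

text \<open>Impulse responses of strictly proper stable rational functions. A single pole already
  produces the jump at 0; vanishing for \<open>t < 0\<close> is causality.\<close>

definition decaying :: "(real \<Rightarrow> complex) \<Rightarrow> bool" where
  "decaying k \<longleftrightarrow> (\<exists>C a. 0 < a \<and> (\<forall>t\<ge>0. norm (k t) \<le> C * exp (- (a * t)))) \<and> (\<forall>t<0. k t = 0) \<and> (\<forall>t. t \<noteq> 0 \<longrightarrow> isCont k t)"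

lemma integrable_exp_decay:
  assumes "a > 0" shows "integrable lborel (\<lambda>t::real. indicator {0..} t * exp (- (a * t)) :: real)"
proof -
  have "set_integrable lborel (einterval 0 \<infinity>) (\<lambda>t. exp (- (a * t)))"
  proof (rule interval_integral_FTC_nonneg(1)[where F = "\<lambda>t. - exp (- (a * t)) / a"])
    show "(((\<lambda>t. - exp (- (a * t)) / a) \<circ> real_of_ereal) \<longlongrightarrow> - 1 / a) (at_right 0)"
      using assms unfolding zero_ereal_def ereal_tendsto_simps by (auto intro!: tendsto_eq_intros)
    have "((\<lambda>t. - exp (- (a * t)) / a) \<longlongrightarrow> - 0 / a) at_top"
      using assms
      by (intro tendsto_intros filterlim_compose[OF exp_at_bot])
        (auto simp: filterlim_uminus_at_bot intro!: filterlim_tendsto_pos_mult_at_top filterlim_ident)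
    thus "(((\<lambda>t. - exp (- (a * t)) / a) \<circ> real_of_ereal) \<longlongrightarrow> 0) (at_left \<infinity>)"
      unfolding ereal_tendsto_simps by simp
  qed (use assms in \<open>auto intro!: derivative_eq_intros continuous_intros simp: field_simps\<close>)
  hence "integrable lborel (\<lambda>t. indicator {0<..} t *\<^sub>R exp (- (a * t)))"
    by (simp add: set_integrable_def einterval_def zero_ereal_def greaterThan_def)
  moreover have "AE t in lborel. indicator {0<..} t *\<^sub>R exp (- (a * t)) = (indicator {0..} t * exp (- (a * t)) :: real)"
    using AE_lborel_singleton[of "0::real"] by eventually_elim (auto simp: indicator_def)
  ultimately show ?thesis by (subst integrable_cong_AE[symmetric]) auto
qed

lemma decaying_bound:
  assumes "decaying k"
  obtains C a where "C > 0" "0 < a" "\<And>t. norm (k t) \<le> C * (indicator {0..} t * exp (- (a * t)))"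
proof -
  obtain C a where a: "0 < a" "\<And>t. t \<ge> 0 \<Longrightarrow> norm (k t) \<le> C * exp (- (a * t))" and z: "\<And>t. t < 0 \<Longrightarrow> k t = 0"
    using assms unfolding decaying_def by blast
  have "norm (k t) \<le> (\<bar>C\<bar> + 1) * (indicator {0..} t * exp (- (a * t)))" for t
  proof (cases "t \<ge> 0")
    case True
    have "C * exp (- (a * t)) \<le> (\<bar>C\<bar> + 1) * exp (- (a * t))" by (intro mult_right_mono) auto
    from order_trans[OF a(2)[OF True] this] show ?thesis using True by simp
  qed (simp add: z)
  from that[OF _ a(1) this] show ?thesis by simp
qed

lemma decaying_nice:
  assumes k: "decaying k" shows "tame k"
proof -
  obtain C a where C: "C > 0" "0 < a" "\<And>t. norm (k t) \<le> C * (indicator {0..} t * exp (- (a * t)))"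
    by (rule decaying_bound[OF k]) blast
  have cont: "isCont k t" if "t \<noteq> 0" for t using k that by (auto simp: decaying_def)
  have "continuous_on (- {0}) k" using cont by (auto intro!: continuous_at_imp_continuous_on)
  hence m: "k \<in> borel_measurable borel" by (rule borel_measurable_continuous_countable_exceptions[rotated]) simp
  have "integrable lborel k"
    by (rule Bochner_Integration.integrable_bound[where f = "\<lambda>t. C * (indicator {0..} t * exp (- (a * t)))"])
      (use integrable_exp_decay[OF C(2)] m C in \<open>auto intro!: AE_I2 order_trans[OF C(3)]\<close>)
  moreover have "norm (k t) \<le> C" for t
    by (rule order_trans[OF C(3)]) (use C(1,2) in \<open>auto simp: indicator_def mult_left_le\<close>)
  ultimately show ?thesis unfolding tame_def using cont
    by (auto simp: bounded_iff intro!: exI[of _ "{0}"])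
qed

lemma decaying_add: assumes "decaying j" "decaying k" shows "decaying (\<lambda>t. c * j t + k t)"
proof -
  obtain C a where C: "C > 0" "0 < a" "\<And>t. norm (j t) \<le> C * (indicator {0..} t * exp (- (a * t)))"
    by (rule decaying_bound[OF assms(1)]) blast
  obtain D b where D: "D > 0" "0 < b" "\<And>t. norm (k t) \<le> D * (indicator {0..} t * exp (- (b * t)))"
    by (rule decaying_bound[OF assms(2)]) blast
  have "norm (c * j t + k t) \<le> (norm c * C + D) * exp (- (min a b * t))" if "t \<ge> 0" for t
  proof -
    have e: "exp (- (a * t)) \<le> exp (- (min a b * t))" "exp (- (b * t)) \<le> exp (- (min a b * t))"
      using that by (auto intro!: mult_right_mono)
    have "norm (c * j t + k t) \<le> norm c * (C * exp (- (a * t))) + D * exp (- (b * t))"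
      using C(3)[of t] D(3)[of t] that
      by (intro norm_triangle_le add_mono) (auto simp: norm_mult intro!: mult_left_mono)
    also have "\<dots> \<le> norm c * (C * exp (- (min a b * t))) + D * exp (- (min a b * t))"
      using C(1) D(1) e by (intro add_mono mult_left_mono) auto
    finally show ?thesis by (simp add: algebra_simps)
  qed
  thus ?thesis unfolding decaying_def using assms C(2) D(2)
    by (intro conjI exI[of _ "norm c * C + D"] exI[of _ "min a b"]) (auto simp: decaying_def intro!: continuous_intros)
qed

lemma decaying_conv:
  assumes "decaying j" "decaying k" shows "decaying (conv j k)"
proof -
  obtain C a where C: "C > 0" "0 < a" "\<And>t. norm (j t) \<le> C * (indicator {0..} t * exp (- (a * t)))"
    by (rule decaying_bound[OF assms(1)]) blast
  obtain D b where D: "D > 0" "0 < b" "\<And>t. norm (k t) \<le> D * (indicator {0..} t * exp (- (b * t)))"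
    by (rule decaying_bound[OF assms(2)]) blast
  define m where "m = min a b"
  have m: "m > 0" using C D by (simp add: m_def)
  \<comment> \<open>With the smaller rate \<open>m\<close> on both factors the bound no longer
    depends on \<open>u\<close>, so integration just multiplies it by the window length
    \<open>t\<close>.\<close>
  have pt: "norm (j (t - u) * k u) \<le> C * D * exp (- (m * t)) * indicator {0..t} u" for t u
  proof (cases "0 \<le> u \<and> u \<le> t")
    case True
    have "norm (j (t - u) * k u) \<le> (C * exp (- (a * (t - u)))) * (D * exp (- (b * u)))"
      unfolding norm_mult using C(3)[of "t - u"] D(3)[of u] True C(1) by (intro mult_mono) auto
    also have "\<dots> \<le> (C * exp (- (m * (t - u)))) * (D * exp (- (m * u)))"
      using C(1) D(1) True by (intro mult_mono mult_left_mono) (auto simp: m_def intro!: mult_right_mono)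
    also have "\<dots> = C * D * exp (- (m * t))"
      by (simp add: exp_add[symmetric] algebra_simps mult_exp_exp)
    finally show ?thesis using True by simp
  next
    case False
    hence "j (t - u) = 0 \<or> k u = 0" using assms unfolding decaying_def by auto
    thus ?thesis using False C D by auto
  qed
  have bd: "norm (conv j k t) \<le> C * D * exp (- (m * t)) * t" if "t \<ge> 0" for t
  proof -
    have "norm (conv j k t) \<le> (LINT u|lborel. norm (j (t - u) * k u))"
      unfolding conv_def by (rule integral_norm_bound)
    also have "\<dots> \<le> (LINT u|lborel. C * D * exp (- (m * t)) * indicator {0..t} u)"
      by (rule integral_mono_AE') (use pt C D in \<open>auto simp: emeasure_lborel_Icc_eq\<close>)
    also have "\<dots> = C * D * exp (- (m * t)) * t" using that by simp
    finally show ?thesis .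
  qed
  \<comment> \<open>The factor \<open>t\<close> is absorbed by giving up half of the decay
    rate.\<close>
  have bd2: "norm (conv j k t) \<le> C * D * (2 / m) * exp (- (m / 2 * t))" if "t \<ge> 0" for t
  proof -
    have "t \<le> (2 / m) * exp (m / 2 * t)"
      using exp_ge_add_one_self[of "m / 2 * t"] m by (simp add: field_simps)
    hence "C * D * exp (- (m * t)) * t \<le> C * D * exp (- (m * t)) * ((2 / m) * exp (m / 2 * t))"
      using C D by (intro mult_left_mono) auto
    also have "\<dots> = C * D * (2 / m) * exp (- (m / 2 * t))"
      by (simp add: mult_exp_exp field_simps)
    finally show ?thesis using bd[OF that] by linarith
  qed
  have "conv j k t = 0" if "t < 0" for t
  proof -
    have "j (t - u) * k u = 0" for u using pt[of t u] that by (auto simp: indicator_def)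
    hence "(\<lambda>u. j (t - u) * k u) = (\<lambda>u. 0)" by (rule ext)
    thus ?thesis by (simp only: conv_def integral_zero)
  qed
  thus ?thesis unfolding decaying_def
    using m bd2 tame_conv(2)[OF decaying_nice[OF assms(1)] decaying_nice[OF assms(2)]]
    by (intro conjI exI[of _ "C * D * (2 / m)"] exI[of _ "m / 2"]) auto
qed

definition exp_kernel :: "complex \<Rightarrow> real \<Rightarrow> complex" where
  "exp_kernel p t = (if t < 0 then 0 else exp (p * complex_of_real t))"

lemma decaying_exp_kernel:
  assumes p: "Re p < 0"
  shows "decaying (exp_kernel p)"
    and "fourier (exp_kernel p) w = 1 / (\<i> * complex_of_real w - p)"
proof -
  let ?k = "exp_kernel p"
  have n: "norm (exp (p * complex_of_real t)) = exp (- ((- Re p) * t))" for t by simp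
  have cont: "isCont ?k t" if "t \<noteq> 0" for t
  proof (cases "t < 0")
    case True
    have "\<forall>\<^sub>F x in nhds t. x \<in> {..<0}" using True by (intro eventually_nhds_in_open) auto
    hence "\<forall>\<^sub>F x in nhds t. ?k x = 0" by eventually_elim (simp add: exp_kernel_def)
    thus ?thesis by (subst isCont_cong) auto
  next
    case False
    with that have "\<forall>\<^sub>F x in nhds t. x \<in> {0<..}" by (intro eventually_nhds_in_open) auto
    hence "\<forall>\<^sub>F x in nhds t. ?k x = exp (p * complex_of_real x)" by eventually_elim (simp add: exp_kernel_def)
    thus ?thesis by (subst isCont_cong) (auto intro!: continuous_intros)
  qed
  show k: "decaying ?k" unfolding decaying_def using p n cont
    by (intro conjI exI[of _ 1] exI[of _ "- Re p"]) (auto simp: exp_kernel_def)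
  define q where "q = p - \<i> * complex_of_real w"
  have q1: "Re q < 0" using p by (simp add: q_def)
  hence q: "Re q < 0" "q \<noteq> 0" by auto
  have eq: "iexp (-(w * x)) * ?k x = (if x < 0 then 0 else exp (q * complex_of_real x))" for x
    by (simp add: q_def mult_exp_exp algebra_simps exp_kernel_def)
  have "integrable lborel (\<lambda>x. iexp (-(w * x)) * ?k x)"
    using integrable_iexp_uminus_mult[OF tameD(1)[OF decaying_nice[OF k]]] .
  hence int: "integrable lborel (\<lambda>x. if x < 0 then 0 else exp (q * complex_of_real x))" unfolding eq .
  have ae: "AE x in lborel. indicator {0<..} x *\<^sub>R exp (q * complex_of_real x) = (if x < 0 then 0 else exp (q * complex_of_real x))"
    using AE_lborel_singleton[of "0::real"] by eventually_elim (auto simp: indicator_def)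
  have [measurable]: "(\<lambda>x. exp (q * complex_of_real x)) \<in> borel_measurable borel"
    by (intro borel_measurable_continuous_onI continuous_intros)
  have int': "integrable lborel (\<lambda>x. indicator {0<..} x *\<^sub>R exp (q * complex_of_real x))"
    using int by (subst integrable_cong_AE[OF _ _ ae]) auto
  have e: "einterval 0 \<infinity> = {0<..}" by (simp add: einterval_def zero_ereal_def greaterThan_def)
  have "fourier ?k w = (LINT x|lborel. indicator {0<..} x *\<^sub>R exp (q * complex_of_real x))"
    unfolding fourier_def eq using ae int int' by (intro integral_cong_AE) (auto simp: borel_measurable_integrable eq_commute)
  also have "\<dots> = interval_lebesgue_integral lborel 0 \<infinity> (\<lambda>x. exp (q * complex_of_real x))"
    by (simp add: interval_lebesgue_integral_def set_lebesgue_integral_def e)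
  also have "\<dots> = 0 - 1 / q"
  proof (rule interval_integral_FTC_integrable[where F = "\<lambda>x. exp (q * complex_of_real x) / q"])
    show "set_integrable lborel (einterval 0 \<infinity>) (\<lambda>x. exp (q * complex_of_real x))"
      unfolding set_integrable_def e by (rule int')
    show "((\<lambda>x. exp (q * complex_of_real x) / q) has_vector_derivative exp (q * complex_of_real x)) (at x)" for x
      using q(2) by (auto intro!: derivative_eq_intros has_vector_derivative_real_field simp: has_real_derivative_iff_has_vector_derivative[symmetric])
    show "(((\<lambda>x. exp (q * complex_of_real x) / q) \<circ> real_of_ereal) \<longlongrightarrow> 1 / q) (at_right 0)"
      unfolding zero_ereal_def ereal_tendsto_simps using q(2) by (auto intro!: tendsto_eq_intros)
    have "((\<lambda>x::real. exp (Re q * x)) \<longlongrightarrow> 0) at_top"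
      using q(1) by (intro filterlim_compose[OF exp_at_bot] filterlim_tendsto_neg_mult_at_bot[OF tendsto_const _ filterlim_ident])
    hence "((\<lambda>x. exp (q * complex_of_real x)) \<longlongrightarrow> 0) at_top"
      by (intro tendsto_norm_zero_cancel[of "\<lambda>x. exp (q * complex_of_real x)"]) simp
    hence "((\<lambda>x. exp (q * complex_of_real x) / q) \<longlongrightarrow> 0 / q) at_top"
      by (intro tendsto_divide tendsto_const q(2))
    thus "(((\<lambda>x. exp (q * complex_of_real x) / q) \<circ> real_of_ereal) \<longlongrightarrow> 0) (at_left \<infinity>)"
      unfolding ereal_tendsto_simps by simp
  qed (auto intro!: continuous_intros)
  also have "\<dots> = 1 / (\<i> * complex_of_real w - p)"
    using q(2) by (simp add: q_def divide_simps)
  finally show "fourier ?k w = 1 / (\<i> * complex_of_real w - p)" .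
qed

lemma fourier_add:
  assumes "integrable lborel F" "integrable lborel G"
  shows "fourier (\<lambda>t. c * F t + G t) w = c * fourier F w + fourier G w"
proof -
  have "fourier (\<lambda>t. c * F t + G t) w = (LINT x|lborel. c * (iexp (-(w * x)) * F x) + iexp (-(w * x)) * G x)"
    unfolding fourier_def by (simp add: algebra_simps)
  also have "\<dots> = c * fourier F w + fourier G w"
    unfolding fourier_def using integrable_iexp_uminus_mult[OF assms(1)] integrable_iexp_uminus_mult[OF assms(2)]
    by (subst Bochner_Integration.integral_add) auto
  finally show ?thesis .
qed

text \<open>One root \<open>p\<close> of \<open>d\<close> is split off at a time:
  \<open>n / d = (c + r / d1) / (s - p)\<close> with \<open>r = n mod d1\<close>. Its kernel is
  \<open>c\<close> times the exponential of \<open>p\<close> plus the convolution of that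
  exponential with the kernel of \<open>r / d1\<close>. Multiple roots are covered without partial
  fractions.\<close>

lemma decaying_rational:
  fixes n d :: "complex poly"
  assumes "d \<noteq> 0" "\<And>s. poly d s = 0 \<Longrightarrow> Re s < 0" "n = 0 \<or> degree n < degree d"
  shows "\<exists>k. decaying k \<and> (\<forall>w. fourier k w = poly n (\<i> * complex_of_real w) / poly d (\<i> * complex_of_real w))"
  using assms
proof (induction "degree d" arbitrary: n d)
  case 0
  hence "n = 0" by simp
  moreover have "decaying (\<lambda>_. 0)" unfolding decaying_def by (auto intro!: exI[of _ 1])
  ultimately show ?case by (intro exI[of _ "\<lambda>_. 0"]) (simp add: fourier_def)
next
  case (Suc m)
  have "\<not> constant (poly d)" using Suc.hyps(2) by (simp add: constant_degree)
  then obtain p where p: "poly d p = 0" using fundamental_theorem_of_algebra by blast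
  then obtain d1 where d1: "d = [:- p, 1:] * d1" by (metis dvdE poly_eq_0_iff_dvd)
  have d1_nz: "d1 \<noteq> 0" using d1 Suc.prems(1) by auto
  have deg: "degree d1 = m" using Suc.hyps(2) d1_nz unfolding d1 by (subst (asm) degree_mult_eq) auto
  have Rp: "Re p < 0" by (rule Suc.prems(2)[OF p])
  \<comment> \<open>Strict properness of \<open>n / d\<close> leaves
    \<open>degree n <= degree d1\<close>, so the quotient by \<open>d1\<close> is a
    constant.\<close>
  define c where "c = coeff (n div d1) 0"
  have "degree n \<le> degree d1" using Suc.prems(3) Suc.hyps(2) deg by auto
  have "degree (n div d1) = 0"
  proof (rule ccontr)
    assume pos: "degree (n div d1) \<noteq> 0"
    hence nz: "n div d1 \<noteq> 0" by auto
    have gt: "degree ((n div d1) * d1) > degree d1" using pos nz d1_nz by (simp add: degree_mult_eq)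
    have "n mod d1 = 0 \<or> degree (n mod d1) < degree d1" by (rule degree_mod_less[OF d1_nz])
    hence "degree (n mod d1) < degree ((n div d1) * d1)" using gt by auto
    hence "degree ((n div d1) * d1 + n mod d1) = degree ((n div d1) * d1)" by (rule degree_add_eq_left)
    with gt \<open>degree n \<le> degree d1\<close> show False by simp
  qed
  hence ndiv: "n div d1 = [:c:]" unfolding c_def by (metis degree_0_id)
  have nd: "n = [:c:] * d1 + n mod d1" unfolding ndiv[symmetric] by (rule div_mult_mod_eq[symmetric])
  have "n mod d1 = 0 \<or> degree (n mod d1) < degree d1" by (rule degree_mod_less[OF d1_nz])
  then obtain k1 where k1: "decaying k1" "\<And>w. fourier k1 w = poly (n mod d1) (\<i> * complex_of_real w) / poly d1 (\<i> * complex_of_real w)"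
    using Suc.hyps(1)[OF deg[symmetric] d1_nz, of "n mod d1"] Suc.prems(2) d1 by force
  let ?e = "exp_kernel p"
  have e: "decaying ?e" "\<And>w. fourier ?e w = 1 / (\<i> * complex_of_real w - p)" by (rule decaying_exp_kernel[OF Rp])+
  let ?k = "\<lambda>t. c * ?e t + conv ?e k1 t"
  have k: "decaying ?k" by (rule decaying_add[OF e(1) decaying_conv[OF e(1) k1(1)]])
  have "fourier ?k w = poly n (\<i> * complex_of_real w) / poly d (\<i> * complex_of_real w)" for w
  proof -
    let ?s = "\<i> * complex_of_real w"
    have sp: "?s - p \<noteq> 0" using Rp by (auto simp: complex_eq_iff)
    have d1s: "poly d1 ?s \<noteq> 0" using Suc.prems(2)[of ?s] d1 by auto
    have "fourier ?k w = c * fourier ?e w + fourier (conv ?e k1) w"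
      by (intro fourier_add tameD(1) decaying_nice e(1) decaying_conv k1(1))
    also have "fourier (conv ?e k1) w = fourier ?e w * fourier k1 w"
      by (intro conv_integrable_fourier(2) tameD(1) decaying_nice e(1) k1(1))
    also have "c * fourier ?e w + fourier ?e w * fourier k1 w = poly ([:c:] * d1 + n mod d1) ?s / poly d ?s"
      unfolding e(2) k1(2) d1 using sp d1s by (simp add: divide_simps) (simp add: algebra_simps)
    finally show ?thesis unfolding nd[symmetric] .
  qed
  with k show ?case by blast
qed

section \<open>Evaluation of transfer functions\<close>

abbreviation cpoly :: "real poly \<Rightarrow> complex poly" where "cpoly \<equiv> map_poly complex_of_real"

abbreviation tf_num :: "tf \<Rightarrow> real poly" where "tf_num h \<equiv> fst (quot_of_fract h)"
abbreviation tf_den :: "tf \<Rightarrow> real poly" where "tf_den h \<equiv> snd (quot_of_fract h)"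

lemma tf_den_nonzero [simp]: "tf_den h \<noteq> 0"
  by simp

lemma cpoly_hom:
  "cpoly (p + q) = cpoly p + cpoly q" "cpoly (p * q) = cpoly p * cpoly q" "cpoly 1 = 1"
  "cpoly (- p) = - cpoly p"
  "cpoly p = 0 \<longleftrightarrow> p = 0" "degree (cpoly p) = degree p"
  by (simp_all add: poly_eq_iff coeff_map_poly coeff_mult degree_map_poly)

text \<open>A common factor of \<open>p\<close> and \<open>q\<close> does not vanish at
  \<open>s\<close> when \<open>q\<close> does not, so passing to lowest terms keeps the
  value.\<close>

lemma tf_eval_Fract:
  assumes "poly (cpoly q) s \<noteq> 0"
  shows "tf_eval (Fract p q) s = poly (cpoly p) s / poly (cpoly q) s"
proof -
  have q: "q \<noteq> 0" using assms by auto
  have e: "quot_of_fract (Fract p q) = normalize_quot (p, q)"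
    using quot_of_fract_quot_to_fract[of "(p, q)"] by (simp add: quot_to_fract_def)
  obtain d where d: "p = fst (normalize_quot (p, q)) * d" "q = snd (normalize_quot (p, q)) * d"
    using normalize_quotE[OF q] by metis
  define a b where "a = fst (normalize_quot (p, q))" and "b = snd (normalize_quot (p, q))"
  have "poly (cpoly d) s \<noteq> 0" "poly (cpoly p) s = poly (cpoly a) s * poly (cpoly d) s"
    "poly (cpoly q) s = poly (cpoly b) s * poly (cpoly d) s"
    using assms d by (metis a_def b_def cpoly_hom(2) mult_zero_right poly_mult)+
  thus ?thesis unfolding tf_eval_def e a_def[symmetric] b_def[symmetric] by simp
qed

lemma cofinite_poly_nonzero:
  assumes "q \<noteq> 0" shows "\<forall>\<^sub>F s in cofinite. poly (cpoly q) s \<noteq> 0"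
  unfolding eventually_cofinite using poly_roots_finite[of "cpoly q"] assms by (simp add: cpoly_hom)

lemma tf_cases:
  fixes h :: tf
  obtains p q where "h = Fract p q" "q \<noteq> 0"
  using Fract_quot_of_fract[of h] tf_den_nonzero[of h] by metis

text \<open>Evaluation uses lowest terms and gives 0 at a pole, so it respects the field operations
  only off a finite set: \<open>s * (1 / s)\<close> is 1, yet the product of the two values at 0 is
  0. This is why the filter \<open>cofinite\<close> appears throughout.\<close>

lemma tf_eval_add: "\<forall>\<^sub>F s in cofinite. tf_eval (a + b) s = tf_eval a s + tf_eval b s"
proof -
  obtain p q where a: "a = Fract p q" "q \<noteq> 0" by (rule tf_cases)
  obtain p' q' where b: "b = Fract p' q'" "q' \<noteq> 0" by (rule tf_cases)
  show ?thesis using cofinite_poly_nonzero[OF a(2)] cofinite_poly_nonzero[OF b(2)]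
    by eventually_elim (simp add: a b tf_eval_Fract cpoly_hom add_frac_eq)
qed

lemma tf_eval_mult: "\<forall>\<^sub>F s in cofinite. tf_eval (a * b) s = tf_eval a s * tf_eval b s"
proof -
  obtain p q where a: "a = Fract p q" "q \<noteq> 0" by (rule tf_cases)
  obtain p' q' where b: "b = Fract p' q'" "q' \<noteq> 0" by (rule tf_cases)
  show ?thesis using cofinite_poly_nonzero[OF a(2)] cofinite_poly_nonzero[OF b(2)]
    by eventually_elim (simp add: a b tf_eval_Fract cpoly_hom field_simps)
qed

lemma tf_eval_uminus: "tf_eval (- a) s = - tf_eval a s"
  unfolding tf_eval_def by (cases "quot_of_fract a") (simp add: quot_of_fract_uminus cpoly_hom)

lemma tf_eval_0 [simp]: "tf_eval 0 s = 0" and tf_eval_1 [simp]: "tf_eval 1 s = 1"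
  by (simp_all add: tf_eval_def)

lemma tf_eval_const [simp]: "tf_eval (tf_const c) s = complex_of_real c"
  unfolding tf_const_def by (subst tf_eval_Fract) (auto simp: of_real_hom.map_poly_pCons_hom)

lemma tf_eval_s [simp]: "tf_eval tf_s s = s"
  unfolding tf_s_def by (subst tf_eval_Fract) (auto simp: of_real_hom.map_poly_pCons_hom)

lemma tf_eval_nonzero:
  assumes "a \<noteq> 0" shows "\<forall>\<^sub>F s in cofinite. tf_eval a s \<noteq> 0"
proof -
  have "tf_num a \<noteq> 0" using assms by (metis Fract_quot_of_fract fract_collapse(1))
  from cofinite_poly_nonzero[OF this] cofinite_poly_nonzero[OF tf_den_nonzero[of a]]
  show ?thesis by eventually_elim (simp add: tf_eval_def)
qed

lemma tf_eval_inverse: "\<forall>\<^sub>F s in cofinite. tf_eval (inverse a) s = inverse (tf_eval a s)"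
proof (cases "a = 0")
  case False
  from tf_eval_mult[of a "inverse a"] tf_eval_nonzero[OF False]
  show ?thesis by eventually_elim (use False in \<open>simp add: field_simps\<close>)
qed simp

lemma tf_eval_sum:
  assumes "finite A"
  shows "\<forall>\<^sub>F s in cofinite. tf_eval (\<Sum>i\<in>A. f i) s = (\<Sum>i\<in>A. tf_eval (f i) s)"
  using assms
proof induction
  case (insert x A)
  from insert.IH tf_eval_add[of "f x" "\<Sum>i\<in>A. f i"] show ?case
    by eventually_elim (simp add: insert.hyps)
qed simp

lemma infinite_right_half_plane: "infinite {s::complex. Re s > 0}"
proof
  assume "finite {s::complex. Re s > 0}"
  hence "finite (Re ` {s::complex. Re s > 0})" by simp
  moreover have "{0<..} \<subseteq> Re ` {s::complex. Re s > 0}"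
    by (auto intro!: image_eqI[of _ Re "complex_of_real _"])
  ultimately have "finite {0::real<..}" by (rule rev_finite_subset)
  thus False using infinite_Ioi by blast
qed

lemma cofinite_RHP_ex:
  assumes "\<forall>\<^sub>F s in cofinite. P s" shows "\<exists>s. Re s > 0 \<and> P s"
proof (rule ccontr)
  assume "\<not> ?thesis"
  hence "{s. Re s > 0} \<subseteq> {s. \<not> P s}" by auto
  with assms infinite_right_half_plane show False
    unfolding eventually_cofinite by (meson finite_subset)
qed

text \<open>A nonzero rational function has finitely many zeros, too few for a half plane with
  finitely many points removed.\<close>

lemma tf_eq_0_RHP:
  assumes "\<forall>\<^sub>F s in cofinite. Re s > 0 \<longrightarrow> tf_eval a s = 0" shows "a = 0"
proof (rule ccontr)
  assume "a \<noteq> 0"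
  from tf_eval_nonzero[OF this] assms
  have "\<forall>\<^sub>F s in cofinite. tf_eval a s \<noteq> 0 \<and> (Re s > 0 \<longrightarrow> tf_eval a s = 0)" by (rule eventually_conj)
  from cofinite_RHP_ex[OF this] show False by auto
qed

text \<open>A Bezout identity over the reals maps to one over the complex numbers, so real
  coprimality excludes common complex roots.\<close>

lemma tf_num_den_common_root:
  assumes "poly (cpoly (tf_den h)) s = 0" shows "poly (cpoly (tf_num h)) s \<noteq> 0"
proof
  assume n: "poly (cpoly (tf_num h)) s = 0"
  have "coprime (tf_num h) (tf_den h)" by (rule coprime_quot_of_fract)
  then obtain a b where "a * tf_num h + b * tf_den h = 1"
    by (metis bezout_coefficients_fst_snd coprime_imp_gcd_eq_1)
  hence "cpoly a * cpoly (tf_num h) + cpoly b * cpoly (tf_den h) = 1"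
    by (metis cpoly_hom(1-3))
  from arg_cong[OF this, of "\<lambda>p. poly p s"] n assms show False by simp
qed

section \<open>Behaviour of transfer functions at infinity and at poles\<close>

lemma poly_div_power_tendsto:
  fixes p :: "complex poly"
  assumes "degree p \<le> n"
  shows "((\<lambda>z. poly p z / z ^ n) \<longlongrightarrow> coeff p n) at_infinity"
proof -
  have "((\<lambda>z. \<Sum>i\<le>n. coeff p i * (z ^ i / z ^ n)) \<longlongrightarrow> (\<Sum>i\<le>n. coeff p i * (if i = n then 1 else 0))) at_infinity"
  proof (intro tendsto_sum tendsto_mult_left)
    fix i assume i: "i \<in> {..n}"
    show "((\<lambda>z::complex. z ^ i / z ^ n) \<longlongrightarrow> (if i = n then 1 else 0)) at_infinity"
    proof (cases "i = n")
      case True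
      have "\<forall>\<^sub>F z::complex in at_infinity. z \<noteq> 0" by (rule eventually_not_equal_at_infinity)
      hence "\<forall>\<^sub>F z::complex in at_infinity. z ^ i / z ^ n = 1" by eventually_elim (simp add: True)
      thus ?thesis by (simp add: True tendsto_eventually)
    next
      case False
      with i have lt: "0 < n - i" by simp
      have "((\<lambda>z::complex. inverse z ^ (n - i)) \<longlongrightarrow> 0 ^ (n - i)) at_infinity"
        by (intro tendsto_power tendsto_inverse_0)
      moreover have "\<forall>\<^sub>F z::complex in at_infinity. z \<noteq> 0" by (rule eventually_not_equal_at_infinity)
      hence "\<forall>\<^sub>F z::complex in at_infinity. inverse z ^ (n - i) = z ^ i / z ^ n"
        by eventually_elim (use lt in \<open>simp add: power_diff field_simps power_inverse\<close>)
      ultimately show ?thesis using False lt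
        by (simp add: power_0_left) (erule Lim_transform_eventually)
    qed
  qed
  moreover have "poly p z / z ^ n = (\<Sum>i\<le>n. coeff p i * (z ^ i / z ^ n))" for z
    using assms by (subst poly_altdef) (simp add: sum_divide_distrib sum.mono_neutral_left[of "{..n}" "{..degree p}"] coeff_eq_0)
  ultimately show ?thesis by (simp add: if_distrib[of "(*) _"] sum.delta cong: if_cong)
qed

lemma tf_eval_tendsto_infinity:
  assumes "degree (tf_num h) \<le> degree (tf_den h)"
  shows "(tf_eval h \<longlongrightarrow> coeff (cpoly (tf_num h)) (degree (tf_den h)) / lead_coeff (cpoly (tf_den h))) at_infinity"
proof -
  let ?m = "degree (tf_den h)"
  have "((\<lambda>z. (poly (cpoly (tf_num h)) z / z ^ ?m) / (poly (cpoly (tf_den h)) z / z ^ ?m))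
    \<longlongrightarrow> coeff (cpoly (tf_num h)) ?m / coeff (cpoly (tf_den h)) ?m) at_infinity"
    using assms by (intro tendsto_divide poly_div_power_tendsto) (simp_all add: cpoly_hom)
  moreover have "\<forall>\<^sub>F z::complex in at_infinity. z \<noteq> 0" by (rule eventually_not_equal_at_infinity)
  hence "\<forall>\<^sub>F z in at_infinity. (poly (cpoly (tf_num h)) z / z ^ ?m) / (poly (cpoly (tf_den h)) z / z ^ ?m) = tf_eval h z"
    by eventually_elim (simp add: tf_eval_def)
  ultimately show ?thesis by (simp add: cpoly_hom) (erule Lim_transform_eventually)
qed

text \<open>Otherwise denominator over numerator tends to 0 along the imaginary axis, whereas a
  bound \<open>M\<close> on the modulus of \<open>h\<close> keeps its norm times \<open>M\<close> at
  least 1.\<close>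

lemma hinf_defined_proper:
  assumes "hinf_defined h"
  shows "degree (tf_num h) \<le> degree (tf_den h)"
proof (rule ccontr)
  let ?n = "cpoly (tf_num h)" and ?d = "cpoly (tf_den h)"
  assume "\<not> ?thesis"
  hence lt: "degree ?d < degree ?n" by (simp add: cpoly_hom)
  obtain M where M: "\<And>w. norm (tf_eval h (\<i> * complex_of_real w)) \<le> M"
    using assms unfolding hinf_defined_def bdd_above_def by auto
  let ?f = "\<lambda>w::real. \<i> * complex_of_real w"
  have f: "filterlim ?f at_infinity at_top"
    by (intro tendsto_mult_filterlim_at_infinity[OF tendsto_const] filterlim_of_real_at_infinity) auto
  have lim: "((\<lambda>w. (poly ?d (?f w) / ?f w ^ degree ?n) / (poly ?n (?f w) / ?f w ^ degree ?n)) \<longlongrightarrow> coeff ?d (degree ?n) / lead_coeff ?n) at_top"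
    using lt by (intro tendsto_divide filterlim_compose[OF poly_div_power_tendsto f]) auto
  have nz: "poly ?d (?f w) \<noteq> 0" for w
    using assms unfolding hinf_defined_def tf_poles_def by fastforce
  have ev: "\<forall>\<^sub>F w::real in at_top. w > 0" by (rule eventually_gt_at_top)
  have "\<forall>\<^sub>F w in at_top. norm ((poly ?d (?f w) / ?f w ^ degree ?n) / (poly ?n (?f w) / ?f w ^ degree ?n)) * M \<ge> 1 \<or> poly ?n (?f w) = 0"
    using ev
  proof eventually_elim
    case (elim w)
    show ?case
    proof (cases "poly ?n (?f w) = 0")
      case False
      have "norm (poly ?n (?f w)) \<le> M * norm (poly ?d (?f w))"
        using M[of w] nz[of w] by (simp add: tf_eval_def norm_divide divide_simps mult_ac)
      thus ?thesis using False elim by (simp add: norm_divide norm_mult divide_simps mult_ac)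
    qed simp
  qed
  moreover have "\<forall>\<^sub>F w in at_top. poly ?n (?f w) \<noteq> 0"
  proof -
    have "((\<lambda>w. poly ?n (?f w) / ?f w ^ degree ?n) \<longlongrightarrow> lead_coeff ?n) at_top"
      by (rule filterlim_compose[OF poly_div_power_tendsto f]) simp
    moreover have "lead_coeff ?n \<noteq> 0" using lt by auto
    ultimately have "\<forall>\<^sub>F w in at_top. poly ?n (?f w) / ?f w ^ degree ?n \<noteq> 0"
      by (rule tendsto_imp_eventually_ne)
    thus ?thesis by eventually_elim auto
  qed
  ultimately have "\<forall>\<^sub>F w in at_top. norm ((poly ?d (?f w) / ?f w ^ degree ?n) / (poly ?n (?f w) / ?f w ^ degree ?n)) * M \<ge> 1"
    by eventually_elim auto
  moreover have "((\<lambda>w. norm ((poly ?d (?f w) / ?f w ^ degree ?n) / (poly ?n (?f w) / ?f w ^ degree ?n)) * M) \<longlongrightarrow> 0 * M) at_top"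
    using tendsto_norm[OF lim] lt by (intro tendsto_mult_right) (simp add: coeff_eq_0)
  ultimately have "0 * M \<ge> 1" by (intro tendsto_lowerbound) auto
  thus False by simp
qed

lemma hinf_norm_nonneg:
  assumes "hinf_defined h" shows "0 \<le> hinf_norm h"
  unfolding hinf_norm_def using assms
  by (intro order_trans[OF norm_ge_zero cSUP_upper[of 0]]) (auto simp: hinf_defined_def)

lemma tf_eval_le_hinf_norm:
  assumes "hinf_defined h" shows "norm (tf_eval h (\<i> * complex_of_real w)) \<le> hinf_norm h"
  unfolding hinf_norm_def using assms
  by (intro cSUP_upper[of w]) (auto simp: hinf_defined_def)

text \<open>Strict properness makes the impulse response a function, free of an impulse at 0. The
  zero function is listed apart because its numerator and denominator both have degree 0.\<close>

definition strictly_stable :: "tf \<Rightarrow> bool" where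
  "strictly_stable h \<longleftrightarrow> (\<forall>s\<in>tf_poles h. Re s < 0) \<and> (tf_num h = 0 \<or> degree (tf_num h) < degree (tf_den h))"

lemma tf_eval_continuous:
  assumes "s \<notin> tf_poles h" shows "isCont (tf_eval h) s"
  using assms unfolding tf_poles_def tf_eval_def[abs_def] by (intro continuous_intros) auto

text \<open>A pole in the closed right half plane would make the left-hand side unbounded near it, as the
  squared modulus grows at least like the inverse squared distance while \<open>h\<close> stays bounded.\<close>

lemma strictly_stableI:
  assumes h: "hinf_defined h"
    and le: "\<forall>\<^sub>F s in cofinite. Re s > 0 \<longrightarrow> (norm (tf_eval \<eta> s))\<^sup>2 * Re s \<le> K * norm (tf_eval h s)"
  shows "strictly_stable \<eta>"
proof -
  let ?n = "cpoly (tf_num \<eta>)" and ?d = "cpoly (tf_den \<eta>)"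
  have fin: "finite {s. \<not> (Re s > 0 \<longrightarrow> (norm (tf_eval \<eta> s))\<^sup>2 * Re s \<le> K * norm (tf_eval h s))}" (is "finite ?B")
    using le by (simp add: eventually_cofinite)
  have "Re s0 < 0" if p: "s0 \<in> tf_poles \<eta>" for s0
  proof (rule ccontr)
    assume ge: "\<not> Re s0 < 0"
    \<comment> \<open>The pole is approached horizontally from the right, so that
      \<open>Re (?s e) >= e\<close> even if it lies on the imaginary axis.\<close>
    let ?s = "\<lambda>e::real. s0 + complex_of_real e"
    have d0: "poly ?d s0 = 0" using p by (simp add: tf_poles_def)
    have n0: "poly ?n s0 \<noteq> 0" by (rule tf_num_den_common_root[OF d0])
    obtain q where q: "?d = [:- s0, 1:] * q" using d0 by (metis dvdE poly_eq_0_iff_dvd)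
    have s_lim: "(?s \<longlongrightarrow> s0) (at_right 0)" by (auto intro!: tendsto_eq_intros)
    have ev_B: "\<forall>\<^sub>F e in at_right 0. ?s e \<notin> ?B \<union> {s. poly ?d s = 0}"
    proof -
      have inj: "inj ?s" by (auto simp: inj_def)
      have "finite (?B \<union> {s. poly ?d s = 0})" using fin by (simp add: poly_roots_finite cpoly_hom)
      hence "finite (?s -` (?B \<union> {s. poly ?d s = 0}))" by (rule finite_vimageI[OF _ inj])
      from islimpt_finite[OF this, of 0] show ?thesis
        by (simp add: islimpt_iff_eventually eventually_at_split)
    qed
    have ev_pos: "\<forall>\<^sub>F e in at_right 0. (0::real) < e" by (rule eventually_at_right_less)
    \<comment> \<open>The denominator contributes \<open>e\<close> squared and the factor
      \<open>Re s\<close> takes back only one \<open>e\<close>. The remaining \<open>e\<close> on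
      the right forces the numerator to vanish at \<open>s0\<close>; for a multiple pole
      \<open>q\<close> becomes small as well.\<close>
    have "\<forall>\<^sub>F e in at_right 0. (norm (poly ?n (?s e)))\<^sup>2 \<le> (K * norm (tf_eval h (?s e)) * (norm (poly q (?s e)))\<^sup>2) * e"
      using ev_B ev_pos
    proof eventually_elim
      case (elim e)
      have dq: "poly ?d (?s e) = complex_of_real e * poly q (?s e)" unfolding q by (simp add: algebra_simps)
      have qn: "poly q (?s e) \<noteq> 0" using elim dq by auto
      have "(norm (tf_eval \<eta> (?s e)))\<^sup>2 * Re (?s e) \<le> K * norm (tf_eval h (?s e))"
        using elim ge by auto
      moreover have "(norm (tf_eval \<eta> (?s e)))\<^sup>2 * e \<le> (norm (tf_eval \<eta> (?s e)))\<^sup>2 * Re (?s e)"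
        using ge by (intro mult_left_mono) auto
      ultimately have "(norm (tf_eval \<eta> (?s e)))\<^sup>2 * e \<le> K * norm (tf_eval h (?s e))" by linarith
      moreover have "(norm (tf_eval \<eta> (?s e)))\<^sup>2 * e = (norm (poly ?n (?s e)))\<^sup>2 / (e * (norm (poly q (?s e)))\<^sup>2)"
        using elim(2) by (simp add: tf_eval_def dq norm_divide norm_mult power_divide power_mult_distrib power2_eq_square)
      ultimately have "(norm (poly ?n (?s e)))\<^sup>2 / (e * (norm (poly q (?s e)))\<^sup>2) \<le> K * norm (tf_eval h (?s e))" by simp
      thus ?case using elim(2) qn by (subst (asm) pos_divide_le_eq) (auto simp: mult_ac)
    qed
    moreover have "((\<lambda>e. (norm (poly ?n (?s e)))\<^sup>2) \<longlongrightarrow> (norm (poly ?n s0))\<^sup>2) (at_right 0)"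
      by (intro tendsto_intros s_lim)
    moreover have "((\<lambda>e. (K * norm (tf_eval h (?s e)) * (norm (poly q (?s e)))\<^sup>2) * e) \<longlongrightarrow> (K * norm (tf_eval h s0) * (norm (poly q s0))\<^sup>2) * 0) (at_right 0)"
    proof (intro tendsto_intros s_lim isCont_tendsto_compose[OF _ s_lim] tf_eval_continuous)
      show "s0 \<notin> tf_poles h" using h ge unfolding hinf_defined_def by auto
    qed
    ultimately have "(norm (poly ?n s0))\<^sup>2 \<le> (K * norm (tf_eval h s0) * (norm (poly q s0))\<^sup>2) * 0"
      by (intro tendsto_le[of "at_right (0::real)"]) auto
    thus False using n0 by simp
  qed
  \<comment> \<open>Along the positive reals \<open>Re s = s\<close>. If \<open>\<eta>\<close> did
    not tend to 0 there, the left-hand side of the bound would grow at least linearly, while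
    \<open>h\<close> has a finite limit because it is proper.\<close>
  moreover have "degree ?n < degree ?d" if nz: "?n \<noteq> 0"
  proof (rule ccontr)
    assume "\<not> ?thesis"
    hence deg: "degree ?d \<le> degree ?n" by simp
    let ?f = "complex_of_real"
    have f: "filterlim ?f at_infinity at_top" by (rule filterlim_of_real_at_infinity)
    have h_lim: "((\<lambda>w. tf_eval h (?f w)) \<longlongrightarrow> coeff (cpoly (tf_num h)) (degree (tf_den h)) / lead_coeff (cpoly (tf_den h))) at_top" (is "(_ \<longlongrightarrow> ?c) _")
      by (rule filterlim_compose[OF tf_eval_tendsto_infinity[OF hinf_defined_proper[OF h]] f])
    have rhs: "((\<lambda>w. K * norm (tf_eval h (?f w)) * (norm (poly ?d (?f w) / ?f w ^ degree ?n))\<^sup>2 * inverse w)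
       \<longlongrightarrow> K * norm ?c * (norm (coeff ?d (degree ?n)))\<^sup>2 * 0) at_top"
      by (intro tendsto_intros h_lim filterlim_compose[OF poly_div_power_tendsto[OF deg] f] tendsto_inverse_0_at_top filterlim_ident)
    have lhs: "((\<lambda>w. (norm (poly ?n (?f w) / ?f w ^ degree ?n))\<^sup>2) \<longlongrightarrow> (norm (lead_coeff ?n))\<^sup>2) at_top"
      by (intro tendsto_intros filterlim_compose[OF poly_div_power_tendsto[OF order_refl] f])
    have "\<forall>\<^sub>F w in at_top. ?f w \<notin> ?B \<union> {s. poly ?d s = 0}"
    proof -
      have "finite (?B \<union> {s. poly ?d s = 0})" using fin by (simp add: poly_roots_finite cpoly_hom)
      from iffD1[OF bounded_iff finite_imp_bounded[OF this]] obtain b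
        where b: "\<forall>s \<in> ?B \<union> {s. poly ?d s = 0}. norm s \<le> b" ..
      have "\<forall>\<^sub>F s in at_infinity. s \<notin> ?B \<union> {s. poly ?d s = 0}"
        unfolding eventually_at_infinity
      proof (intro exI[of _ "b + 1"] allI impI notI)
        fix s assume s: "b + 1 \<le> norm s" "s \<in> ?B \<union> {s. poly ?d s = 0}"
        from bspec[OF b s(2)] s(1) show False by simp
      qed
      from eventually_compose_filterlim[OF this f] show ?thesis .
    qed
    moreover have "\<forall>\<^sub>F w::real in at_top. w > 0" by (rule eventually_gt_at_top)
    ultimately have "\<forall>\<^sub>F w in at_top. (norm (poly ?n (?f w) / ?f w ^ degree ?n))\<^sup>2
        \<le> K * norm (tf_eval h (?f w)) * (norm (poly ?d (?f w) / ?f w ^ degree ?n))\<^sup>2 * inverse w"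
    proof eventually_elim
      case (elim w)
      have dn: "poly ?d (?f w) \<noteq> 0" using elim by auto
      have "(norm (tf_eval \<eta> (?f w)))\<^sup>2 * w \<le> K * norm (tf_eval h (?f w))" using elim by auto
      hence "(norm (tf_eval \<eta> (?f w)))\<^sup>2 \<le> K * norm (tf_eval h (?f w)) * inverse w"
        using elim by (simp add: field_simps)
      hence "(norm (tf_eval \<eta> (?f w)))\<^sup>2 * (norm (poly ?d (?f w) / ?f w ^ degree ?n))\<^sup>2
        \<le> K * norm (tf_eval h (?f w)) * inverse w * (norm (poly ?d (?f w) / ?f w ^ degree ?n))\<^sup>2"
        by (rule mult_right_mono) simp
      moreover have "norm (tf_eval \<eta> (?f w)) * norm (poly ?d (?f w) / ?f w ^ degree ?n) = norm (poly ?n (?f w) / ?f w ^ degree ?n)"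
        unfolding tf_eval_def using dn by (simp add: norm_divide)
      ultimately show ?case by (simp add: power_mult_distrib[symmetric] mult_ac)
    qed
    hence "(norm (lead_coeff ?n))\<^sup>2 \<le> K * norm ?c * (norm (coeff ?d (degree ?n)))\<^sup>2 * 0"
      by (intro tendsto_le[OF _ rhs lhs]) auto
    thus False using nz by simp
  qed
  ultimately show ?thesis unfolding strictly_stable_def by (auto simp: cpoly_hom)
qed

section \<open>Kron reduction and Tellegen's theorem\<close>

fun potential :: "(nat \<Rightarrow> 'a::zero) \<Rightarrow> nat option \<Rightarrow> 'a" where
  "potential x None = 0"
| "potential x (Some m) = x m"

text \<open>Polymorphic, since one incidence matrix acts on rational functions, on their complex
  values and on real trajectories. The signs are those of the current balance in
  \<open>circuit_trajectory\<close>.\<close>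

definition incidence :: "circuit \<Rightarrow> nat \<Rightarrow> nat \<Rightarrow> 'a::ring_1" where
  "incidence cs l m = (case cs ! l of (p, q, el) \<Rightarrow>
     (if p = Some m then 1 else 0) - (if q = Some m then 1 else 0))"

definition voltage_drop :: "circuit \<Rightarrow> (nat \<Rightarrow> 'a::ring_1) \<Rightarrow> nat \<Rightarrow> 'a" where
  "voltage_drop cs x l = (case cs ! l of (p, q, el) \<Rightarrow> potential x p - potential x q)"

abbreviation elem :: "circuit \<Rightarrow> nat \<Rightarrow> element" where
  "elem cs l \<equiv> snd (snd (cs ! l))"

lemma potential_as_sum:
  assumes "p \<in> insert None (Some ` {..<n})"
  shows "potential x p = (\<Sum>m<n. (if p = Some m then 1 else 0) * (x m :: 'a::ring_1))"
proof (cases p)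
  case (Some k)
  with assms have "k < n" by auto
  have "(\<Sum>m<n. (if p = Some m then 1 else 0) * x m) = (\<Sum>m<n. if k = m then x m else 0)"
    by (intro sum.cong) (auto simp: Some)
  thus ?thesis using \<open>k < n\<close> by (simp add: Some sum.delta)
qed simp

lemma passive_nth:
  assumes "passive_circuit n cs" "l < length cs"
  shows "element_passive (elem cs l)"
    "fst (cs ! l) \<in> insert None (Some ` {..<n})" "fst (snd (cs ! l)) \<in> insert None (Some ` {..<n})"
    "fst (cs ! l) \<noteq> fst (snd (cs ! l))"
  using assms(1) nth_mem[OF assms(2)] unfolding passive_circuit_def
  by (cases "cs ! l"; force)+

lemma voltage_drop_as_sum:
  assumes "passive_circuit n cs" "l < length cs"
  shows "voltage_drop cs x l = (\<Sum>m<n. incidence cs l m * x m)"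
  using potential_as_sum[OF passive_nth(2)[OF assms], of x] potential_as_sum[OF passive_nth(3)[OF assms], of x]
  unfolding voltage_drop_def incidence_def
  by (cases "cs ! l") (simp add: left_diff_distrib sum_subtractf)

text \<open>Taking voltage drops is the transpose of summing currents at nodes. \<open>J\<close> and
  \<open>z\<close> may come from different solutions, which is the source of reciprocity.\<close>

lemma sum_voltage_drop:
  fixes J :: "nat \<Rightarrow> 'a::comm_ring_1"
  assumes "passive_circuit n cs"
  shows "(\<Sum>l<length cs. J l * voltage_drop cs z l) = (\<Sum>m<n. z m * (\<Sum>l<length cs. incidence cs l m * J l))"
proof -
  have "(\<Sum>l<length cs. J l * voltage_drop cs z l) = (\<Sum>l<length cs. \<Sum>m<n. z m * (incidence cs l m * J l))"
    by (intro sum.cong refl) (simp add: voltage_drop_as_sum[OF assms] sum_distrib_left mult_ac)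
  also have "\<dots> = (\<Sum>m<n. z m * (\<Sum>l<length cs. incidence cs l m * J l))"
    by (subst sum.swap) (simp add: sum_distrib_left)
  finally show ?thesis .
qed

lemma branch_adm_Cons:
  "branch_adm ((p, q, el) # cs) m k = (if {p, q} = {m, k} then element_adm el else 0) + branch_adm cs m k"
  by (simp add: branch_adm_def)

text \<open>Induction over the elements, because \<open>branch_adm\<close> merges parallel ones. An
  element touching \<open>m\<close> is seen at exactly one other node, in one of two orientations;
  any other element adds 0 on both sides.\<close>

lemma sum_branch_adm:
  fixes x :: "nat \<Rightarrow> tf"
  assumes "passive_circuit n cs" "m < n"
  shows "(\<Sum>p\<in>insert None (Some ` {..<n}) - {Some m}. branch_adm cs (Some m) p * (x m - potential x p))
    = (\<Sum>(p, q, el)\<leftarrow>cs. ((if p = Some m then 1 else 0) - (if q = Some m then 1 else 0)) * (element_adm el * (potential x p - potential x q)))"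
  (is "sum _ ?O = _")
  using assms(1)
proof (induction cs)
  case Nil
  show ?case by (simp add: branch_adm_def)
next
  case (Cons c cs)
  obtain p q el where c: "c = (p, q, el)" by (cases c) auto
  have cs: "passive_circuit n cs" using Cons.prems by (auto simp: passive_circuit_def)
  have pq: "p \<noteq> q" "p \<in> insert None (Some ` {..<n})" "q \<in> insert None (Some ` {..<n})"
    using Cons.prems by (auto simp: passive_circuit_def c)
  have fin: "finite ?O" by simp
  have "(\<Sum>k\<in>?O. (if {p, q} = {Some m, k} then element_adm el else 0) * (x m - potential x k))
    = ((if p = Some m then 1 else 0) - (if q = Some m then 1 else 0)) * (element_adm el * (potential x p - potential x q))"
  proof -
    consider "p = Some m" | "q = Some m" | "p \<noteq> Some m" "q \<noteq> Some m" by blast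
    thus ?thesis
    proof cases
      case 1
      have "(\<Sum>k\<in>?O. (if {p, q} = {Some m, k} then element_adm el else 0) * (x m - potential x k))
        = (\<Sum>k\<in>?O. if q = k then element_adm el * (x m - potential x k) else 0)"
        by (intro sum.cong) (use 1 pq(1) in \<open>auto simp: doubleton_eq_iff\<close>)
      also have "\<dots> = element_adm el * (x m - potential x q)"
        using fin pq 1 by (subst sum.delta') auto
      finally show ?thesis using 1 pq(1) by auto
    next
      case 2
      have "(\<Sum>k\<in>?O. (if {p, q} = {Some m, k} then element_adm el else 0) * (x m - potential x k))
        = (\<Sum>k\<in>?O. if p = k then element_adm el * (x m - potential x k) else 0)"
        by (intro sum.cong) (use 2 pq(1) in \<open>auto simp: doubleton_eq_iff\<close>)
      also have "\<dots> = element_adm el * (x m - potential x p)"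
        using fin pq 2 by (subst sum.delta') auto
      finally show ?thesis using 2 pq(1) by (auto simp: algebra_simps)
    next
      case 3
      thus ?thesis by (auto simp: doubleton_eq_iff intro!: sum.neutral)
    qed
  qed
  thus ?case using Cons.IH[OF cs]
    by (simp add: c branch_adm_Cons distrib_right sum.distrib)
qed

text \<open>The factorisation \<open>Y = B^T diag(y) B\<close> with the incidence matrix
  \<open>B\<close>, in which symmetry and passivity can be read off element by element.\<close>

lemma nodal_adm_mult:
  fixes x :: "nat \<Rightarrow> tf"
  assumes "passive_circuit n cs" "m < n"
  shows "(\<Sum>k<n. nodal_adm n cs $$ (m, k) * x k)
    = (\<Sum>l<length cs. incidence cs l m * (element_adm (elem cs l) * voltage_drop cs x l))"
proof -
  let ?y = "\<lambda>p. branch_adm cs (Some m) p"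
  have O: "insert None (Some ` {..<n}) - {Some m} = insert None (Some ` ({..<n} - {m}))" by auto
  have "(\<Sum>k<n. nodal_adm n cs $$ (m, k) * x k) = nodal_adm n cs $$ (m, m) * x m + (\<Sum>k\<in>{..<n} - {m}. nodal_adm n cs $$ (m, k) * x k)"
    using assms(2) by (intro sum.remove) auto
  also have "\<dots> = (?y None + (\<Sum>p\<in>{..<n} - {m}. ?y (Some p))) * x m + (\<Sum>k\<in>{..<n} - {m}. - ?y (Some k) * x k)"
    using assms(2) by (intro arg_cong2[of _ _ _ _ "(+)"] sum.cong) (auto simp: nodal_adm_def)
  also have "\<dots> = ?y None * x m + (\<Sum>k\<in>{..<n} - {m}. ?y (Some k) * (x m - x k))"
    by (simp add: algebra_simps sum_distrib_left sum_subtractf sum_negf)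
  also have "\<dots> = (\<Sum>p\<in>insert None (Some ` {..<n}) - {Some m}. ?y p * (x m - potential x p))"
    unfolding O by (subst sum.insert) (auto simp: sum.reindex)
  also have "\<dots> = (\<Sum>l<length cs. incidence cs l m * (element_adm (elem cs l) * voltage_drop cs x l))"
    unfolding sum_branch_adm[OF assms] sum_list_sum_nth
    by (intro sum.cong) (auto simp: incidence_def voltage_drop_def split_beta)
  finally show ?thesis .
qed

lemma nodal_adm_sym: "m < n \<Longrightarrow> k < n \<Longrightarrow> nodal_adm n cs $$ (m, k) = nodal_adm n cs $$ (k, m)"
  by (auto simp: nodal_adm_def branch_adm_def insert_commute)

text \<open>Choosing the interior potentials so that no net current is left at the interior nodes is
  what the Schur complement encodes. Kron reduction is thereby traded for a potential on the full
  circuit, where passivity is a property of single elements.\<close>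

lemma kron_potential:
  fixes u :: "nat \<Rightarrow> tf"
  assumes P: "passive_circuit n cs" and b: "b \<le> n" and inv: "invertible_mat (interior_adm b n cs)"
  shows "\<exists>x. (\<forall>m<b. x m = u m) \<and> (\<forall>m<n. (\<Sum>l<length cs. incidence cs l m * (element_adm (elem cs l) * voltage_drop cs x l))
    = (if m < b then (\<Sum>k<b. kron_reduced b n cs $$ (m, k) * u k) else 0))"
proof -
  let ?Y = "nodal_adm n cs"
  have Y: "?Y \<in> carrier_mat n n" by (simp add: nodal_adm_def)
  define A where "A = mat b b (\<lambda>(i, j). ?Y $$ (i, j))"
  define B where "B = mat b (n - b) (\<lambda>(i, j). ?Y $$ (i, j + b))"
  define C where "C = mat (n - b) b (\<lambda>(i, j). ?Y $$ (i + b, j))"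
  define D where "D = mat (n - b) (n - b) (\<lambda>(i, j). ?Y $$ (i + b, j + b))"
  have sb: "split_block ?Y b b = (A, B, C, D)"
    using Y by (simp add: split_block_def Let_def A_def B_def C_def D_def)
  have car: "A \<in> carrier_mat b b" "B \<in> carrier_mat b (n - b)" "C \<in> carrier_mat (n - b) b" "D \<in> carrier_mat (n - b) (n - b)"
    by (simp_all add: A_def B_def C_def D_def)
  have CB: "C = B\<^sup>T" unfolding B_def C_def using b by (intro eq_matI) (auto intro!: nodal_adm_sym)
  have "invertible_mat D" using inv unfolding interior_adm_def sb by simp
  \<comment> \<open>\<open>mat_inverse\<close> is computed by Gauss-Jordan elimination and returns
    \<open>None\<close> only outside the units of the matrix ring; an abstract inverse places
    \<open>D\<close> among these units.\<close>
  then obtain D' where D': "mat_inverse D = Some D'"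
  proof (cases "mat_inverse D")
    case None
    from mat_inverse(1)[OF car(4) None] have "D \<notin> Units (ring_mat TYPE(tf) (n - b) b)" .
    moreover have "D \<in> Units (ring_mat TYPE(tf) (n - b) b)"
    proof -
      obtain E where E: "inverts_mat D E" "inverts_mat E D" using \<open>invertible_mat D\<close> unfolding invertible_mat_def by blast
      have "dim_row E = n - b" "dim_col E = n - b"
        using E car(4) unfolding inverts_mat_def
        by (metis carrier_matD index_mult_mat(2,3) index_one_mat(2,3))+
      thus ?thesis using E car(4) unfolding Units_def inverts_mat_def
        by (auto simp: ring_mat_def intro!: bexI[of _ E])
    qed
    ultimately show ?thesis by simp
  qed simp
  from mat_inverse(2)[OF car(4) D'] have DD: "D * D' = 1\<^sub>m (n - b)" "D' \<in> carrier_mat (n - b) (n - b)" by auto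
  have K: "kron_reduced b n cs = A - B * D' * B\<^sup>T" unfolding kron_reduced_def sb prod.case D' option.sel ..
  define uv where "uv = vec b u"
  \<comment> \<open>The solution of \<open>B^T u + D xi = 0\<close>, the current balance at the
    interior nodes.\<close>
  define xi where "xi = - (D' *\<^sub>v (B\<^sup>T *\<^sub>v uv))"
  have uv: "uv \<in> carrier_vec b" and xi: "xi \<in> carrier_vec (n - b)" using DD car by (simp_all add: uv_def xi_def)
  have BTu: "B\<^sup>T *\<^sub>v uv \<in> carrier_vec (n - b)" using car uv by simp
  have Dxi: "C *\<^sub>v uv + D *\<^sub>v xi = 0\<^sub>v (n - b)"
  proof -
    have "D *\<^sub>v xi = - (D *\<^sub>v (D' *\<^sub>v (B\<^sup>T *\<^sub>v uv)))"
      unfolding xi_def using car DD BTu by (intro eq_vecI) (auto simp: uminus_scalar_prod)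
    also have "D *\<^sub>v (D' *\<^sub>v (B\<^sup>T *\<^sub>v uv)) = B\<^sup>T *\<^sub>v uv"
      using assoc_mult_mat_vec[OF car(4) DD(2) BTu] DD(1) BTu by simp
    finally show ?thesis using BTu unfolding CB by (simp)
  qed
  have Kxi: "A *\<^sub>v uv + B *\<^sub>v xi = kron_reduced b n cs *\<^sub>v uv"
  proof -
    have "B *\<^sub>v xi = - (B *\<^sub>v (D' *\<^sub>v (B\<^sup>T *\<^sub>v uv)))"
      unfolding xi_def using car DD BTu by (intro eq_vecI) (auto simp: uminus_scalar_prod)
    also have "B *\<^sub>v (D' *\<^sub>v (B\<^sup>T *\<^sub>v uv)) = (B * D' * B\<^sup>T) *\<^sub>v uv"
      
    proof -
      have "(B * D' * B\<^sup>T) *\<^sub>v uv = (B * D') *\<^sub>v (B\<^sup>T *\<^sub>v uv)"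
        by (rule assoc_mult_mat_vec[of _ b "n - b" _ b]) (use car DD uv in auto)
      also have "\<dots> = B *\<^sub>v (D' *\<^sub>v (B\<^sup>T *\<^sub>v uv))"
        by (rule assoc_mult_mat_vec[of _ b "n - b" _ "n - b"]) (use car DD BTu in auto)
      finally show ?thesis ..
    qed
    finally have "A *\<^sub>v uv + B *\<^sub>v xi = A *\<^sub>v uv - (B * D' * B\<^sup>T) *\<^sub>v uv"
      using car DD uv by (intro eq_vecI) auto
    also have "\<dots> = (A - B * D' * B\<^sup>T) *\<^sub>v uv"
      using car DD uv by (intro minus_mult_distrib_mat_vec[symmetric, of _ b b]) auto
    finally show ?thesis unfolding K .
  qed
  define x where "x = (\<lambda>m. if m < b then u m else xi $ (m - b))"
  have split: "(\<Sum>k<n. ?Y $$ (m, k) * x k) = (\<Sum>k<b. ?Y $$ (m, k) * u k) + (\<Sum>k<n - b. ?Y $$ (m, k + b) * xi $ k)" for m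
  proof -
    have "(\<Sum>k<n. ?Y $$ (m, k) * x k) = (\<Sum>k<b. ?Y $$ (m, k) * x k) + (\<Sum>k\<in>{b..<n}. ?Y $$ (m, k) * x k)"
      using b by (subst sum.union_disjoint[symmetric]) (auto intro!: sum.cong)
    also have "(\<Sum>k\<in>{b..<n}. ?Y $$ (m, k) * x k) = (\<Sum>k<n - b. ?Y $$ (m, k + b) * x (k + b))"
      using b by (intro sum.reindex_bij_witness[of _ "\<lambda>k. k + b" "\<lambda>k. k - b"]) auto
    finally show ?thesis by (simp add: x_def)
  qed
  have "(\<Sum>k<n. ?Y $$ (m, k) * x k) = (if m < b then (\<Sum>k<b. kron_reduced b n cs $$ (m, k) * u k) else 0)" if m: "m < n" for m
  proof (cases "m < b")
    case True
    have "(\<Sum>k<n. ?Y $$ (m, k) * x k) = (A *\<^sub>v uv + B *\<^sub>v xi) $ m"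
      unfolding split using True car uv xi
      by (simp add: scalar_prod_def A_def B_def uv_def atLeast0LessThan)
    also have "\<dots> = (\<Sum>k<b. kron_reduced b n cs $$ (m, k) * u k)"
      unfolding Kxi using True car DD(2)
      by (simp add: K scalar_prod_def uv_def atLeast0LessThan)
    finally show ?thesis using True by simp
  next
    case False
    have "(\<Sum>k<n. ?Y $$ (m, k) * x k) = (C *\<^sub>v uv + D *\<^sub>v xi) $ (m - b)"
      unfolding split using False m car uv xi
      by (simp add: scalar_prod_def C_def D_def uv_def atLeast0LessThan)
    also have "\<dots> = 0" unfolding Dxi using False m by simp
    finally show ?thesis using False by simp
  qed
  thus ?thesis using nodal_adm_mult[OF P, of _ x] by (intro exI[of _ x]) (auto simp: x_def)
qed

section \<open>Finite-horizon Laplace transform of a circuit\<close>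

definition laplace :: "(real \<Rightarrow> real) \<Rightarrow> real \<Rightarrow> complex \<Rightarrow> complex" where
  "laplace X T s = integral {0..T} (\<lambda>t. exp (- s * complex_of_real t) * complex_of_real (X t))"

lemma laplace_integrable:
  assumes "continuous_on {0..} X"
  shows "(\<lambda>t. exp (- s * complex_of_real t) * complex_of_real (X t)) integrable_on {0..T}"
  by (intro integrable_continuous_interval continuous_intros continuous_on_subset[OF assms]) auto

lemma laplace_add:
  assumes "continuous_on {0..} X" "continuous_on {0..} Y"
  shows "laplace (\<lambda>t. X t + Y t) T s = laplace X T s + laplace Y T s"
  unfolding laplace_def using laplace_integrable[OF assms(1), of s T] laplace_integrable[OF assms(2), of s T]
  by (simp add: integral_add[symmetric] distrib_left)

lemma laplace_scale: "laplace (\<lambda>t. c * X t) T s = complex_of_real c * laplace X T s"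
  unfolding laplace_def by (simp add: mult.left_commute flip: integral_mult_right)

lemma laplace_diff:
  assumes "continuous_on {0..} X" "continuous_on {0..} Y"
  shows "laplace (\<lambda>t. X t - Y t) T s = laplace X T s - laplace Y T s"
  using laplace_add[OF assms(1), of "\<lambda>t. - 1 * Y t" T s] assms(2) laplace_scale[of "-1" Y T s]
  by (simp add: continuous_on_minus)

lemma laplace_sum:
  assumes "finite A" "\<And>i. i \<in> A \<Longrightarrow> continuous_on {0..} (X i)"
  shows "laplace (\<lambda>t. \<Sum>i\<in>A. X i t) T s = (\<Sum>i\<in>A. laplace (X i) T s)"
  using assms
proof induction
  case (insert i A)
  thus ?case using laplace_add[of "X i" "\<lambda>t. \<Sum>i\<in>A. X i t" T s] by (auto intro!: continuous_on_sum)
qed (simp add: laplace_def)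

lemma laplace_cong:
  assumes "\<And>t. t \<ge> 0 \<Longrightarrow> X t = Y t" shows "laplace X T s = laplace Y T s"
  unfolding laplace_def by (intro integral_cong) (simp add: assms)

lemma laplace_deriv:
  assumes X: "\<And>t. t \<ge> 0 \<Longrightarrow> (X has_real_derivative X' t) (at t within {0..})"
    and c: "continuous_on {0..} X'" and T: "0 \<le> T"
  shows "laplace X' T s = exp (- s * complex_of_real T) * complex_of_real (X T) - complex_of_real (X 0) + s * laplace X T s"
proof -
  let ?e = "\<lambda>t. exp (- s * complex_of_real t)"
  have cX: "continuous_on {0..} X"
    by (intro continuous_at_imp_continuous_on DERIV_continuous_on) (auto intro: X DERIV_continuous_on simp: continuous_on_eq_continuous_within)
  have "((\<lambda>t. ?e t * complex_of_real (X' t) - s * (?e t * complex_of_real (X t))) has_integral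
      (?e T * complex_of_real (X T) - ?e 0 * complex_of_real (X 0))) {0..T}"
  proof (rule fundamental_theorem_of_calculus[OF T])
    fix t assume t: "t \<in> {0..T}"
    have 1: "((\<lambda>t. complex_of_real (X t)) has_vector_derivative complex_of_real (X' t)) (at t within {0..T})"
      using has_field_derivative_subset[OF X[of t], of "{0..T}"] t
      by (intro has_vector_derivative_of_real) (auto simp: has_real_derivative_iff_has_vector_derivative)
    have 2: "(?e has_vector_derivative (- s * ?e t)) (at t within {0..T})"
    proof -
      have "((\<lambda>z. exp (- s * z)) has_field_derivative (- s * exp (- s * complex_of_real t))) (at (complex_of_real t))"
        by (auto intro!: derivative_eq_intros)
      from has_vector_derivative_real_field[OF this] show ?thesis by (simp add: o_def)
    qed
    from has_vector_derivative_mult[OF 2 1]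
    show "((\<lambda>t. ?e t * complex_of_real (X t)) has_vector_derivative (?e t * complex_of_real (X' t) - s * (?e t * complex_of_real (X t)))) (at t within {0..T})"
      by (simp add: algebra_simps)
  qed
  hence i1: "integral {0..T} (\<lambda>t. ?e t * complex_of_real (X' t) - s * (?e t * complex_of_real (X t)))
    = ?e T * complex_of_real (X T) - complex_of_real (X 0)" by (simp add: integral_unique)
  have i2: "integral {0..T} (\<lambda>t. ?e t * complex_of_real (X' t) - s * (?e t * complex_of_real (X t)))
    = laplace X' T s - s * laplace X T s"
    unfolding laplace_def integral_mult_right[symmetric]
    by (intro integral_diff integrable_on_mult_right laplace_integrable[OF c] laplace_integrable[OF cX])
  from trans[OF i2[symmetric] i1] show ?thesis by (simp add: algebra_simps)
qed

section \<open>Elements: admittances, stored states, stored energy\<close>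

fun adm_val :: "element \<Rightarrow> complex \<Rightarrow> complex" where
  "adm_val (Resistor r) s = inverse (complex_of_real r)"
| "adm_val (Inductor l) s = inverse (s * complex_of_real l)"
| "adm_val (Capacitor k) s = s * complex_of_real k"

lemma tf_eval_element_adm: "\<forall>\<^sub>F s in cofinite. tf_eval (element_adm el) s = adm_val el s"
proof (cases el)
  case (Resistor r)
  show ?thesis using tf_eval_inverse[of "tf_const r"] by eventually_elim (simp add: Resistor)
next
  case (Inductor l)
  show ?thesis using tf_eval_inverse[of "tf_s * tf_const l"] tf_eval_mult[of tf_s "tf_const l"]
    by eventually_elim (simp add: Inductor)
next
  case (Capacitor k)
  show ?thesis using tf_eval_mult[of tf_s "tf_const k"] by eventually_elim (simp add: Capacitor)
qed

text \<open>The transform of the element law over \<open>[0, T]\<close> is that of the admittance in parallel with the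
  current source \<open>init_src\<close> of the state at \<open>0\<close>, minus \<open>exp (- s T)\<close> times that of the state at
  \<open>T\<close>.\<close>

fun init_src :: "element \<Rightarrow> real \<Rightarrow> real \<Rightarrow> tf" where
  "init_src (Resistor r) u c = 0"
| "init_src (Inductor l) u c = tf_const c * inverse tf_s"
| "init_src (Capacitor k) u c = tf_const (- k * u)"

fun init_val :: "element \<Rightarrow> real \<Rightarrow> real \<Rightarrow> complex \<Rightarrow> complex" where
  "init_val (Resistor r) u c s = 0"
| "init_val (Inductor l) u c s = complex_of_real c / s"
| "init_val (Capacitor k) u c s = - complex_of_real (k * u)"

text \<open>Twice the stored energy, the constant that makes the comparison of stored state and
  dissipation in \<open>adm_val_Re\<close> exact.\<close>

fun init_energy :: "element \<Rightarrow> real \<Rightarrow> real \<Rightarrow> real" where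
  "init_energy (Resistor r) u c = 0"
| "init_energy (Inductor l) u c = l * c\<^sup>2"
| "init_energy (Capacitor k) u c = k * u\<^sup>2"

lemma tf_eval_init_src: "\<forall>\<^sub>F s in cofinite. tf_eval (init_src el u c) s = init_val el u c s"
proof (cases el)
  case (Inductor l)
  show ?thesis using tf_eval_inverse[of tf_s] tf_eval_mult[of "tf_const c" "inverse tf_s"]
    by eventually_elim (simp add: Inductor divide_inverse)
qed simp_all

lemma element_laplace:
  assumes law: "element_law el u c" and pas: "element_passive el"
    and cu: "continuous_on {0..} u" and cc: "continuous_on {0..} c"
    and T: "0 \<le> T" and s: "s \<noteq> 0"
  shows "laplace c T s = adm_val el s * laplace u T s + init_val el (u 0) (c 0) s
    - exp (- s * complex_of_real T) * init_val el (u T) (c T) s"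
proof (cases el)
  case (Resistor r)
  have "laplace u T s = complex_of_real r * laplace c T s"
    using law unfolding Resistor by (subst laplace_scale[symmetric]) (auto intro: laplace_cong)
  thus ?thesis using pas by (simp add: Resistor)
next
  case (Inductor l)
  have "laplace (\<lambda>t. u t / l) T s = exp (- s * complex_of_real T) * complex_of_real (c T) - complex_of_real (c 0) + s * laplace c T s"
    using law pas unfolding Inductor by (intro laplace_deriv) (auto intro!: continuous_intros cu T)
  moreover have "laplace (\<lambda>t. u t / l) T s = laplace u T s / complex_of_real l"
    using laplace_scale[of "inverse l" u T s] by (simp add: divide_inverse mult.commute)
  ultimately have "s * laplace c T s = laplace u T s * inverse (complex_of_real l) + complex_of_real (c 0)
      - exp (- s * complex_of_real T) * complex_of_real (c T)"
    by (simp add: divide_inverse eq_diff_eq) (simp add: algebra_simps)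
  hence "laplace c T s = (laplace u T s * inverse (complex_of_real l) + complex_of_real (c 0)
      - exp (- s * complex_of_real T) * complex_of_real (c T)) * inverse s"
    using s by (metis mult.commute mult.right_neutral mult.assoc right_inverse)
  also have "\<dots> = adm_val el s * laplace u T s + init_val el (u 0) (c 0) s
      - exp (- s * complex_of_real T) * init_val el (u T) (c T) s"
    by (simp add: Inductor divide_inverse ring_distribs mult_ac)
  finally show ?thesis .
next
  case (Capacitor k)
  have "laplace (\<lambda>t. c t / k) T s = exp (- s * complex_of_real T) * complex_of_real (u T) - complex_of_real (u 0) + s * laplace u T s"
    using law pas unfolding Capacitor by (intro laplace_deriv) (auto intro!: continuous_intros cc T)
  moreover have "laplace (\<lambda>t. c t / k) T s = laplace c T s / complex_of_real k"
    using laplace_scale[of "inverse k" c T s] by (simp add: divide_inverse mult.commute)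
  moreover have "laplace c T s = complex_of_real k * (laplace c T s / complex_of_real k)" using pas by (simp add: Capacitor)
  ultimately have "laplace c T s = complex_of_real k * (exp (- s * complex_of_real T) * complex_of_real (u T) - complex_of_real (u 0) + s * laplace u T s)"
    by metis
  thus ?thesis by (simp add: Capacitor ring_distribs mult_ac)
qed

lemma Re_inverse_pos: "Re s > 0 \<Longrightarrow> Re (inverse s) = Re s / (norm s)\<^sup>2"
  by (simp add: cmod_power2)

text \<open>For \<open>Re s > 0\<close> the arguments of \<open>1\<close>, \<open>s\<close> and
  \<open>1 / s\<close> are in modulus at most that of \<open>s\<close>; the second claim is this
  sector condition, expressed with cosines. In the third claim the two sides agree for each kind of
  element.\<close>

lemma adm_val_Re:
  assumes "element_passive el" "Re s > 0"
  shows "0 \<le> Re (adm_val el s)" "norm (adm_val el s) * Re s \<le> norm s * Re (adm_val el s)"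
    "(norm (init_val el u c s))\<^sup>2 * Re s \<le> init_energy el u c * Re (adm_val el s)" "0 \<le> init_energy el u c"
proof -
  have s0: "norm s > 0" using assms(2) by auto
  have Rl: "Re (inverse (s * complex_of_real l)) = Re s / (l * (norm s)\<^sup>2)" if "l > 0" for l
  proof -
    have "0 < Re (s * complex_of_real l)" using that assms(2) by simp
    from Re_inverse_pos[OF this] show ?thesis
      using that by (simp add: norm_mult power2_eq_square field_simps del: inverse_complex.sel inverse_mult_distrib)
  qed
  have le: "Re s \<le> norm s" by (rule complex_Re_le_cmod)
  show "0 \<le> Re (adm_val el s)"
    using assms by (cases el) (simp_all add: Rl del: inverse_mult_distrib inverse_complex.sel)
  show "norm (adm_val el s) * Re s \<le> norm s * Re (adm_val el s)"
  proof (cases el)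
    case (Resistor r)
    have "Re s * inverse r \<le> norm s * inverse r" using assms le Resistor by (intro mult_right_mono) auto
    thus ?thesis using assms Resistor by (simp add: norm_inverse mult.commute flip: of_real_inverse del: inverse_complex.sel)
  next
    case (Inductor l)
    hence "l > 0" using assms by simp
    have "norm (inverse (s * complex_of_real l)) = inverse (norm s * l)"
      unfolding norm_inverse norm_mult using \<open>l > 0\<close> by simp
    thus ?thesis using s0 \<open>l > 0\<close> unfolding Inductor adm_val.simps Rl[OF \<open>l > 0\<close>]
      by (simp only:) (simp add: power2_eq_square divide_simps)
  next
    case (Capacitor k)
    thus ?thesis using assms s0 by (simp add: norm_mult)
  qed
  show "(norm (init_val el u c s))\<^sup>2 * Re s \<le> init_energy el u c * Re (adm_val el s)"
  proof (cases el)
    case (Inductor l)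
    hence "l > 0" using assms by simp
    thus ?thesis using s0 unfolding Inductor adm_val.simps Rl[OF \<open>l > 0\<close>]
      by (simp add: norm_divide power_divide)
  qed (simp_all add: norm_mult power2_eq_square mult_ac)
  show "0 \<le> init_energy el u c" using assms by (cases el) auto
qed

section \<open>The quadratic form of the Kron-reduced matrix\<close>

definition kron_row :: "nat \<Rightarrow> nat \<Rightarrow> circuit \<Rightarrow> (nat \<Rightarrow> real) \<Rightarrow> nat \<Rightarrow> tf" where
  "kron_row b n cs u m = (\<Sum>k<b. kron_reduced b n cs $$ (m, k) * tf_const (u k))"

definition kron_form :: "nat \<Rightarrow> nat \<Rightarrow> circuit \<Rightarrow> (nat \<Rightarrow> real) \<Rightarrow> tf" where
  "kron_form b n cs u = (\<Sum>m<b. tf_const (u m) * kron_row b n cs u m)"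

lemma tf_eval_incidence: "tf_eval (incidence cs l m * w) s = incidence cs l m * tf_eval w s"
  by (cases "cs ! l") (auto simp: incidence_def tf_eval_uminus)

lemma tf_eval_potential: "tf_eval (potential x p) s = potential (\<lambda>m. tf_eval (x m) s) p"
  by (cases p) auto

lemma tf_eval_diff: "\<forall>\<^sub>F s in cofinite. tf_eval (a - b) s = tf_eval a s - tf_eval b s"
  using tf_eval_add[of a "- b"] by eventually_elim (simp add: tf_eval_uminus)

lemma tf_eval_voltage_drop: "\<forall>\<^sub>F s in cofinite. tf_eval (voltage_drop cs x l) s = voltage_drop cs (\<lambda>m. tf_eval (x m) s) l"
  unfolding voltage_drop_def
  by (cases "cs ! l") (use tf_eval_diff in \<open>simp add: tf_eval_potential[symmetric]\<close>)

text \<open>Finitely many exceptional sets are merged into one, off which the potentials are plain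
  complex numbers obeying the current balance.\<close>

lemma kron_potential_eval:
  assumes P: "passive_circuit n cs" and b: "b \<le> n" and inv: "invertible_mat (interior_adm b n cs)"
  shows "\<exists>x. \<forall>\<^sub>F s in cofinite. (\<forall>m<b. tf_eval (x m) s = complex_of_real (u m)) \<and>
    (\<forall>l<length cs. tf_eval (voltage_drop cs x l) s = voltage_drop cs (\<lambda>m. tf_eval (x m) s) l) \<and>
    (\<forall>m<n. (\<Sum>l<length cs. incidence cs l m * (adm_val (elem cs l) s * voltage_drop cs (\<lambda>m. tf_eval (x m) s) l))
      = (if m < b then tf_eval (kron_row b n cs u m) s else 0))"
proof -
  obtain x where x: "\<And>m. m < b \<Longrightarrow> x m = tf_const (u m)"
    "\<And>m. m < n \<Longrightarrow> (\<Sum>l<length cs. incidence cs l m * (element_adm (elem cs l) * voltage_drop cs x l)) = (if m < b then kron_row b n cs u m else 0)"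
    using kron_potential[OF P b inv, of "\<lambda>m. tf_const (u m)"] unfolding kron_row_def by blast
  have 1: "\<forall>\<^sub>F s in cofinite. \<forall>l\<in>{..<length cs}. tf_eval (voltage_drop cs x l) s = voltage_drop cs (\<lambda>m. tf_eval (x m) s) l"
    by (intro eventually_ball_finite ballI tf_eval_voltage_drop) simp
  have 2: "\<forall>\<^sub>F s in cofinite. \<forall>l\<in>{..<length cs}. tf_eval (element_adm (elem cs l)) s = adm_val (elem cs l) s"
    by (intro eventually_ball_finite ballI tf_eval_element_adm) simp
  have 3: "\<forall>\<^sub>F s in cofinite. \<forall>l\<in>{..<length cs}. tf_eval (element_adm (elem cs l) * voltage_drop cs x l) s
      = tf_eval (element_adm (elem cs l)) s * tf_eval (voltage_drop cs x l) s"
    by (intro eventually_ball_finite ballI tf_eval_mult) simp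
  have 4: "\<forall>\<^sub>F s in cofinite. \<forall>m\<in>{..<n}. tf_eval (\<Sum>l<length cs. incidence cs l m * (element_adm (elem cs l) * voltage_drop cs x l)) s
      = (\<Sum>l<length cs. tf_eval (incidence cs l m * (element_adm (elem cs l) * voltage_drop cs x l)) s)"
    by (intro eventually_ball_finite ballI tf_eval_sum) simp_all
  have "\<forall>\<^sub>F s in cofinite. (\<forall>m<b. tf_eval (x m) s = complex_of_real (u m)) \<and>
    (\<forall>l<length cs. tf_eval (voltage_drop cs x l) s = voltage_drop cs (\<lambda>m. tf_eval (x m) s) l) \<and>
    (\<forall>m<n. (\<Sum>l<length cs. incidence cs l m * (adm_val (elem cs l) s * voltage_drop cs (\<lambda>m. tf_eval (x m) s) l))
      = (if m < b then tf_eval (kron_row b n cs u m) s else 0))"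
    using 1 2 3 4
  proof eventually_elim
    case (elim s)
    have "(\<Sum>l<length cs. incidence cs l m * (adm_val (elem cs l) s * voltage_drop cs (\<lambda>m. tf_eval (x m) s) l))
      = (if m < b then tf_eval (kron_row b n cs u m) s else 0)" if m: "m < n" for m
    proof -
      have "(\<Sum>l<length cs. incidence cs l m * (adm_val (elem cs l) s * voltage_drop cs (\<lambda>m. tf_eval (x m) s) l))
        = (\<Sum>l<length cs. tf_eval (incidence cs l m * (element_adm (elem cs l) * voltage_drop cs x l)) s)"
        using elim(1-3) by (intro sum.cong refl) (simp add: tf_eval_incidence)
      also have "\<dots> = tf_eval (\<Sum>l<length cs. incidence cs l m * (element_adm (elem cs l) * voltage_drop cs x l)) s"
        using bspec[OF elim(4), of m] m by simp
      also have "\<dots> = tf_eval (if m < b then kron_row b n cs u m else 0) s"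
        unfolding x(2)[OF m] ..
      finally show ?thesis by simp
    qed
    thus ?case using elim(1) x(1) by simp
  qed
  thus ?thesis by blast
qed

lemma tf_eval_kron_form:
  "\<forall>\<^sub>F s in cofinite. tf_eval (kron_form b n cs u) s = (\<Sum>m<b. complex_of_real (u m) * tf_eval (kron_row b n cs u m) s)"
proof -
  have "\<forall>\<^sub>F s in cofinite. \<forall>m\<in>{..<b}. tf_eval (tf_const (u m) * kron_row b n cs u m) s = tf_eval (tf_const (u m)) s * tf_eval (kron_row b n cs u m) s"
    by (intro eventually_ball_finite ballI tf_eval_mult) simp
  moreover have "\<forall>\<^sub>F s in cofinite. tf_eval (kron_form b n cs u) s = (\<Sum>m<b. tf_eval (tf_const (u m) * kron_row b n cs u m) s)"
    unfolding kron_form_def by (rule tf_eval_sum) simp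
  ultimately show ?thesis by eventually_elim simp
qed

lemma voltage_drop_cnj: "voltage_drop cs (\<lambda>m. cnj (z m)) l = cnj (voltage_drop cs z l)"
proof -
  have "potential (\<lambda>m. cnj (z m)) p = cnj (potential z p)" for p by (cases p) auto
  thus ?thesis by (cases "cs ! l") (simp add: voltage_drop_def)
qed

text \<open>Tellegen's theorem for the voltage drops of \<open>z\<close> and their conjugates.\<close>

lemma kron_form_energy:
  assumes P: "passive_circuit n cs" and b: "b \<le> n"
    and xb: "\<forall>m<b. z m = complex_of_real (u m)"
    and kcl: "\<forall>m<n. (\<Sum>l<length cs. incidence cs l m * (adm_val (elem cs l) s * voltage_drop cs z l)) = (if m < b then r m else 0)"
  shows "(\<Sum>m<b. complex_of_real (u m) * r m) = (\<Sum>l<length cs. adm_val (elem cs l) s * complex_of_real ((norm (voltage_drop cs z l))\<^sup>2))"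
proof -
  have "(\<Sum>l<length cs. adm_val (elem cs l) s * complex_of_real ((norm (voltage_drop cs z l))\<^sup>2))
    = (\<Sum>l<length cs. (adm_val (elem cs l) s * voltage_drop cs z l) * voltage_drop cs (\<lambda>m. cnj (z m)) l)"
    by (simp only: voltage_drop_cnj complex_norm_square mult.assoc)
  also have "\<dots> = (\<Sum>m<n. cnj (z m) * (if m < b then r m else 0))"
    unfolding sum_voltage_drop[OF P] using kcl by (intro sum.cong) auto
  also have "\<dots> = (\<Sum>m<b. complex_of_real (u m) * r m)"
    using b xb by (intro sum.mono_neutral_cong_right) auto
  finally show ?thesis ..
qed

text \<open>By \<open>kron_form_energy\<close> the form combines element admittances with
  nonnegative weights, and the sector is a convex cone. The sector says more than
  \<open>Re >= 0\<close>: inside it a value with zero real part is zero.\<close>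

lemma kron_form_sector:
  assumes P: "passive_circuit n cs" and b: "b \<le> n" and inv: "invertible_mat (interior_adm b n cs)"
  shows "\<forall>\<^sub>F s in cofinite. Re s > 0 \<longrightarrow> 0 \<le> Re (tf_eval (kron_form b n cs u) s) \<and>
    norm (tf_eval (kron_form b n cs u) s) * Re s \<le> norm s * Re (tf_eval (kron_form b n cs u) s)"
proof -
  obtain x where x: "\<forall>\<^sub>F s in cofinite. (\<forall>m<b. tf_eval (x m) s = complex_of_real (u m)) \<and>
    (\<forall>l<length cs. tf_eval (voltage_drop cs x l) s = voltage_drop cs (\<lambda>m. tf_eval (x m) s) l) \<and>
    (\<forall>m<n. (\<Sum>l<length cs. incidence cs l m * (adm_val (elem cs l) s * voltage_drop cs (\<lambda>m. tf_eval (x m) s) l))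
      = (if m < b then tf_eval (kron_row b n cs u m) s else 0))"
    using kron_potential_eval[OF assms] by blast
  show ?thesis using x tf_eval_kron_form[of b n cs u]
  proof eventually_elim
    case (elim s)
    let ?q = "tf_eval (kron_form b n cs u) s"
    let ?d = "\<lambda>l. (norm (voltage_drop cs (\<lambda>m. tf_eval (x m) s) l))\<^sup>2"
    have q: "?q = (\<Sum>l<length cs. adm_val (elem cs l) s * complex_of_real (?d l))"
      unfolding elim(2) using elim(1) by (intro kron_form_energy[OF P b, of _ u]) auto
    show ?case
    proof
      assume s: "Re s > 0"
      have Rq: "Re ?q = (\<Sum>l<length cs. Re (adm_val (elem cs l) s) * ?d l)" unfolding q by simp
      have "norm ?q * Re s \<le> (\<Sum>l<length cs. norm (adm_val (elem cs l) s) * ?d l) * Re s"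
        unfolding q using s by (intro mult_right_mono order_trans[OF norm_sum]) (auto simp: norm_mult norm_power)
      also have "\<dots> = (\<Sum>l<length cs. (norm (adm_val (elem cs l) s) * Re s) * ?d l)"
        unfolding sum_distrib_right by (simp only: mult_ac)
      also have "\<dots> \<le> (\<Sum>l<length cs. (norm s * Re (adm_val (elem cs l) s)) * ?d l)"
        using s by (intro sum_mono mult_right_mono adm_val_Re(2) passive_nth(1)[OF P]) auto
      also have "\<dots> = norm s * Re ?q" unfolding Rq by (simp add: sum_distrib_left mult_ac)
      finally have "norm ?q * Re s \<le> norm s * Re ?q" .
      moreover have "0 \<le> Re ?q" unfolding Rq
        using s by (intro sum_nonneg mult_nonneg_nonneg adm_val_Re(1) passive_nth(1)[OF P]) auto
      ultimately show "0 \<le> Re ?q \<and> norm ?q * Re s \<le> norm s * Re ?q" by simp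
    qed
  qed
qed

section \<open>Circuit trajectories in the Laplace domain\<close>

definition branch_voltage :: "circuit \<Rightarrow> (nat \<Rightarrow> real \<Rightarrow> real) \<Rightarrow> nat \<Rightarrow> real \<Rightarrow> real" where
  "branch_voltage cs e l t = voltage_drop cs (\<lambda>m. e m t) l"

lemma node_pot_eq_potential: "node_pot e p t = potential (\<lambda>m. e m t) p"
  by (cases p) auto

lemma circuit_trajectoryD:
  assumes tr: "circuit_trajectory n cs J e c" and P: "passive_circuit n cs"
  shows "m < n \<Longrightarrow> continuous_on {0..} (e m)"
    "l < length cs \<Longrightarrow> continuous_on {0..} (c l)"
    "l < length cs \<Longrightarrow> element_law (elem cs l) (branch_voltage cs e l) (c l)"
    "m < n \<Longrightarrow> t \<ge> 0 \<Longrightarrow> (\<Sum>l<length cs. incidence cs l m * c l t) = J m t"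
    "l < length cs \<Longrightarrow> continuous_on {0..} (branch_voltage cs e l)"
    "l < length cs \<Longrightarrow> laplace (branch_voltage cs e l) T s = voltage_drop cs (\<lambda>m. laplace (e m) T s) l"
proof -
  show e: "continuous_on {0..} (e m)" if "m < n" for m using tr that by (simp add: circuit_trajectory_def)
  show "l < length cs \<Longrightarrow> continuous_on {0..} (c l)" using tr by (simp add: circuit_trajectory_def)
  show "l < length cs \<Longrightarrow> element_law (elem cs l) (branch_voltage cs e l) (c l)"
    using tr unfolding circuit_trajectory_def branch_voltage_def[abs_def] voltage_drop_def node_pot_eq_potential
    by (cases "cs ! l") auto
  show "(\<Sum>l<length cs. incidence cs l m * c l t) = J m t" if "m < n" "t \<ge> 0" for m t
  proof -
    have "(\<Sum>l<length cs. incidence cs l m * c l t) = (\<Sum>l<length cs. case cs ! l of (a, b, el) \<Rightarrow>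
           (if a = Some m then c l t else 0) - (if b = Some m then c l t else 0))"
      by (intro sum.cong) (auto simp: incidence_def split: prod.splits)
    thus ?thesis using tr that by (simp add: circuit_trajectory_def)
  qed
  have bv: "branch_voltage cs e l = (\<lambda>t. \<Sum>m<n. incidence cs l m * e m t)" if "l < length cs" for l
    unfolding branch_voltage_def[abs_def] using voltage_drop_as_sum[OF P that] by auto
  show "l < length cs \<Longrightarrow> continuous_on {0..} (branch_voltage cs e l)"
    using e by (auto simp: bv intro!: continuous_intros)
  show "laplace (branch_voltage cs e l) T s = voltage_drop cs (\<lambda>m. laplace (e m) T s) l" if l: "l < length cs"
  proof -
    have "laplace (branch_voltage cs e l) T s = (\<Sum>m<n. laplace (\<lambda>t. incidence cs l m * e m t) T s)"
      unfolding bv[OF l] using e by (intro laplace_sum) (auto intro!: continuous_intros)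
    also have "\<dots> = (\<Sum>m<n. incidence cs l m * laplace (e m) T s)"
      by (intro sum.cong refl) (simp add: laplace_scale incidence_def split: prod.splits)
    finally show ?thesis using voltage_drop_as_sum[OF P l, of "\<lambda>m. laplace (e m) T s"] by simp
  qed
qed

text \<open>The transformed currents are paired with the voltage drops of the Kron potential
  \<open>x\<close> of \<open>u\<close> instead of those of the trajectory. The interior nodes then
  drop out, and each stored state is weighted by a drop that also occurs in the quadratic form, so
  it can be compared with the dissipation. \<open>\<rho> t\<close> uses the state at time
  \<open>t\<close>, with the same \<open>x\<close> for all \<open>t\<close>.\<close>

lemma circuit_laplace:
  assumes P: "passive_circuit n cs" and b: "b \<le> n" and inv: "invertible_mat (interior_adm b n cs)"
    and tr: "circuit_trajectory n cs (\<lambda>m t. if m < b then i m t else 0) e c"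
  shows "\<exists>\<rho> :: real \<Rightarrow> tf. (\<forall>t. \<exists>K. \<forall>\<^sub>F s in cofinite. Re s > 0 \<longrightarrow>
      (norm (tf_eval (\<rho> t) s))\<^sup>2 * Re s \<le> K * Re (tf_eval (kron_form b n cs u) s)) \<and>
    (\<forall>T\<ge>0. \<forall>\<^sub>F s in cofinite. (\<Sum>m<b. complex_of_real (u m) * laplace (i m) T s)
      = (\<Sum>m<b. laplace (e m) T s * tf_eval (kron_row b n cs u m) s) + tf_eval (\<rho> 0) s
        - exp (- s * complex_of_real T) * tf_eval (\<rho> T) s)"
proof -
  note trD = circuit_trajectoryD[OF tr P]
  obtain x where x: "\<forall>\<^sub>F s in cofinite. (\<forall>m<b. tf_eval (x m) s = complex_of_real (u m)) \<and>
    (\<forall>l<length cs. tf_eval (voltage_drop cs x l) s = voltage_drop cs (\<lambda>m. tf_eval (x m) s) l) \<and>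
    (\<forall>m<n. (\<Sum>l<length cs. incidence cs l m * (adm_val (elem cs l) s * voltage_drop cs (\<lambda>m. tf_eval (x m) s) l))
      = (if m < b then tf_eval (kron_row b n cs u m) s else 0))"
    using kron_potential_eval[OF P b inv] by blast
  define ini where "ini = (\<lambda>t l. init_src (elem cs l) (branch_voltage cs e l t) (c l t))"
  define iv where "iv = (\<lambda>t l. init_val (elem cs l) (branch_voltage cs e l t) (c l t))"
  define \<rho> where "\<rho> = (\<lambda>t. \<Sum>l<length cs. voltage_drop cs x l * ini t l)"
  have ev\<rho>: "\<forall>\<^sub>F s in cofinite. tf_eval (\<rho> t) s = (\<Sum>l<length cs. tf_eval (voltage_drop cs x l) s * iv t l s)" for t
  proof -
    have 1: "\<forall>\<^sub>F s in cofinite. tf_eval (\<rho> t) s = (\<Sum>l<length cs. tf_eval (voltage_drop cs x l * ini t l) s)"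
      unfolding \<rho>_def by (rule tf_eval_sum) simp
    have 2: "\<forall>\<^sub>F s in cofinite. \<forall>l\<in>{..<length cs}. tf_eval (voltage_drop cs x l * ini t l) s = tf_eval (voltage_drop cs x l) s * tf_eval (ini t l) s"
      by (intro eventually_ball_finite ballI tf_eval_mult) simp
    have 3: "\<forall>\<^sub>F s in cofinite. \<forall>l\<in>{..<length cs}. tf_eval (ini t l) s = iv t l s"
      unfolding ini_def iv_def by (intro eventually_ball_finite ballI tf_eval_init_src) simp
    show ?thesis using 1 2 3 by eventually_elim simp
  qed
  \<comment> \<open>Cauchy--Schwarz over the elements brings in \<open>length cs\<close>; the total
    energy is used as a bound for the energy of each element.\<close>
  have bound: "\<forall>\<^sub>F s in cofinite. Re s > 0 \<longrightarrow> (norm (tf_eval (\<rho> t) s))\<^sup>2 * Re s \<le> K * Re (tf_eval (kron_form b n cs u) s)"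
    if K: "K = (\<Sum>l<length cs. init_energy (elem cs l) (branch_voltage cs e l t) (c l t)) * real (length cs)" for t K
    using x tf_eval_kron_form[of b n cs u] ev\<rho>[of t]
  proof eventually_elim
    case (elim s)
    let ?q = "tf_eval (kron_form b n cs u) s"
    let ?d = "\<lambda>l. voltage_drop cs (\<lambda>m. tf_eval (x m) s) l"
    let ?E = "\<lambda>l. init_energy (elem cs l) (branch_voltage cs e l t) (c l t)"
    have q: "?q = (\<Sum>l<length cs. adm_val (elem cs l) s * complex_of_real ((norm (?d l))\<^sup>2))"
      unfolding elim(2) using elim(1) by (intro kron_form_energy[OF P b, of _ u]) auto
    show ?case
    proof
      assume s: "Re s > 0"
      note pas = passive_nth(1)[OF P]
      have Rq: "Re ?q = (\<Sum>l<length cs. Re (adm_val (elem cs l) s) * (norm (?d l))\<^sup>2)" unfolding q by simp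
      have E0: "0 \<le> ?E l" if "l < length cs" for l using adm_val_Re(4)[OF pas[OF that] s] .
      have "norm (tf_eval (\<rho> t) s) \<le> (\<Sum>l<length cs. norm (?d l * iv t l s))"
        unfolding elim(3) using elim(1) by (intro order_trans[OF norm_sum] sum_mono) auto
      hence "(norm (tf_eval (\<rho> t) s))\<^sup>2 \<le> (\<Sum>l<length cs. norm (?d l * iv t l s))\<^sup>2" by (rule power_mono) simp
      also have "\<dots> \<le> (\<Sum>l<length cs. (norm (?d l * iv t l s))\<^sup>2) * real (length cs)"
        using sum_squared_le_sum_of_squares[of "\<lambda>l. norm (?d l * iv t l s)" "{..<length cs}"] by simp
      finally have "(norm (tf_eval (\<rho> t) s))\<^sup>2 * Re s \<le> (\<Sum>l<length cs. (norm (?d l * iv t l s))\<^sup>2) * real (length cs) * Re s"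
        using s by (intro mult_right_mono) auto
      also have "\<dots> = real (length cs) * (\<Sum>l<length cs. ((norm (iv t l s))\<^sup>2 * Re s) * (norm (?d l))\<^sup>2)"
        by (simp add: sum_distrib_left sum_distrib_right norm_mult power_mult_distrib mult_ac)
      also have "\<dots> \<le> real (length cs) * (\<Sum>l<length cs. (?E l * Re (adm_val (elem cs l) s)) * (norm (?d l))\<^sup>2)"
        unfolding iv_def using s pas by (intro mult_left_mono sum_mono mult_right_mono adm_val_Re(3)) auto
      also have "\<dots> \<le> real (length cs) * (\<Sum>l<length cs. ((\<Sum>l<length cs. ?E l) * Re (adm_val (elem cs l) s)) * (norm (?d l))\<^sup>2)"
        using s pas E0 by (intro mult_left_mono sum_mono mult_right_mono adm_val_Re(1) member_le_sum) auto
      also have "\<dots> = K * Re ?q" unfolding Rq K by (simp add: sum_distrib_left mult_ac)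
      finally show "(norm (tf_eval (\<rho> t) s))\<^sup>2 * Re s \<le> K * Re ?q" .
    qed
  qed
  have rel: "\<forall>\<^sub>F s in cofinite. (\<Sum>m<b. complex_of_real (u m) * laplace (i m) T s)
      = (\<Sum>m<b. laplace (e m) T s * tf_eval (kron_row b n cs u m) s) + tf_eval (\<rho> 0) s
        - exp (- s * complex_of_real T) * tf_eval (\<rho> T) s" if T: "T \<ge> 0" for T
  proof -
    have s0: "\<forall>\<^sub>F s in cofinite. s \<noteq> (0::complex)" by (simp add: eventually_cofinite)
    show ?thesis using x ev\<rho>[of 0] ev\<rho>[of T] s0
    proof eventually_elim
      case (elim s)
      define z where "z = (\<lambda>m. tf_eval (x m) s)"
      define C where "C = (\<lambda>l. laplace (c l) T s)"
      let ?d = "voltage_drop cs z"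
      let ?y = "\<lambda>l. adm_val (elem cs l) s"
      let ?ex = "exp (- s * complex_of_real T)"
      have zb: "\<And>m. m < b \<Longrightarrow> z m = complex_of_real (u m)" using elim(1) by (simp add: z_def)
      have dz: "\<And>l. l < length cs \<Longrightarrow> tf_eval (voltage_drop cs x l) s = ?d l" using elim(1) by (simp add: z_def)
      have kcl: "\<And>m. m < n \<Longrightarrow> (\<Sum>l<length cs. incidence cs l m * (?y l * ?d l)) = (if m < b then tf_eval (kron_row b n cs u m) s else 0)"
        using elim(1) by (simp add: z_def)
      have Cl: "C l = ?y l * voltage_drop cs (\<lambda>m. laplace (e m) T s) l + iv 0 l s - ?ex * iv T l s" if l: "l < length cs" for l
        unfolding C_def iv_def using element_laplace[OF trD(3)[OF l] passive_nth(1)[OF P l] trD(5)[OF l] trD(2)[OF l] T elim(4)] trD(6)[OF l, of T s]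
        by simp
      have inj: "(if m < b then laplace (i m) T s else 0) = (\<Sum>l<length cs. incidence cs l m * C l)" if m: "m < n" for m
      proof -
        have "(if m < b then laplace (i m) T s else 0) = laplace (\<lambda>t. if m < b then i m t else 0) T s"
          by (simp add: laplace_def)
        also have "\<dots> = laplace (\<lambda>t. \<Sum>l<length cs. incidence cs l m * c l t) T s"
          using trD(4)[OF m] by (intro laplace_cong) simp
        also have "\<dots> = (\<Sum>l<length cs. laplace (\<lambda>t. incidence cs l m * c l t) T s)"
          using trD(2) by (intro laplace_sum) (auto intro!: continuous_intros)
        also have "\<dots> = (\<Sum>l<length cs. incidence cs l m * C l)"
          by (intro sum.cong refl) (simp add: laplace_scale C_def incidence_def split: prod.splits)
        finally show ?thesis .
      qed
      have "(\<Sum>m<b. complex_of_real (u m) * laplace (i m) T s) = (\<Sum>m<n. z m * (if m < b then laplace (i m) T s else 0))"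
        using b zb by (intro sum.mono_neutral_cong_left) auto
      also have "\<dots> = (\<Sum>l<length cs. C l * ?d l)"
        unfolding sum_voltage_drop[OF P] using inj by (intro sum.cong) auto
      also have "\<dots> = (\<Sum>l<length cs. (?y l * ?d l) * voltage_drop cs (\<lambda>m. laplace (e m) T s) l + ?d l * iv 0 l s - ?ex * (?d l * iv T l s))"
        by (intro sum.cong refl) (simp add: Cl ring_distribs mult_ac)
      also have "\<dots> = (\<Sum>l<length cs. (?y l * ?d l) * voltage_drop cs (\<lambda>m. laplace (e m) T s) l)
         + (\<Sum>l<length cs. ?d l * iv 0 l s) - ?ex * (\<Sum>l<length cs. ?d l * iv T l s)"
        by (simp add: sum.distrib sum_subtractf sum_distrib_left)
      \<comment> \<open>Second use of Tellegen's theorem with the roles exchanged: currents of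
        \<open>x\<close> against voltages of the trajectory. The current balance of \<open>x\<close>
        yields the Kron rows.\<close>
      also have "(\<Sum>l<length cs. (?y l * ?d l) * voltage_drop cs (\<lambda>m. laplace (e m) T s) l) = (\<Sum>m<n. laplace (e m) T s * (if m < b then tf_eval (kron_row b n cs u m) s else 0))"
        unfolding sum_voltage_drop[OF P] using kcl by (intro sum.cong) auto
      also have "\<dots> = (\<Sum>m<b. laplace (e m) T s * tf_eval (kron_row b n cs u m) s)"
        using b by (intro sum.mono_neutral_cong_right) auto
      finally show ?case unfolding elim(2,3) by (simp add: dz)
    qed
  qed
  show ?thesis using bound rel by (intro exI[of _ \<rho>]) blast
qed

section \<open>Responses in the time domain\<close>

lemma tame_lincomb:
  assumes "tame F" "tame G" shows "tame (\<lambda>t. c * F t + G t)"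
proof -
  obtain S where S: "finite S" "\<And>x. x \<notin> S \<Longrightarrow> isCont F x" using assms by (auto simp: tame_def)
  obtain S' where S': "finite S'" "\<And>x. x \<notin> S' \<Longrightarrow> isCont G x" using assms by (auto simp: tame_def)
  obtain M where M: "\<And>x. norm (F x) \<le> M" using tameD(3)[OF assms(1)] by blast
  obtain M' where M': "\<And>x. norm (G x) \<le> M'" using tameD(3)[OF assms(2)] by blast
  have "norm (c * F x + G x) \<le> norm c * M + M'" for x
    using M[of x] M'[of x] by (intro norm_triangle_le add_mono) (auto simp: norm_mult intro!: mult_left_mono)
  moreover have "isCont (\<lambda>t. c * F t + G t) x" if "x \<notin> S \<union> S'" for x
    using S(2) S'(2) that by (intro continuous_intros) auto
  ultimately show ?thesis unfolding tame_def using tameD(1)[OF assms(1)] tameD(1)[OF assms(2)] S(1) S'(1)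
    by (auto simp: bounded_iff intro!: exI[of _ "S \<union> S'"])
qed

lemma isCont_shift:
  fixes F :: "real \<Rightarrow> complex"
  assumes "isCont F (x - a)" shows "isCont (\<lambda>t. F (t - a)) x"
proof -
  have "isCont (\<lambda>t. t - a) x" by (intro continuous_intros)
  from isCont_o2[OF this assms] show ?thesis .
qed

lemma tame_shift:
  assumes "tame F" shows "tame (\<lambda>t. F (t - a))"
proof -
  obtain S where S: "finite S" "\<And>x. x \<notin> S \<Longrightarrow> isCont F x" using assms by (auto simp: tame_def)
  have "isCont (\<lambda>t. F (t - a)) x" if "x \<notin> (\<lambda>s. s + a) ` S" for x
  proof -
    have "x - a \<notin> S" using that by (auto simp: image_iff)
    from S(2)[OF this] show ?thesis by (rule isCont_shift)
  qed
  moreover have "integrable lborel (\<lambda>t. F (t - a))"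
    using lborel_integrable_real_affine[OF tameD(1)[OF assms], of 1 "-a"] by simp
  ultimately show ?thesis using tameD(3)[OF assms] S(1) unfolding tame_def
    by (auto simp: bounded_iff intro!: exI[of _ "(\<lambda>s. s + a) ` S"])
qed

lemma fourier_shift: "fourier (\<lambda>t. F (t - a)) w = iexp (-(w * a)) * fourier F w"
proof -
  have "fourier (\<lambda>t. F (t - a)) w = (LINT x|lborel. iexp (-(w * (a + 1 * x))) * F (a + 1 * x - a))"
    unfolding fourier_def by (subst lborel_integral_real_affine[of 1 _ a]) simp_all
  also have "\<dots> = (LINT x|lborel. iexp (-(w * a)) * (iexp (-(w * x)) * F x))"
  proof (intro Bochner_Integration.integral_cong refl)
    fix x
    have "iexp (-(w * (a + 1 * x))) = iexp (-(w * a)) * iexp (-(w * x))"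
      unfolding mult_exp_exp by (simp add: algebra_simps)
    thus "iexp (-(w * (a + 1 * x))) * F (a + 1 * x - a) = iexp (-(w * a)) * (iexp (-(w * x)) * F x)" by simp
  qed
  also have "\<dots> = iexp (-(w * a)) * fourier F w" unfolding fourier_def by simp
  finally show ?thesis .
qed

lemma LINT_Icc:
  fixes g :: "real \<Rightarrow> 'a::euclidean_space"
  assumes "continuous_on {a..b} g"
  shows "integrable lborel (\<lambda>x. indicator {a..b} x *\<^sub>R g x)"
    "(LINT x|lborel. indicator {a..b} x *\<^sub>R g x) = integral {a..b} g"
proof -
  have i: "set_integrable lborel {a..b} g" by (rule borel_integrable_atLeastAtMost'[OF assms])
  thus "integrable lborel (\<lambda>x. indicator {a..b} x *\<^sub>R g x)" by (simp add: set_integrable_def)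
  show "(LINT x|lborel. indicator {a..b} x *\<^sub>R g x) = integral {a..b} g"
    using set_borel_integral_eq_integral(2)[OF i] by (simp add: set_lebesgue_integral_def)
qed

definition truncate :: "(real \<Rightarrow> real) \<Rightarrow> real \<Rightarrow> real \<Rightarrow> complex" where
  "truncate W T t = indicator {0..T} t *\<^sub>R complex_of_real (W t)"

lemma truncate_isCont:
  assumes W: "continuous_on {0..} W" and t: "t \<noteq> 0" "t \<noteq> T"
  shows "isCont (truncate W T) t"
proof -
  consider "0 < t \<and> t < T" | "t < 0 \<or> t > T" using t by linarith
  thus ?thesis
  proof cases
    case 1
    hence ev: "\<forall>\<^sub>F x in nhds t. x \<in> {0<..<T}" by (intro eventually_nhds_in_open) auto
    have "isCont W t" using 1 continuous_on_interior[OF W, of t] by (simp add: interior_Ici)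
    hence "isCont (\<lambda>x. complex_of_real (W x)) t" by (intro continuous_intros)
    moreover have "\<forall>\<^sub>F x in nhds t. truncate W T x = complex_of_real (W x)"
      using ev by eventually_elim (auto simp: truncate_def)
    ultimately show ?thesis by (subst isCont_cong)
  next
    case 2
    hence "\<forall>\<^sub>F x in nhds t. x \<in> {..<0} \<union> {T<..}" by (intro eventually_nhds_in_open) auto
    hence "\<forall>\<^sub>F x in nhds t. truncate W T x = 0" by eventually_elim (auto simp: truncate_def)
    thus ?thesis by (subst isCont_cong) auto
  qed
qed

lemma truncate_nice:
  assumes W: "continuous_on {0..} W" shows "tame (truncate W T)"
proof -
  have c: "continuous_on {0..T} (\<lambda>t. complex_of_real (W t))"
    by (intro continuous_intros continuous_on_subset[OF W]) auto
  have "bounded ((\<lambda>t. complex_of_real (W t)) ` {0..T})"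
    by (intro compact_imp_bounded compact_continuous_image[OF c]) simp
  then obtain M where "\<forall>x\<in>(\<lambda>t. complex_of_real (W t)) ` {0..T}. norm x \<le> M" unfolding bounded_iff by blast
  hence "norm (truncate W T t) \<le> max M 0" for t by (force simp: truncate_def indicator_def)
  thus ?thesis unfolding tame_def using LINT_Icc(1)[OF c] truncate_isCont[OF W, of _ T]
    by (auto simp: bounded_iff truncate_def[abs_def] intro!: exI[of _ "{0, T}"])
qed

lemma fourier_trunc:
  assumes W: "continuous_on {0..} W" shows "fourier (truncate W T) w = laplace W T (\<i> * complex_of_real w)"
proof -
  let ?g = "\<lambda>x. exp (- (\<i> * complex_of_real w) * complex_of_real x) * complex_of_real (W x)"
  have "continuous_on {0..T} ?g"
    by (intro continuous_intros continuous_on_subset[OF W]) auto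
  from LINT_Icc(2)[OF this] show ?thesis
    unfolding fourier_def laplace_def truncate_def by (simp add: algebra_simps)
qed

lemma truncate_L2:
  assumes W: "continuous_on {0..} W" shows "(LINT t|lborel. (norm (truncate W T t))\<^sup>2) = integral {0..T} (\<lambda>t. (W t)\<^sup>2)"
proof -
  have "continuous_on {0..T} (\<lambda>t. (W t)\<^sup>2)" by (intro continuous_intros continuous_on_subset[OF W]) auto
  from LINT_Icc(2)[OF this] have "(LINT t|lborel. indicator {0..T} t *\<^sub>R (W t)\<^sup>2) = integral {0..T} (\<lambda>t. (W t)\<^sup>2)" .
  moreover have "(norm (truncate W T t))\<^sup>2 = indicator {0..T} t *\<^sub>R (W t)\<^sup>2" for t
    by (simp add: truncate_def indicator_def)
  ultimately show ?thesis by (simp only:)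
qed

lemma strictly_stable_kernel:
  assumes "strictly_stable h"
  shows "\<exists>k. decaying k \<and> (\<forall>w. fourier k w = tf_eval h (\<i> * complex_of_real w))"
proof -
  have "\<exists>k. decaying k \<and> (\<forall>w. fourier k w = poly (cpoly (tf_num h)) (\<i> * complex_of_real w) / poly (cpoly (tf_den h)) (\<i> * complex_of_real w))"
    using assms unfolding strictly_stable_def tf_poles_def
    by (intro decaying_rational) (auto simp: cpoly_hom)
  thus ?thesis by (simp add: tf_eval_def)
qed

text \<open>\<open>D\<close> is the value of \<open>h\<close> at infinity, hence a limit along the
  imaginary axis, which bounds it by the norm. The remainder \<open>h - D\<close> is strictly proper
  and has a decaying kernel.\<close>

lemma hinf_kernel:
  assumes h: "hinf_defined h"
  obtains D k where "norm D \<le> hinf_norm h" "decaying k"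
    "\<And>w. D + fourier k w = tf_eval h (\<i> * complex_of_real w)"
proof -
  let ?n = "cpoly (tf_num h)" and ?d = "cpoly (tf_den h)"
  define D where "D = coeff ?n (degree ?d) / lead_coeff ?d"
  have deg: "degree ?n \<le> degree ?d" using hinf_defined_proper[OF h] by (simp add: cpoly_hom)
  have d0: "?d \<noteq> 0" by (simp add: cpoly_hom)
  have stab: "Re s < 0" if "poly ?d s = 0" for s using h that by (auto simp: hinf_defined_def tf_poles_def)
  define r where "r = ?n - Polynomial.smult D ?d"
  have "r = 0 \<or> degree r < degree ?d"
  proof -
    have "degree r \<le> degree ?d" unfolding r_def using deg by (intro degree_diff_le) (auto simp: degree_smult_le)
    moreover have "coeff r (degree ?d) = 0" using d0 by (simp add: r_def D_def)
    ultimately show ?thesis using leading_coeff_0_iff le_neq_implies_less by metis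
  qed
  from decaying_rational[OF d0 stab this] obtain k where k: "decaying k" "\<And>w. fourier k w = poly r (\<i> * complex_of_real w) / poly ?d (\<i> * complex_of_real w)" by blast
  have eq: "D + fourier k w = tf_eval h (\<i> * complex_of_real w)" for w
  proof -
    have "poly ?d (\<i> * complex_of_real w) \<noteq> 0" using stab[of "\<i> * complex_of_real w"] by auto
    thus ?thesis unfolding k(2) tf_eval_def r_def by (simp add: field_simps)
  qed
  have f: "filterlim (\<lambda>w. \<i> * complex_of_real w) at_infinity at_top"
    by (intro tendsto_mult_filterlim_at_infinity[OF tendsto_const] filterlim_of_real_at_infinity) auto
  from filterlim_compose[OF tf_eval_tendsto_infinity[OF hinf_defined_proper[OF h]] f]
  have "((\<lambda>w. tf_eval h (\<i> * complex_of_real w)) \<longlongrightarrow> D) at_top"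
    by (simp add: D_def cpoly_hom)
  from tendsto_norm[OF this] have "norm D \<le> hinf_norm h"
    by (rule tendsto_upperbound) (auto intro!: always_eventually tf_eval_le_hinf_norm[OF h])
  from that[OF this k(1) eq] show ?thesis .
qed

text \<open>On the imaginary axis the relation equates the transforms of two signals:
  \<open>truncate W T\<close> plus the free response of the state at \<open>T\<close>, delayed by
  \<open>T\<close>, and the forced response plus the free response of the state at 0. Before
  \<open>T\<close> the delayed part vanishes by causality, so the identity holds on
  \<open>(0, T)\<close> with \<open>D\<close>, \<open>k\<close> and \<open>e\<close> chosen once for
  all \<open>T\<close>.\<close>

lemma response_time_domain:
  assumes h: "hinf_defined h" and cW: "continuous_on {0..} W" and cF: "continuous_on {0..} F"
    and \<eta>: "\<And>t. strictly_stable (\<eta> t)"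
    and rel: "\<And>T. T \<ge> 0 \<Longrightarrow> \<forall>\<^sub>F s in cofinite. laplace W T s = tf_eval h s * laplace F T s + tf_eval (\<eta> 0) s
        - exp (- s * complex_of_real T) * tf_eval (\<eta> T) s"
  obtains D k e where "norm D \<le> hinf_norm h" "decaying k" "decaying e"
    "\<And>t T. 0 < t \<Longrightarrow> t < T \<Longrightarrow> complex_of_real (W t) = D * complex_of_real (F t) + conv k (truncate F T) t + e t"
    "\<And>T. T \<ge> 0 \<Longrightarrow> (LINT t|lborel. (norm (D * truncate F T t + conv k (truncate F T) t))\<^sup>2) \<le> (hinf_norm h)\<^sup>2 * integral {0..T} (\<lambda>t. (F t)\<^sup>2)"
proof -
  obtain D k where D: "norm D \<le> hinf_norm h" "decaying k" "\<And>w. D + fourier k w = tf_eval h (\<i> * complex_of_real w)"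
    by (rule hinf_kernel[OF h]) blast
  obtain e where e: "decaying e" "\<And>w. fourier e w = tf_eval (\<eta> 0) (\<i> * complex_of_real w)"
    using strictly_stable_kernel[OF \<eta>] by blast
  have tF: "tame (truncate F T)" and tW: "tame (truncate W T)" for T by (intro truncate_nice cF cW)+
  have nk: "tame k" and ne: "tame e" by (intro decaying_nice D(2) e(1))+
  define m where "m = (\<lambda>T t. D * truncate F T t + conv k (truncate F T) t)"
  have nm: "tame (m T)" for T unfolding m_def by (intro tame_lincomb tF tame_conv nk)
  have ftm: "fourier (m T) w = tf_eval h (\<i> * complex_of_real w) * laplace F T (\<i> * complex_of_real w)" for T w
    unfolding m_def D(3)[symmetric]
    by (subst fourier_add) (auto simp: conv_integrable_fourier(2) tameD(1) tF nk tame_conv fourier_trunc[OF cF] algebra_simps)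
  have "complex_of_real (W t) = D * complex_of_real (F t) + conv k (truncate F T) t + e t" if t: "0 < t" "t < T" for t T
  proof -
    obtain j where j: "decaying j" "\<And>w. fourier j w = tf_eval (\<eta> T) (\<i> * complex_of_real w)"
      using strictly_stable_kernel[OF \<eta>] by blast
    define S where "S = (\<lambda>t. 1 * truncate W T t + j (t - T))"
    define R where "R = (\<lambda>t. 1 * m T t + e t)"
    define G where "G = (\<lambda>t. (-1) * R t + S t)"
    have nj: "tame (\<lambda>t. j (t - T))" by (intro tame_shift decaying_nice j(1))
    have nS: "tame S" and nR: "tame R" unfolding S_def R_def by (intro tame_lincomb tW nj nm ne)+
    have nG: "tame G" unfolding G_def by (intro tame_lincomb nS nR)
    let ?B = "{s. \<not> (laplace W T s = tf_eval h s * laplace F T s + tf_eval (\<eta> 0) s - exp (- s * complex_of_real T) * tf_eval (\<eta> T) s)}"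
    have "finite ?B" using rel[of T] t by (simp add: eventually_cofinite)
    hence fin: "finite ((\<lambda>w. \<i> * complex_of_real w) -` ?B)" by (rule finite_vimageI) (auto simp: inj_def)
    have "fourier G w = 0" if "w \<notin> (\<lambda>w. \<i> * complex_of_real w) -` ?B" for w
    proof -
      let ?s = "\<i> * complex_of_real w"
      have "fourier S w = 1 * fourier (truncate W T) w + fourier (\<lambda>t. j (t - T)) w"
        unfolding S_def by (intro fourier_add tameD(1) tW nj)
      hence 1: "fourier S w = laplace W T ?s + exp (- ?s * complex_of_real T) * tf_eval (\<eta> T) ?s"
        by (simp add: fourier_trunc[OF cW] fourier_shift j(2) mult_ac)
      have "fourier R w = 1 * fourier (m T) w + fourier e w"
        unfolding R_def by (intro fourier_add tameD(1) nm ne)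
      hence 2: "fourier R w = tf_eval h ?s * laplace F T ?s + tf_eval (\<eta> 0) ?s" by (simp add: ftm e(2))
      have "fourier G w = (-1) * fourier R w + fourier S w"
        unfolding G_def by (intro fourier_add tameD(1) nS nR)
      thus ?thesis using that 1 2 by simp
    qed
    \<comment> \<open>All jumps sit at 0 and \<open>T\<close>, hence the strict inequalities on
      \<open>t\<close>.\<close>
    moreover have "isCont G t"
    proof -
      have c: "isCont (truncate W T) t" "isCont (truncate F T) t" using t by (intro truncate_isCont cW cF; simp)+
      have ce: "isCont e t" using e(1) t by (simp add: decaying_def)
      have cj: "isCont (\<lambda>t. j (t - T)) t" using j(1) t by (intro isCont_shift) (simp add: decaying_def)
      have cc: "isCont (conv k (truncate F T)) t" by (rule tame_conv(2)[OF nk tF])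
      show ?thesis unfolding G_def S_def R_def m_def
        by (intro continuous_add continuous_mult continuous_const c ce cj cc)
    qed
    ultimately have "G t = 0" by (rule fourier_unique[OF nG fin])
    moreover have "j (t - T) = 0" using j(1) t by (simp add: decaying_def)
    ultimately have "complex_of_real (W t) - (D * complex_of_real (F t) + conv k (truncate F T) t + e t) = 0"
      using t by (simp add: G_def S_def R_def m_def truncate_def algebra_simps)
    thus ?thesis by simp
  qed
  moreover have "(LINT t|lborel. (norm (m T t))\<^sup>2) \<le> (hinf_norm h)\<^sup>2 * integral {0..T} (\<lambda>t. (F t)\<^sup>2)" if "T \<ge> 0" for T
    unfolding truncate_L2[OF cF, symmetric]
    by (rule plancherel_le[OF tF nm finite.emptyI hinf_norm_nonneg[OF h]])
      (simp add: ftm fourier_trunc[OF cF] norm_mult mult_right_mono tf_eval_le_hinf_norm[OF h])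
  ultimately show ?thesis unfolding m_def by (rule that[OF D(1,2) e(1)])
qed

section \<open>Small gain\<close>

text \<open>Young's inequality with a free weight: the factor close to 1 goes to the term that has
  to be absorbed, the large factor to a term already under control.\<close>

lemma norm_add_sq_le:
  fixes x y :: "'a::real_normed_vector"
  assumes "\<delta> > 0"
  shows "(norm (x + y))\<^sup>2 \<le> (1 + \<delta>) * (norm x)\<^sup>2 + (1 + 1 / \<delta>) * (norm y)\<^sup>2"
proof -
  have "(norm (x + y))\<^sup>2 \<le> (norm x + norm y)\<^sup>2" by (intro power_mono norm_triangle_ineq) simp
  also have "\<dots> = (norm x)\<^sup>2 + (norm y)\<^sup>2 + 2 * norm x * norm y" by (simp add: power2_sum)
  also have "2 * norm x * norm y \<le> \<delta> * (norm x)\<^sup>2 + (1 / \<delta>) * (norm y)\<^sup>2"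
  proof -
    have "(\<delta> * norm x - norm y)\<^sup>2 = \<delta> * (\<delta> * (norm x)\<^sup>2 + (1 / \<delta>) * (norm y)\<^sup>2 - 2 * norm x * norm y)"
      using assms by (simp add: power2_eq_square algebra_simps)
    hence "0 \<le> \<delta> * (\<delta> * (norm x)\<^sup>2 + (1 / \<delta>) * (norm y)\<^sup>2 - 2 * norm x * norm y)"
      by (metis zero_le_power2)
    hence "0 \<le> \<delta> * (norm x)\<^sup>2 + (1 / \<delta>) * (norm y)\<^sup>2 - 2 * norm x * norm y"
      using assms by (simp add: zero_le_mult_iff)
    thus ?thesis by simp
  qed
  finally show ?thesis by (simp add: algebra_simps)
qed

lemma integral_exp_window:
  assumes a: "a > 0" and t: "0 \<le> (t::real)"
  shows "integral {0..t} (\<lambda>u. exp (- (a * (t - u)))) \<le> 1 / a"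
proof -
  have "((\<lambda>u. exp (- (a * (t - u)))) has_integral (exp (- (a * (t - t))) / a - exp (- (a * (t - 0))) / a)) {0..t}"
  proof (rule fundamental_theorem_of_calculus[OF t])
    fix x assume "x \<in> {0..t}"
    show "((\<lambda>u. exp (- (a * (t - u))) / a) has_vector_derivative exp (- (a * (t - x)))) (at x within {0..t})"
      using a by (auto intro!: derivative_eq_intros simp: has_real_derivative_iff_has_vector_derivative[symmetric])
  qed
  hence "integral {0..t} (\<lambda>u. exp (- (a * (t - u)))) = 1 / a - exp (- (a * t)) / a" by (simp add: integral_unique)
  thus ?thesis using a by simp
qed

text \<open>The energy is finite, so after some \<open>\<tau>\<close> less than \<open>r / 2\<close>
  of it is left; the part before \<open>\<tau>\<close> is damped by the exponential weight.\<close>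

lemma exp_window_tendsto_0:
  fixes a B :: real and F :: "real \<Rightarrow> real"
  assumes a: "a > 0" and cF: "continuous_on {0..} F"
    and bd: "\<And>T. T \<ge> 0 \<Longrightarrow> integral {0..T} (\<lambda>t. (F t)\<^sup>2) \<le> B"
  shows "((\<lambda>t. integral {0..t} (\<lambda>u. exp (- (a * (t - u))) * (F u)\<^sup>2)) \<longlongrightarrow> 0) at_top"
proof (rule tendstoI)
  fix r :: real assume r: "r > 0"
  define P where "P = (\<lambda>T. integral {0..T} (\<lambda>t. (F t)\<^sup>2))"
  have int: "(\<lambda>t. (F t)\<^sup>2) integrable_on {x..y}" if "0 \<le> x" for x y
    by (intro integrable_continuous_interval continuous_intros continuous_on_subset[OF cF]) (use that in auto)
  have intE: "(\<lambda>u. exp (- (a * (t - u))) * (F u)\<^sup>2) integrable_on {x..y}" if "0 \<le> x" for t x y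
    by (intro integrable_continuous_interval continuous_intros continuous_on_subset[OF cF]) (use that in auto)
  have bdd: "bdd_above (P ` {0..})" using bd by (auto simp: P_def intro!: bdd_aboveI2)
  obtain \<tau> where \<tau>: "\<tau> \<ge> 0" "(SUP T\<in>{0..}. P T) - r / 2 < P \<tau>"
    using less_cSUP_iff[OF _ bdd, of "(SUP T\<in>{0..}. P T) - r / 2"] r by auto
  have tail: "P t - P \<tau> < r / 2" if "t \<ge> 0" for t
    using cSUP_upper[OF _ bdd, of t] \<tau>(2) that by simp
  have B0: "B \<ge> 0" using bd[of 0] by simp
  have est: "integral {0..t} (\<lambda>u. exp (- (a * (t - u))) * (F u)\<^sup>2) \<le> exp (- (a * (t - \<tau>))) * B + (P t - P \<tau>)" if t: "t \<ge> \<tau>" for t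
  proof -
    have "integral {0..t} (\<lambda>u. exp (- (a * (t - u))) * (F u)\<^sup>2)
      = integral {0..\<tau>} (\<lambda>u. exp (- (a * (t - u))) * (F u)\<^sup>2) + integral {\<tau>..t} (\<lambda>u. exp (- (a * (t - u))) * (F u)\<^sup>2)"
      using \<tau>(1) t intE by (intro Henstock_Kurzweil_Integration.integral_combine[symmetric]) auto
    also have "integral {0..\<tau>} (\<lambda>u. exp (- (a * (t - u))) * (F u)\<^sup>2) \<le> integral {0..\<tau>} (\<lambda>u. exp (- (a * (t - \<tau>))) * (F u)\<^sup>2)"
      using a t by (intro integral_le intE integrable_on_mult_right int mult_right_mono) auto
    also have "\<dots> \<le> exp (- (a * (t - \<tau>))) * B" using bd[OF \<tau>(1)] by simp
    also have "integral {\<tau>..t} (\<lambda>u. exp (- (a * (t - u))) * (F u)\<^sup>2) \<le> integral {\<tau>..t} (\<lambda>u. (F u)\<^sup>2)"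
      using a \<tau>(1) by (intro integral_le intE int mult_left_le_one_le) auto
    also have "\<dots> = P t - P \<tau>"
      using Henstock_Kurzweil_Integration.integral_combine[of 0 \<tau> t "\<lambda>u. (F u)\<^sup>2"] \<tau>(1) t int by (simp add: P_def)
    finally show ?thesis by simp
  qed
  have nn: "0 \<le> integral {0..t} (\<lambda>u. exp (- (a * (t - u))) * (F u)\<^sup>2)" for t
    by (rule integral_nonneg[OF intE]) auto
  have "((\<lambda>t. exp (- (a * (t - \<tau>))) * B) \<longlongrightarrow> 0 * B) at_top"
  proof (rule tendsto_mult_right)
    have "((\<lambda>t. exp (- a * t) * exp (a * \<tau>)) \<longlongrightarrow> 0 * exp (a * \<tau>)) at_top"
      using a by (intro tendsto_mult_right filterlim_compose[OF exp_at_bot] filterlim_tendsto_neg_mult_at_bot[OF tendsto_const _ filterlim_ident]) auto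
    thus "((\<lambda>t. exp (- (a * (t - \<tau>)))) \<longlongrightarrow> 0) at_top" by (simp add: mult_exp_exp algebra_simps)
  qed
  hence "\<forall>\<^sub>F t in at_top. exp (- (a * (t - \<tau>))) * B < r / 2"
    using r by (intro order_tendstoD(2)) auto
  moreover have "\<forall>\<^sub>F t in at_top. t \<ge> \<tau>" by (rule eventually_ge_at_top)
  ultimately show "\<forall>\<^sub>F t in at_top. dist (integral {0..t} (\<lambda>u. exp (- (a * (t - u))) * (F u)\<^sup>2)) 0 < r"
  proof eventually_elim
    case (elim t)
    thus ?case using est[of t] tail[of t] \<tau>(1) nn[of t] by (simp add: dist_real_def)
  qed
qed

text \<open>The bound of \<open>|F|\<close> by \<open>\<epsilon> + F^2 / \<epsilon>\<close> takes
  the place of Cauchy--Schwarz and reduces the claim to an exponential window of \<open>F^2\<close>.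
  Since \<open>k\<close> is causal, any horizon beyond \<open>t\<close> gives the same value;
  \<open>t + 1\<close> fits the condition \<open>t < T\<close> of the representation of
  \<open>W\<close>.\<close>

lemma conv_truncate_tendsto_0:
  assumes k: "decaying k" and cF: "continuous_on {0..} F"
    and bd: "\<And>T. T \<ge> 0 \<Longrightarrow> integral {0..T} (\<lambda>t. (F t)\<^sup>2) \<le> B"
  shows "((\<lambda>t. conv k (truncate F (t + 1)) t) \<longlongrightarrow> 0) at_top"
proof (rule tendstoI)
  fix r :: real assume r: "r > 0"
  obtain C a where C: "C > 0" "0 < a" "\<And>t. norm (k t) \<le> C * (indicator {0..} t * exp (- (a * t)))"
    by (rule decaying_bound[OF k]) blast
  \<comment> \<open>Chosen so that the constant part \<open>C * \<epsilon> / a\<close> of the bound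
    equals \<open>r / 2\<close>.\<close>
  define \<epsilon> where "\<epsilon> = r * a / (2 * C)"
  have \<epsilon>: "\<epsilon> > 0" using r C by (simp add: \<epsilon>_def)
  let ?J = "\<lambda>t. integral {0..t} (\<lambda>u. exp (- (a * (t - u))) * (F u)\<^sup>2)"
  have amgm: "\<bar>x\<bar> \<le> \<epsilon> + x\<^sup>2 / \<epsilon>" for x :: real
  proof -
    have "0 \<le> (\<bar>x\<bar> - \<epsilon>)\<^sup>2" by simp
    hence "2 * \<epsilon> * \<bar>x\<bar> \<le> x\<^sup>2 + \<epsilon>\<^sup>2" by (simp add: power2_diff algebra_simps)
    moreover have "\<epsilon> * \<bar>x\<bar> \<ge> 0" using \<epsilon> by simp
    ultimately have "\<bar>x\<bar> * \<epsilon> \<le> \<epsilon> * \<epsilon> + x\<^sup>2" by (simp add: power2_eq_square algebra_simps)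
    hence "\<bar>x\<bar> \<le> (\<epsilon> * \<epsilon> + x\<^sup>2) / \<epsilon>" by (simp only: pos_le_divide_eq[OF \<epsilon>])
    thus ?thesis using \<epsilon> by (simp add: add_divide_distrib)
  qed
  have bnd: "norm (conv k (truncate F (t + 1)) t) \<le> C * (\<epsilon> * (1 / a)) + C / \<epsilon> * ?J t" if t: "t \<ge> 0" for t
  proof -
    let ?g = "\<lambda>u. C * \<epsilon> * exp (- (a * (t - u))) + C / \<epsilon> * (exp (- (a * (t - u))) * (F u)\<^sup>2)"
    have c1: "continuous_on {0..t} (\<lambda>u. exp (- (a * (t - u))))" by (intro continuous_intros)
    have c2: "continuous_on {0..t} (\<lambda>u. exp (- (a * (t - u))) * (F u)\<^sup>2)"
      by (intro continuous_intros continuous_on_subset[OF cF]) auto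
    have cg: "continuous_on {0..t} ?g" by (intro continuous_on_add continuous_on_mult continuous_on_const c1 c2)
    have "norm (conv k (truncate F (t + 1)) t) \<le> (LINT u|lborel. norm (k (t - u) * truncate F (t + 1) u))"
      unfolding conv_def by (rule integral_norm_bound)
    also have "\<dots> \<le> (LINT u|lborel. indicator {0..t} u *\<^sub>R ?g u)"
    proof (rule integral_mono_AE')
      show "integrable lborel (\<lambda>u. indicator {0..t} u *\<^sub>R ?g u)" by (rule LINT_Icc(1)[OF cg])
      show "AE u in lborel. norm (k (t - u) * truncate F (t + 1) u) \<le> indicator {0..t} u *\<^sub>R ?g u"
      proof (rule AE_I2)
        fix u :: real
        show "norm (k (t - u) * truncate F (t + 1) u) \<le> indicator {0..t} u *\<^sub>R ?g u"
        proof (cases "0 \<le> u \<and> u \<le> t")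
          case True
          have "norm (k (t - u) * truncate F (t + 1) u) = norm (k (t - u)) * \<bar>F u\<bar>"
            using True by (simp add: norm_mult truncate_def)
          also have "\<dots> \<le> (C * exp (- (a * (t - u)))) * (\<epsilon> + (F u)\<^sup>2 / \<epsilon>)"
            using C(3)[of "t - u"] True C(1) amgm[of "F u"] by (intro mult_mono) auto
          finally show ?thesis using True by (simp add: algebra_simps)
        next
          case False
          hence "k (t - u) = 0 \<or> truncate F (t + 1) u = 0" using k by (auto simp: decaying_def truncate_def)
          thus ?thesis using False by auto
        qed
      qed
      show "AE u in lborel. 0 \<le> indicator {0..t} u *\<^sub>R ?g u"
        using C(1) \<epsilon> by (auto intro!: mult_nonneg_nonneg add_nonneg_nonneg)
    qed
    also have "\<dots> = integral {0..t} ?g" by (rule LINT_Icc(2)[OF cg])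
    also have "\<dots> = C * \<epsilon> * integral {0..t} (\<lambda>u. exp (- (a * (t - u)))) + C / \<epsilon> * ?J t"
      unfolding integral_mult_right[symmetric]
      by (intro integral_add integrable_on_mult_right integrable_continuous_interval c1 c2)
    also have "\<dots> \<le> C * \<epsilon> * (1 / a) + C / \<epsilon> * ?J t"
      using integral_exp_window[OF C(2) t] C(1) \<epsilon> by (intro add_mono mult_left_mono) auto
    finally show ?thesis by simp
  qed
  have "((\<lambda>t. C / \<epsilon> * ?J t) \<longlongrightarrow> C / \<epsilon> * 0) at_top"
    by (intro tendsto_mult_left exp_window_tendsto_0[OF C(2) cF bd])
  hence "\<forall>\<^sub>F t in at_top. C / \<epsilon> * ?J t < r / 2" using r by (intro order_tendstoD(2)) auto
  moreover have "\<forall>\<^sub>F t::real in at_top. t \<ge> 0" by (rule eventually_ge_at_top)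
  ultimately show "\<forall>\<^sub>F t in at_top. dist (conv k (truncate F (t + 1)) t) 0 < r"
  proof (eventually_elim)
    case (elim t)
    moreover have "C * (\<epsilon> * (1 / a)) = r / 2" using C by (simp add: \<epsilon>_def)
    ultimately show ?case using bnd[OF elim(2)] elim(1) unfolding dist_norm diff_zero by linarith
  qed
qed

lemma decaying_tendsto_0:
  assumes "decaying k" shows "(k \<longlongrightarrow> 0) at_top"
proof -
  obtain C a where C: "C > 0" "0 < a" "\<And>t. norm (k t) \<le> C * (indicator {0..} t * exp (- (a * t)))"
    by (rule decaying_bound[OF assms]) blast
  have "((\<lambda>t. C * exp (- a * t)) \<longlongrightarrow> C * 0) at_top"
    using C(2) by (intro tendsto_mult_left filterlim_compose[OF exp_at_bot] filterlim_tendsto_neg_mult_at_bot[OF tendsto_const _ filterlim_ident]) auto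
  moreover have "norm (k t) \<le> C * exp (- a * t)" for t
    by (rule order_trans[OF C(3)]) (use C(1) in \<open>auto simp: indicator_def\<close>)
  ultimately show ?thesis
    by (intro Lim_null_comparison[of k "\<lambda>t. C * exp (- a * t)"]) auto
qed

text \<open>The modes are estimated together, since \<open>lip\<close> compares only sums over all
  of them. Integrals over \<open>[0, T]\<close> are finite, so the part with factor
  \<open>\<theta> < 1\<close> can be moved to the left, and the bound that remains does not depend
  on \<open>T\<close>. The same absorption at a single time then gives the decay.\<close>

lemma small_gain:
  fixes W f :: "'i \<Rightarrow> real \<Rightarrow> real"
  assumes fin: "finite A" and cW: "\<And>i. i \<in> A \<Longrightarrow> continuous_on {0..} (W i)" and cf: "\<And>i. i \<in> A \<Longrightarrow> continuous_on {0..} (f i)"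
    and \<gamma>: "\<gamma> \<ge> 0" and \<sigma>: "\<sigma> \<ge> 0" and gain: "\<gamma> * \<sigma> < 1"
    and D: "\<And>i. i \<in> A \<Longrightarrow> norm (D i) \<le> \<gamma>" and k: "\<And>i. i \<in> A \<Longrightarrow> decaying (k i)" and e: "\<And>i. i \<in> A \<Longrightarrow> decaying (e i)"
    and rep: "\<And>i t T. i \<in> A \<Longrightarrow> 0 < t \<Longrightarrow> t < T \<Longrightarrow> complex_of_real (W i t) = D i * complex_of_real (f i t) + conv (k i) (truncate (f i) T) t + e i t"
    and L2: "\<And>i T. i \<in> A \<Longrightarrow> T \<ge> 0 \<Longrightarrow> (LINT t|lborel. (norm (D i * truncate (f i) T t + conv (k i) (truncate (f i) T) t))\<^sup>2) \<le> \<gamma>\<^sup>2 * integral {0..T} (\<lambda>t. (f i t)\<^sup>2)"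
    and lip: "\<And>t. t \<ge> 0 \<Longrightarrow> (\<Sum>i\<in>A. (f i t)\<^sup>2) \<le> \<sigma>\<^sup>2 * (\<Sum>i\<in>A. (W i t)\<^sup>2)"
    and i: "i \<in> A"
  shows "(W i \<longlongrightarrow> 0) at_top"
proof -
  define q where "q = (\<gamma> * \<sigma>)\<^sup>2"
  have q: "0 \<le> q" "q < 1" using gain \<gamma> \<sigma> by (simp_all add: q_def power_less_one_iff abs_square_less_1)
  \<comment> \<open>Half of the gap left by \<open>q\<close>; then
    \<open>1 - \<theta> = (1 - q) * (1 - q / 2)\<close> is positive.\<close>
  define \<delta> where "\<delta> = (1 - q) / 2"
  have \<delta>: "\<delta> > 0" using q by (simp add: \<delta>_def)
  define \<theta> where "\<theta> = (1 + \<delta>) * q"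
  have \<theta>: "\<theta> < 1"
  proof -
    have "1 - \<theta> = (1 - q) * (1 - q / 2)" by (simp add: \<theta>_def \<delta>_def algebra_simps)
    also have "\<dots> > 0" using q by simp
    finally show ?thesis by simp
  qed
  have cW2: "continuous_on {0..T} (\<lambda>t. (W i t)\<^sup>2)" if "i \<in> A" for i T
    by (intro continuous_intros continuous_on_subset[OF cW[OF that]]) auto
  have cf2: "continuous_on {0..T} (\<lambda>t. (f i t)\<^sup>2)" if "i \<in> A" for i T
    by (intro continuous_intros continuous_on_subset[OF cf[OF that]]) auto
  define E where "E = (\<lambda>i. (LINT t|lborel. (norm (e i t))\<^sup>2))"
  define C where "C = (1 + 1 / \<delta>) * (\<Sum>i\<in>A. E i) / (1 - \<theta>)"
  have each: "integral {0..T} (\<lambda>t. (W i t)\<^sup>2) \<le> (1 + \<delta>) * (\<gamma>\<^sup>2 * integral {0..T} (\<lambda>t. (f i t)\<^sup>2)) + (1 + 1 / \<delta>) * E i"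
    if i: "i \<in> A" and T: "T \<ge> 0" for i T
  proof -
    let ?m = "\<lambda>t. D i * truncate (f i) T t + conv (k i) (truncate (f i) T) t"
    have nm: "tame ?m" by (intro tame_lincomb truncate_nice cf[OF i] tame_conv decaying_nice k[OF i])
    have ne: "tame (e i)" by (intro decaying_nice e i)
    have nW: "tame (truncate (W i) T)" by (intro truncate_nice cW i)
    have "integral {0..T} (\<lambda>t. (W i t)\<^sup>2) = (LINT t|lborel. (norm (truncate (W i) T t))\<^sup>2)"
      by (rule truncate_L2[OF cW[OF i], symmetric])
    also have "\<dots> \<le> (LINT t|lborel. (1 + \<delta>) * (norm (?m t))\<^sup>2 + (1 + 1 / \<delta>) * (norm (e i t))\<^sup>2)"
    proof (rule integral_mono_AE)
      show "integrable lborel (\<lambda>t. (norm (truncate (W i) T t))\<^sup>2)" by (rule tame_sq_integrable[OF nW])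
      show "integrable lborel (\<lambda>t. (1 + \<delta>) * (norm (?m t))\<^sup>2 + (1 + 1 / \<delta>) * (norm (e i t))\<^sup>2)"
        using tame_sq_integrable[OF nm] tame_sq_integrable[OF ne] by auto
      show "AE t in lborel. (norm (truncate (W i) T t))\<^sup>2 \<le> (1 + \<delta>) * (norm (?m t))\<^sup>2 + (1 + 1 / \<delta>) * (norm (e i t))\<^sup>2"
        using AE_lborel_singleton[of 0] AE_lborel_singleton[of T]
      proof eventually_elim
        case (elim t)
        show ?case
        proof (cases "0 < t \<and> t < T")
          case True
          have "truncate (W i) T t = ?m t + e i t"
            using rep[OF i, of t T] True by (simp add: truncate_def)
          thus ?thesis using norm_add_sq_le[OF \<delta>, of "?m t" "e i t"] by simp
        next
          case False
          hence "truncate (W i) T t = 0" using elim by (auto simp: truncate_def)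
          thus ?thesis using \<delta> by simp
        qed
      qed
    qed
    also have "\<dots> = (1 + \<delta>) * (LINT t|lborel. (norm (?m t))\<^sup>2) + (1 + 1 / \<delta>) * E i"
      unfolding E_def using tame_sq_integrable[OF nm] tame_sq_integrable[OF ne]
      by (subst Bochner_Integration.integral_add) auto
    also have "\<dots> \<le> (1 + \<delta>) * (\<gamma>\<^sup>2 * integral {0..T} (\<lambda>t. (f i t)\<^sup>2)) + (1 + 1 / \<delta>) * E i"
      using L2[OF i T] \<delta> by (intro add_mono mult_left_mono) auto
    finally show ?thesis .
  qed
  have fW: "(\<Sum>i\<in>A. integral {0..T} (\<lambda>t. (f i t)\<^sup>2)) \<le> \<sigma>\<^sup>2 * (\<Sum>i\<in>A. integral {0..T} (\<lambda>t. (W i t)\<^sup>2))" for T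
  proof -
    have "(\<Sum>i\<in>A. integral {0..T} (\<lambda>t. (f i t)\<^sup>2)) = integral {0..T} (\<lambda>t. \<Sum>i\<in>A. (f i t)\<^sup>2)"
      using fin cf2 by (intro integral_sum[symmetric] integrable_continuous_interval) auto
    also have "\<dots> \<le> integral {0..T} (\<lambda>t. \<sigma>\<^sup>2 * (\<Sum>i\<in>A. (W i t)\<^sup>2))"
      using lip cf2 cW2 by (intro integral_le integrable_continuous_interval continuous_on_sum continuous_on_mult continuous_on_const) auto
    also have "\<dots> = \<sigma>\<^sup>2 * (\<Sum>i\<in>A. integral {0..T} (\<lambda>t. (W i t)\<^sup>2))"
      using fin cW2 by (subst integral_mult_right, subst integral_sum) (auto intro!: integrable_continuous_interval)
    finally show ?thesis .
  qed
  have SC: "(\<Sum>i\<in>A. integral {0..T} (\<lambda>t. (W i t)\<^sup>2)) \<le> C" (is "?S \<le> C") if T: "T \<ge> 0" for T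
  proof -
    have "?S \<le> (\<Sum>i\<in>A. (1 + \<delta>) * (\<gamma>\<^sup>2 * integral {0..T} (\<lambda>t. (f i t)\<^sup>2)) + (1 + 1 / \<delta>) * E i)"
      by (intro sum_mono each T)
    also have "\<dots> = (1 + \<delta>) * (\<gamma>\<^sup>2 * (\<Sum>i\<in>A. integral {0..T} (\<lambda>t. (f i t)\<^sup>2))) + (1 + 1 / \<delta>) * (\<Sum>i\<in>A. E i)"
      by (simp only: sum.distrib sum_distrib_left)
    also have "\<dots> \<le> (1 + \<delta>) * (\<gamma>\<^sup>2 * (\<sigma>\<^sup>2 * ?S)) + (1 + 1 / \<delta>) * (\<Sum>i\<in>A. E i)"
      using fW \<delta> by (intro add_mono mult_left_mono) auto
    also have "\<dots> = \<theta> * ?S + (1 + 1 / \<delta>) * (\<Sum>i\<in>A. E i)"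
      by (simp add: \<theta>_def q_def power_mult_distrib)
    finally have "?S * (1 - \<theta>) \<le> (1 + 1 / \<delta>) * (\<Sum>i\<in>A. E i)" by (simp add: algebra_simps)
    thus ?thesis using \<theta> by (simp add: C_def pos_le_divide_eq)
  qed
  have fB: "integral {0..T} (\<lambda>t. (f i t)\<^sup>2) \<le> \<sigma>\<^sup>2 * C" if i: "i \<in> A" and T: "T \<ge> 0" for i T
  proof -
    have "integral {0..T} (\<lambda>t. (f i t)\<^sup>2) \<le> (\<Sum>i\<in>A. integral {0..T} (\<lambda>t. (f i t)\<^sup>2))"
      using fin i by (intro member_le_sum integral_nonneg integrable_continuous_interval cf2) auto
    also have "\<dots> \<le> \<sigma>\<^sup>2 * C" using fW[of T] SC[OF T] by (meson mult_left_mono order_trans zero_le_power2)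
    finally show ?thesis .
  qed
  \<comment> \<open>Everything in \<open>W i\<close> except the feedthrough; it tends to 0 because
    \<open>f i\<close> is now known to have finite energy.\<close>
  define p where "p = (\<lambda>i t. conv (k i) (truncate (f i) (t + 1)) t + e i t)"
  have p0: "(p i \<longlongrightarrow> 0) at_top" if i: "i \<in> A" for i
    unfolding p_def using tendsto_add[OF conv_truncate_tendsto_0[OF k[OF i] cf[OF i] fB[OF i]] decaying_tendsto_0[OF e[OF i]]] by simp
  define V where "V = (\<lambda>t. \<Sum>i\<in>A. (W i t)\<^sup>2)"
  \<comment> \<open>Feedthrough and nonlinearity close a loop at each time, of gain at most
    \<open>\<gamma> * \<sigma>\<close> because \<open>norm (D i)\<close> is bounded by the same
    \<open>\<gamma>\<close>.\<close>
  have V: "V t \<le> (1 + 1 / \<delta>) / (1 - \<theta>) * (\<Sum>i\<in>A. (norm (p i t))\<^sup>2)" if t: "t > 0" for t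
  proof -
    have "V t \<le> (\<Sum>i\<in>A. (1 + \<delta>) * (\<gamma>\<^sup>2 * (f i t)\<^sup>2) + (1 + 1 / \<delta>) * (norm (p i t))\<^sup>2)"
      unfolding V_def
    proof (rule sum_mono)
      fix i assume i: "i \<in> A"
      have "complex_of_real (W i t) = D i * complex_of_real (f i t) + p i t"
        using rep[OF i t, of "t + 1"] by (simp add: p_def)
      hence "(W i t)\<^sup>2 = (norm (D i * complex_of_real (f i t) + p i t))\<^sup>2"
        by (metis norm_of_real power2_abs)
      also have "\<dots> \<le> (1 + \<delta>) * (norm (D i * complex_of_real (f i t)))\<^sup>2 + (1 + 1 / \<delta>) * (norm (p i t))\<^sup>2"
        by (rule norm_add_sq_le[OF \<delta>])
      also have "(norm (D i * complex_of_real (f i t)))\<^sup>2 \<le> \<gamma>\<^sup>2 * (f i t)\<^sup>2"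
        unfolding norm_mult power_mult_distrib using D[OF i] by (simp add: mult_right_mono power_mono)
      finally show "(W i t)\<^sup>2 \<le> (1 + \<delta>) * (\<gamma>\<^sup>2 * (f i t)\<^sup>2) + (1 + 1 / \<delta>) * (norm (p i t))\<^sup>2"
        using \<delta> by simp
    qed
    also have "\<dots> = (1 + \<delta>) * (\<gamma>\<^sup>2 * (\<Sum>i\<in>A. (f i t)\<^sup>2)) + (1 + 1 / \<delta>) * (\<Sum>i\<in>A. (norm (p i t))\<^sup>2)"
      by (simp only: sum.distrib sum_distrib_left)
    also have "\<dots> \<le> (1 + \<delta>) * (\<gamma>\<^sup>2 * (\<sigma>\<^sup>2 * V t)) + (1 + 1 / \<delta>) * (\<Sum>i\<in>A. (norm (p i t))\<^sup>2)"
      unfolding V_def using lip[of t] t \<delta> by (intro add_mono mult_left_mono) auto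
    also have "\<dots> = \<theta> * V t + (1 + 1 / \<delta>) * (\<Sum>i\<in>A. (norm (p i t))\<^sup>2)"
      by (simp add: \<theta>_def q_def power_mult_distrib)
    finally have "V t * (1 - \<theta>) \<le> (1 + 1 / \<delta>) * (\<Sum>i\<in>A. (norm (p i t))\<^sup>2)" by (simp add: algebra_simps)
    thus ?thesis using \<theta> by (simp add: pos_le_divide_eq)
  qed
  have lim: "((\<lambda>t. (1 + 1 / \<delta>) / (1 - \<theta>) * (\<Sum>i\<in>A. (norm (p i t))\<^sup>2)) \<longlongrightarrow> (1 + 1 / \<delta>) / (1 - \<theta>) * (\<Sum>i\<in>A. (norm (0::complex))\<^sup>2)) at_top"
    by (intro tendsto_mult_left tendsto_sum tendsto_power tendsto_norm p0)
  have "((\<lambda>t. (W i t)\<^sup>2) \<longlongrightarrow> 0) at_top"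
  proof (rule Lim_null_comparison)
    show "((\<lambda>t. (1 + 1 / \<delta>) / (1 - \<theta>) * (\<Sum>i\<in>A. (norm (p i t))\<^sup>2)) \<longlongrightarrow> 0) at_top" using lim by simp
    have "\<forall>\<^sub>F t::real in at_top. t > 0" by (rule eventually_gt_at_top)
    thus "\<forall>\<^sub>F t in at_top. norm ((W i t)\<^sup>2) \<le> (1 + 1 / \<delta>) / (1 - \<theta>) * (\<Sum>i\<in>A. (norm (p i t))\<^sup>2)"
    proof eventually_elim
      case (elim t)
      have "(W i t)\<^sup>2 \<le> V t" unfolding V_def using fin i by (intro member_le_sum) auto
      thus ?case using V[OF elim] by simp
    qed
  qed
  from tendsto_real_sqrt[OF this] have "((\<lambda>t. \<bar>W i t\<bar>) \<longlongrightarrow> 0) at_top" by simp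
  thus ?thesis by (rule tendsto_rabs_zero_cancel)
qed

section \<open>Symmetric matrices and the Laplacian\<close>

text \<open>Vectors are functions on \<open>nat\<close> of which the first \<open>N\<close> values
  count. Coordinates are then continuous in the product topology, and compactness comes from
  Tychonoff's theorem.\<close>

definition inprod :: "nat \<Rightarrow> (nat \<Rightarrow> real) \<Rightarrow> (nat \<Rightarrow> real) \<Rightarrow> real" where
  "inprod N x y = (\<Sum>j<N. x j * y j)"

lemma inprod_comm: "inprod N x y = inprod N y x"
  by (simp add: inprod_def mult.commute)

lemma inprod_add: "inprod N (\<lambda>j. x j + y j) z = inprod N x z + inprod N y z" "inprod N z (\<lambda>j. x j + y j) = inprod N z x + inprod N z y"
  by (simp_all add: inprod_def algebra_simps sum.distrib)

lemma inprod_diff: "inprod N (\<lambda>j. x j - y j) z = inprod N x z - inprod N y z" "inprod N z (\<lambda>j. x j - y j) = inprod N z x - inprod N z y"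
  by (simp_all add: inprod_def algebra_simps sum_subtractf)

lemma inprod_scale: "inprod N (\<lambda>j. c * x j) y = c * inprod N x y" "inprod N y (\<lambda>j. c * x j) = c * inprod N y x"
  by (simp_all add: inprod_def sum_distrib_left mult_ac)

lemma inprod_sum: "inprod N z (\<lambda>j. \<Sum>i\<in>A. x i j) = (\<Sum>i\<in>A. inprod N z (x i))"
  unfolding inprod_def sum_distrib_left by (rule sum.swap)

lemma inprod_nonneg: "0 \<le> inprod N x x"
  by (simp add: inprod_def sum_nonneg)

lemma inprod_eq_0: "inprod N x x = 0 \<longleftrightarrow> (\<forall>j<N. x j = 0)"
  unfolding inprod_def by (subst sum_nonneg_eq_0_iff) auto

lemma inprod_cong: "(\<And>j. j < N \<Longrightarrow> x j = x' j) \<Longrightarrow> (\<And>j. j < N \<Longrightarrow> y j = y' j) \<Longrightarrow> inprod N x y = inprod N x' y'"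
  unfolding inprod_def by (intro sum.cong) auto

definition matvec :: "nat \<Rightarrow> (nat \<Rightarrow> nat \<Rightarrow> real) \<Rightarrow> (nat \<Rightarrow> real) \<Rightarrow> nat \<Rightarrow> real" where
  "matvec N M x j = (\<Sum>k<N. M j k * x k)"

lemma inprod_app:
  assumes "\<And>j k. j < N \<Longrightarrow> k < N \<Longrightarrow> M j k = M k j"
  shows "inprod N x (matvec N M y) = inprod N (matvec N M x) y"
proof -
  have "inprod N x (matvec N M y) = (\<Sum>j<N. \<Sum>k<N. x j * (M j k * y k))"
    by (simp add: inprod_def matvec_def sum_distrib_left)
  also have "\<dots> = (\<Sum>k<N. \<Sum>j<N. x j * (M j k * y k))" by (rule sum.swap)
  also have "\<dots> = inprod N (matvec N M x) y"
    unfolding inprod_def matvec_def sum_distrib_right using assms by (intro sum.cong refl) (simp add: mult_ac)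
  finally show ?thesis .
qed

lemma matvec_lin: "matvec N M (\<lambda>j. x j + y j) = (\<lambda>j. matvec N M x j + matvec N M y j)"
  "matvec N M (\<lambda>j. c * x j) = (\<lambda>j. c * matvec N M x j)"
  by (simp_all add: matvec_def fun_eq_iff algebra_simps sum.distrib sum_distrib_left)

section \<open>Spectral theorem for real symmetric matrices\<close>

lemma quadratic_nonneg_imp_linear_zero:
  fixes B q :: real
  assumes "\<And>t. 0 \<le> 2 * t * B + t\<^sup>2 * q" "0 \<le> q"
  shows "B = 0"
proof -
  \<comment> \<open>The minimiser would be \<open>- B / q\<close>; the denominator
    \<open>q + 1\<close> also works for \<open>q = 0\<close>.\<close>
  define t where "t = - B / (q + 1)"
  have t: "t * (q + 1) = - B" using assms(2) by (simp add: t_def)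
  have "0 \<le> (2 * t * B + t\<^sup>2 * q) * (q + 1)\<^sup>2" by (intro mult_nonneg_nonneg assms(1)) simp
  also have "\<dots> = 2 * B * (q + 1) * (t * (q + 1)) + (t * (q + 1))\<^sup>2 * q"
    by (simp only: power2_eq_square ring_distribs mult_ac)
  also have "\<dots> = - (B\<^sup>2 * (q + 2))"
    unfolding t by (simp add: power2_eq_square algebra_simps)
  finally have "B\<^sup>2 * (q + 2) \<le> 0" by simp
  thus ?thesis using assms(2) by (simp add: mult_le_0_iff)
qed

lemma compact_box: "compact {x :: nat \<Rightarrow> real. \<forall>j. x j \<in> S j}" if "\<And>j. compact (S j)"
proof -
  have "compactin (product_topology (\<lambda>_. euclidean) UNIV) (PiE UNIV S)"
    using that by (subst compactin_PiE) (auto simp: compactin_euclidean_iff)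
  moreover have "PiE UNIV S = {x. \<forall>j. x j \<in> S j}" by (auto simp: PiE_UNIV_domain)
  ultimately show ?thesis by (simp add: euclidean_product_topology flip: compactin_euclidean_iff)
qed

lemma inprod_continuous [continuous_intros]:
  assumes "\<And>j. j < N \<Longrightarrow> continuous_on A (\<lambda>x. f x j)" "\<And>j. j < N \<Longrightarrow> continuous_on A (\<lambda>x. h x j)"
  shows "continuous_on A (\<lambda>x. inprod N (f x) (h x))"
  unfolding inprod_def using assms by (intro continuous_intros) auto

text \<open>The Rayleigh quotient is maximised on the unit sphere of the orthogonal complement of
  the known eigenvectors. By symmetry the residual \<open>z\<close> at the maximiser lies in this
  complement, so it is an admissible direction; the first-order variation along it is twice its own
  squared norm and has to vanish.\<close>

lemma orthonormal_eigenvector_extend: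
  assumes sym: "\<And>j k. j < N \<Longrightarrow> k < N \<Longrightarrow> M j k = M k j"
    and orth: "\<And>i j. i < r \<Longrightarrow> j < r \<Longrightarrow> inprod N (u i) (u j) = (if i = j then 1 else 0)"
    and eig: "\<And>i j. i < r \<Longrightarrow> j < N \<Longrightarrow> matvec N M (u i) j = lam i * u i j"
    and y: "\<And>i. i < r \<Longrightarrow> inprod N (u i) y = 0" "inprod N y y \<noteq> 0"
  shows "\<exists>x \<mu>. inprod N x x = 1 \<and> (\<forall>i<r. inprod N (u i) x = 0) \<and> (\<forall>j<N. matvec N M x j = \<mu> * x j)"
proof -
  \<comment> \<open>Coordinates from \<open>N\<close> on are pinned to 0, and the others lie in
    \<open>{-1..1}\<close> for any unit vector, so the sphere is a closed part of a compact
    box.\<close>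
  define K where "K = {x :: nat \<Rightarrow> real. (\<forall>j. x j \<in> (if j < N then {-1..1} else {0}))} \<inter> {x. inprod N x x = 1} \<inter> (\<Inter>i\<in>{..<r}. {x. inprod N (u i) x = 0})"
  have cc: "continuous_on A (\<lambda>x :: nat \<Rightarrow> real. x j)" for A j
    by (rule continuous_on_subset[OF continuous_on_product_coordinates]) simp
  have K: "compact K" unfolding K_def
  proof (intro compact_Int_closed compact_box)
    show "closed {x. inprod N x x = 1}" by (intro closed_Collect_eq continuous_intros cc)
    show "closed (\<Inter>i\<in>{..<r}. {x. inprod N (u i) x = 0})"
      by (intro closed_INT ballI closed_Collect_eq continuous_intros cc)
  qed auto
  have norm_in_K: "\<exists>x\<in>K. \<forall>j<N. z j = sqrt (inprod N z z) * x j" if z: "\<And>i. i < r \<Longrightarrow> inprod N (u i) z = 0" "inprod N z z \<noteq> 0" for z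
  proof -
    define c where "c = inverse (sqrt (inprod N z z))"
    have pos: "inprod N z z > 0" using z(2) inprod_nonneg[of N z] by linarith
    define x where "x = (\<lambda>j. if j < N then c * z j else 0)"
    have ipx: "inprod N w x = c * inprod N w z" for w
      unfolding inprod_scale(2)[symmetric] by (rule inprod_cong) (auto simp: x_def)
    have "inprod N x x = c * (c * inprod N z z)"
      unfolding ipx[of x] by (simp add: inprod_comm[of N x z] ipx)
    also have "\<dots> = 1" using pos by (simp add: c_def field_simps power2_eq_square[symmetric])
    finally have 1: "inprod N x x = 1" .
    have "(x j)\<^sup>2 \<le> 1" if "j < N" for j
    proof -
      have "x j * x j \<le> (\<Sum>j<N. x j * x j)" using that by (intro member_le_sum) auto
      thus ?thesis using 1 by (simp add: inprod_def power2_eq_square)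
    qed
    hence "x j \<in> {-1..1}" if "j < N" for j using that abs_square_le_1[of "x j"] by (auto simp: abs_le_iff)
    moreover have "x j = 0" if "\<not> j < N" for j using that by (simp add: x_def)
    moreover have "inprod N (u i) x = 0" if "i < r" for i using z(1)[OF that] by (simp add: ipx)
    ultimately have "x \<in> K" unfolding K_def using 1 by auto
    moreover have "z j = sqrt (inprod N z z) * x j" if "j < N" for j using pos that by (simp add: x_def c_def)
    ultimately show ?thesis by blast
  qed
  have ne: "K \<noteq> {}" using norm_in_K[OF y] by blast
  have "continuous_on K (\<lambda>x. inprod N x (matvec N M x))"
    unfolding matvec_def by (intro continuous_intros cc)
  from continuous_attains_sup[OF K ne this] obtain x where x: "x \<in> K" "\<And>z. z \<in> K \<Longrightarrow> inprod N z (matvec N M z) \<le> inprod N x (matvec N M x)"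
    by blast
  define \<mu> where "\<mu> = inprod N x (matvec N M x)"
  have x1: "inprod N x x = 1" and xo: "\<And>i. i < r \<Longrightarrow> inprod N (u i) x = 0" using x(1) by (auto simp: K_def)
  \<comment> \<open>The gap in the Rayleigh inequality: nonnegative on the complement and zero at
    \<open>x\<close>.\<close>
  define Q where "Q = (\<lambda>z. \<mu> * inprod N z z - inprod N z (matvec N M z))"
  have Q: "0 \<le> Q z" if z: "\<And>i. i < r \<Longrightarrow> inprod N (u i) z = 0" for z
  proof (cases "inprod N z z = 0")
    case True
    hence "z j = 0" if "j < N" for j using that by (simp add: inprod_eq_0)
    hence "inprod N z (matvec N M z) = 0" by (simp add: inprod_def)
    thus ?thesis by (simp add: Q_def True)
  next
    case False
    obtain w where w: "w \<in> K" "\<And>j. j < N \<Longrightarrow> z j = sqrt (inprod N z z) * w j" using norm_in_K[OF z False] by blast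
    have "inprod N z (matvec N M z) = inprod N (\<lambda>j. sqrt (inprod N z z) * w j) (matvec N M (\<lambda>j. sqrt (inprod N z z) * w j))"
      by (rule inprod_cong) (use w(2) in \<open>auto simp: matvec_def\<close>)
    also have "\<dots> = inprod N z z * inprod N w (matvec N M w)"
      unfolding matvec_lin inprod_scale using inprod_nonneg[of N z] by (simp flip: mult.assoc)
    also have "\<dots> \<le> inprod N z z * \<mu>" unfolding \<mu>_def by (intro mult_left_mono x(2) w(1) inprod_nonneg)
    finally show ?thesis by (simp add: Q_def mult.commute)
  qed
  define z where "z = (\<lambda>j. \<mu> * x j - matvec N M x j)"
  have zo: "inprod N (u i) z = 0" if i: "i < r" for i
  proof -
    have "inprod N (u i) (matvec N M x) = inprod N (matvec N M (u i)) x" by (rule inprod_app[OF sym])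
    also have "\<dots> = inprod N (\<lambda>j. lam i * u i j) x" by (rule inprod_cong) (simp_all add: eig[OF i])
    also have "\<dots> = 0" by (simp add: inprod_scale xo[OF i])
    finally show ?thesis by (simp add: z_def inprod_diff inprod_scale xo[OF i])
  qed
  have "0 \<le> 2 * t * inprod N z z + t\<^sup>2 * Q z" for t
  proof -
    have "0 \<le> Q (\<lambda>j. x j + t * z j)" by (rule Q) (simp add: inprod_add inprod_scale xo zo)
    also have "\<dots> = Q x + 2 * t * (\<mu> * inprod N x z - inprod N x (matvec N M z)) + t\<^sup>2 * Q z"
      unfolding Q_def matvec_lin inprod_add inprod_scale
      using inprod_comm[of N z x] inprod_app[OF sym, where x = z and y = x] inprod_comm[of N "matvec N M z" x]
      by (simp add: algebra_simps power2_eq_square)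
    also have "Q x = 0" by (simp add: Q_def x1 \<mu>_def)
    also have "\<mu> * inprod N x z - inprod N x (matvec N M z) = inprod N z z"
    proof -
      have "inprod N z z = inprod N (\<lambda>j. \<mu> * x j - matvec N M x j) z" by (simp only: z_def)
      also have "\<dots> = \<mu> * inprod N x z - inprod N (matvec N M x) z" by (simp only: inprod_diff inprod_scale)
      also have "inprod N (matvec N M x) z = inprod N x (matvec N M z)" by (rule inprod_app[OF sym, symmetric])
      finally show ?thesis ..
    qed
    finally show ?thesis by simp
  qed
  hence "inprod N z z = 0" by (rule quadratic_nonneg_imp_linear_zero) (rule Q[OF zo])
  hence "matvec N M x j = \<mu> * x j" if "j < N" for j using that by (simp add: inprod_eq_0 z_def)
  with x1 xo show ?thesis by blast
qed

text \<open>Bessel's inequality for the \<open>k\<close>-th unit vector bounds the sum of the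
  squares \<open>(u i k)^2\<close> over \<open>i\<close> by 1. Summing over \<open>k\<close> counts
  the vectors.\<close>

lemma orthonormal_card_le:
  assumes orth: "\<And>i j. i < r \<Longrightarrow> j < r \<Longrightarrow> inprod N (u i) (u j) = (if i = j then 1 else 0)"
  shows "r \<le> N"
proof -
  have bes: "(\<Sum>i<r. (u i k)\<^sup>2) \<le> 1" if k: "k < N" for k
  proof -
    let ?e = "\<lambda>j. if j = k then 1 else 0 :: real"
    let ?p = "\<lambda>j. \<Sum>i<r. u i k * u i j"
    have e: "inprod N x ?e = x k" for x unfolding inprod_def using k by (simp add: if_distrib[of "(*) _"] sum.delta cong: if_cong)
    have up: "inprod N (u i) ?p = u i k" if "i < r" for i
      unfolding inprod_sum inprod_scale using that by (simp add: orth if_distrib[of "(*) _"] sum.delta cong: if_cong)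
    have "inprod N ?p ?p = (\<Sum>i<r. u i k * inprod N ?p (u i))" unfolding inprod_sum inprod_scale ..
    also have "\<dots> = (\<Sum>i<r. (u i k)\<^sup>2)" by (intro sum.cong refl) (simp add: inprod_comm[of N ?p] up power2_eq_square)
    finally have pp: "inprod N ?p ?p = (\<Sum>i<r. (u i k)\<^sup>2)" .
    have "inprod N ?p ?e = (\<Sum>i<r. (u i k)\<^sup>2)" by (simp add: e power2_eq_square)
    moreover have "inprod N ?e ?e = 1" by (simp add: e)
    ultimately have "inprod N (\<lambda>j. ?e j - ?p j) (\<lambda>j. ?e j - ?p j) = 1 - (\<Sum>i<r. (u i k)\<^sup>2)"
      unfolding inprod_diff pp by (simp add: inprod_comm[of N ?e ?p])
    thus ?thesis using inprod_nonneg[of N "\<lambda>j. ?e j - ?p j"] by simp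
  qed
  have "real r = (\<Sum>i<r. inprod N (u i) (u i))" by (simp add: orth)
  also have "\<dots> = (\<Sum>k<N. \<Sum>i<r. (u i k)\<^sup>2)" unfolding inprod_def power2_eq_square by (rule sum.swap)
  also have "\<dots> \<le> (\<Sum>k<N. 1)" by (intro sum_mono bes) simp
  finally show ?thesis by simp
qed

text \<open>A longest orthonormal list of eigenvectors exists because its length is at most
  \<open>N\<close>. A vector outside its span would leave a nonzero remainder orthogonal to the
  list, and the list could be extended.\<close>

theorem symmetric_orthonormal_eigenbasis:
  assumes sym: "\<And>j k. j < N \<Longrightarrow> k < N \<Longrightarrow> M j k = M k j"
  obtains r :: nat and u lam where
    "\<And>i j. i < r \<Longrightarrow> j < r \<Longrightarrow> inprod N (u i) (u j) = (if i = j then 1 else 0)"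
    "\<And>i j. i < r \<Longrightarrow> j < N \<Longrightarrow> matvec N M (u i) j = lam i * u i j"
    "\<And>x j. j < N \<Longrightarrow> x j = (\<Sum>i<r. inprod N (u i) x * u i j)"
proof -
  define P where "P = (\<lambda>r::nat. \<exists>u lam. (\<forall>i<r. \<forall>j<r. inprod N (u i) (u j) = (if i = j then 1 else 0)) \<and>
    (\<forall>i<r. \<forall>j<N. matvec N M (u i) j = lam i * u i j))"
  have P0: "P 0" by (simp add: P_def)
  have bd: "r \<le> N" if P: "P r" for r
  proof -
    from P obtain u where "\<forall>i<r. \<forall>j<r. inprod N (u i) (u j) = (if i = j then 1 else 0)"
      unfolding P_def by (elim exE conjE)
    thus ?thesis by (intro orthonormal_card_le[of r N u]) simp
  qed
  define r where "r = (GREATEST r. P r)"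
  have r: "P r" "\<And>r'. P r' \<Longrightarrow> r' \<le> r"
    unfolding r_def by (rule GreatestI_nat[where P = P and b = N, OF P0 bd], assumption) (rule Greatest_le_nat[where P = P and b = N, OF _ bd])
  from r(1) obtain u lam where u: "\<And>i j. i < r \<Longrightarrow> j < r \<Longrightarrow> inprod N (u i) (u j) = (if i = j then 1 else 0)"
    "\<And>i j. i < r \<Longrightarrow> j < N \<Longrightarrow> matvec N M (u i) j = lam i * u i j" unfolding P_def by blast
  have "x j = (\<Sum>i<r. inprod N (u i) x * u i j)" if j: "j < N" for x j
  proof (rule ccontr)
    assume ne: "x j \<noteq> (\<Sum>i<r. inprod N (u i) x * u i j)"
    define y where "y = (\<lambda>j. x j - (\<Sum>i<r. inprod N (u i) x * u i j))"
    have yo: "inprod N (u i) y = 0" if "i < r" for i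
      unfolding y_def inprod_diff inprod_sum inprod_scale using that by (simp add: u(1) if_distrib[of "(*) _"] sum.delta cong: if_cong)
    have "inprod N y y \<noteq> 0" using ne j by (auto simp: inprod_eq_0 y_def)
    from orthonormal_eigenvector_extend[OF sym u yo this] obtain z \<mu> where
      z: "inprod N z z = 1" "\<And>i. i < r \<Longrightarrow> inprod N (u i) z = 0" "\<And>j. j < N \<Longrightarrow> matvec N M z j = \<mu> * z j" by blast
    let ?u = "u(r := z)" and ?l = "lam(r := \<mu>)"
    have "inprod N (?u i) (?u j) = (if i = j then 1 else 0)" if "i < Suc r" "j < Suc r" for i j
    proof (cases "i = r")
      case True
      thus ?thesis using that z(1) z(2)[of j] inprod_comm[of N z "u j"] by (cases "j = r") simp_all
    next
      case False
      thus ?thesis using that z(2)[of i] u(1)[of i j] by (cases "j = r") simp_all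
    qed
    moreover have "matvec N M (?u i) j = ?l i * ?u i j" if "i < Suc r" "j < N" for i j
      using that z(3)[of j] u(2)[of i j] by (cases "i = r") simp_all
    ultimately have "P (Suc r)" unfolding P_def by (intro exI[of _ ?u] exI[of _ ?l]) blast
    from r(2)[OF this] show False by simp
  qed
  from that[OF u this] show ?thesis .
qed

section \<open>The Lipschitz constant of the nonlinearity\<close>

text \<open>The fundamental theorem of calculus tolerates finitely many breakpoints of a continuous
  function, so leaving them out of the supremum costs nothing.\<close>

lemma slopes_Lipschitz:
  assumes pd: "piecewise_diff g" and bdd: "bdd_above (slopes g)"
  shows "0 \<le> Sup (slopes g)" "\<bar>g x - g y\<bar> \<le> Sup (slopes g) * \<bar>x - y\<bar>"
proof -
  have d: "\<bar>deriv g v\<bar> \<le> Sup (slopes g)" if "g differentiable (at v)" for v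
  proof -
    have "(g has_real_derivative deriv g v) (at v)"
      using that by (simp add: DERIV_deriv_iff_real_differentiable)
    thus ?thesis by (intro cSup_upper[OF _ bdd]) (auto simp: slopes_def)
  qed
  have fin: "finite {v \<in> {a..b}. \<not> g differentiable (at v)}" for a b using pd by (simp add: piecewise_diff_def)
  \<comment> \<open>An interval is infinite and has finitely many breakpoints. A point of
    differentiability makes \<open>slopes g\<close> nonempty, hence its supremum
    nonnegative.\<close>
  have "\<exists>v\<in>{0..1}. g differentiable (at v)"
  proof (rule ccontr)
    assume "\<not> ?thesis"
    hence "{v \<in> {0..1}. \<not> g differentiable (at v)} = {0..1::real}" by auto
    hence "finite {0..1::real}" using fin[of 0 1] by (simp only:)
    with infinite_Icc[of "0::real" 1] show False by simp
  qed
  then obtain v where "g differentiable (at v)" by blast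
  from order_trans[OF abs_ge_zero d[OF this]] show s0: "0 \<le> Sup (slopes g)" .
  have le: "\<bar>g b - g a\<bar> \<le> Sup (slopes g) * (b - a)" if ab: "a \<le> b" for a b
  proof -
    let ?S = "{v \<in> {a..b}. \<not> g differentiable (at v)}"
    have "(deriv g has_integral (g b - g a)) {a..b}"
    proof (rule fundamental_theorem_of_calculus_interior_strong[OF fin ab])
      show "(g has_vector_derivative deriv g x) (at x)" if "x \<in> {a<..<b} - ?S" for x
        using that by (simp add: DERIV_deriv_iff_real_differentiable flip: has_real_derivative_iff_has_vector_derivative)
      show "continuous_on {a..b} g" using pd by (auto simp: piecewise_diff_def intro: continuous_on_subset)
    qed
    hence "norm (g b - g a) \<le> Sup (slopes g) * measure lborel {a..b}"
      by (rule has_integral_bound_real[OF s0 fin[of a b]]) (use d in auto)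
    thus ?thesis using ab by simp
  qed
  show "\<bar>g x - g y\<bar> \<le> Sup (slopes g) * \<bar>x - y\<bar>"
    using le[of x y] le[of y x] by (cases "x \<le> y") (auto simp: abs_minus_commute)
qed

section \<open>Kernel of the Laplacian and expansion of disagreements\<close>

definition laplacian_entry :: "nat \<Rightarrow> (nat \<Rightarrow> nat \<Rightarrow> real) \<Rightarrow> nat \<Rightarrow> nat \<Rightarrow> real" where
  "laplacian_entry N a j k = (if j = k then (\<Sum>m<N. a j m) else - a j k)"

lemma laplacian_entry_sym:
  assumes "connected_weights N a" "j < N" "k < N" shows "laplacian_entry N a j k = laplacian_entry N a k j"
proof -
  have "a j k = a k j" using assms unfolding connected_weights_def by blast
  thus ?thesis by (auto simp: laplacian_entry_def)
qed

lemma matvec_laplacian: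
  assumes "connected_weights N a" "j < N"
  shows "matvec N (laplacian_entry N a) x j = (\<Sum>k<N. a j k * (x j - x k))"
proof -
  have ajj: "a j j = 0" using assms by (simp add: connected_weights_def)
  have "matvec N (laplacian_entry N a) x j = (\<Sum>m<N. a j m) * x j + (\<Sum>k\<in>{..<N} - {j}. - a j k * x k)"
    unfolding matvec_def using assms(2)
    by (subst sum.remove[of _ j]) (auto simp: laplacian_entry_def intro!: sum.cong)
  also have "(\<Sum>k\<in>{..<N} - {j}. - a j k * x k) = (\<Sum>k<N. - a j k * x k)"
    using assms(2) by (intro sum.mono_neutral_left) (auto simp: ajj)
  finally show ?thesis by (simp add: sum_distrib_right right_diff_distrib sum_subtractf sum_negf)
qed

lemma laplacian_sum_zero:
  assumes "connected_weights N a"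
  shows "(\<Sum>j<N. matvec N (laplacian_entry N a) x j) = 0"
proof -
  let ?s = "\<Sum>j<N. \<Sum>k<N. a j k * (x j - x k)"
  have "?s = (\<Sum>k<N. \<Sum>j<N. a j k * (x j - x k))" by (rule sum.swap)
  also have "\<dots> = (\<Sum>k<N. \<Sum>j<N. - (a k j * (x k - x j)))"
    using assms by (intro sum.cong refl) (auto simp: connected_weights_def algebra_simps)
  also have "\<dots> = - ?s" by (simp only: sum_negf)
  finally have "?s = 0" by simp
  thus ?thesis using matvec_laplacian[OF assms] by simp
qed

lemma laplacian_form:
  assumes "connected_weights N a"
  shows "2 * inprod N x (matvec N (laplacian_entry N a) x) = (\<Sum>j<N. \<Sum>k<N. a j k * (x j - x k)\<^sup>2)"
proof -
  let ?s = "\<Sum>j<N. \<Sum>k<N. x j * (a j k * (x j - x k))"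
  have 1: "inprod N x (matvec N (laplacian_entry N a) x) = ?s"
    by (simp add: inprod_def matvec_laplacian[OF assms] sum_distrib_left)
  have "?s = (\<Sum>k<N. \<Sum>j<N. x j * (a j k * (x j - x k)))" by (rule sum.swap)
  also have "\<dots> = (\<Sum>j<N. \<Sum>k<N. - (x k * (a j k * (x j - x k))))"
    using assms by (intro sum.cong refl) (auto simp: connected_weights_def algebra_simps)
  finally have "2 * ?s = ?s + (\<Sum>j<N. \<Sum>k<N. - (x k * (a j k * (x j - x k))))" by simp
  also have "\<dots> = (\<Sum>j<N. \<Sum>k<N. a j k * (x j - x k)\<^sup>2)"
    by (simp add: sum.distrib[symmetric] power2_eq_square algebra_simps)
  finally show ?thesis unfolding 1 .
qed

text \<open>The quadratic form is a sum of nonnegative edge terms. Where it vanishes,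
  \<open>x\<close> agrees across every edge and so along every path.\<close>

lemma laplacian_kernel_constant:
  assumes w: "connected_weights N a" and z: "\<And>j. j < N \<Longrightarrow> matvec N (laplacian_entry N a) x j = 0"
    and jk: "j < N" "k < N"
  shows "x j = x k"
proof -
  have nn: "0 \<le> a p q * (x p - x q)\<^sup>2" if "p < N" "q < N" for p q
    using w that by (simp add: connected_weights_def)
  have tot: "(\<Sum>j<N. \<Sum>k<N. a j k * (x j - x k)\<^sup>2) = 0"
    unfolding laplacian_form[OF w, symmetric] by (simp add: inprod_def z)
  hence zero: "a p q * (x p - x q)\<^sup>2 = 0" if "p < N" "q < N" for p q
  proof -
    have "(\<Sum>k<N. a p k * (x p - x k)\<^sup>2) = 0"
      by (rule sum_nonneg_0[of "{..<N}" "\<lambda>j. \<Sum>k<N. a j k * (x j - x k)\<^sup>2"])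
        (use that nn tot in \<open>auto intro!: sum_nonneg\<close>)
    thus ?thesis
      by (intro sum_nonneg_0[of "{..<N}" "\<lambda>k. a p k * (x p - x k)\<^sup>2"]) (use that nn in auto)
  qed
  have edge: "x p = x q" if "p < N" "q < N" "a p q > 0" for p q
    using zero[OF that(1,2)] that(3) by simp
  have "(j, k) \<in> {(p, q). p < N \<and> q < N \<and> a p q > 0}\<^sup>*" using w jk by (simp add: connected_weights_def)
  thus ?thesis by (induction rule: rtrancl_induct) (auto dest: edge)
qed

lemma eigenvalue_laplacian:
  assumes "\<And>j. j < N \<Longrightarrow> matvec N (laplacian_entry N a) u j = lam * u j" "inprod N u u = 1"
  shows "eigenvalue (laplacian N a) lam"
proof -
  have L: "laplacian N a \<in> carrier_mat N N" by (simp add: laplacian_def)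
  have "vec N u \<noteq> 0\<^sub>v N"
  proof
    assume "vec N u = 0\<^sub>v N"
    hence "u j = 0" if "j < N" for j using that by (metis index_vec index_zero_vec(1))
    thus False using assms(2) by (simp add: inprod_def)
  qed
  moreover have "laplacian N a *\<^sub>v vec N u = lam \<cdot>\<^sub>v vec N u"
  proof (rule eq_vecI)
    fix j assume "j < dim_vec (lam \<cdot>\<^sub>v vec N u)"
    hence j: "j < N" by simp
    have "(laplacian N a *\<^sub>v vec N u) $ j = matvec N (laplacian_entry N a) u j"
      using j by (simp add: laplacian_def scalar_prod_def matvec_def laplacian_entry_def atLeast0LessThan)
    thus "(laplacian N a *\<^sub>v vec N u) $ j = (lam \<cdot>\<^sub>v vec N u) $ j" using assms(1)[OF j] j by simp
  qed (simp add: laplacian_def)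
  ultimately have "eigenvector (laplacian N a) (vec N u) lam"
    unfolding eigenvector_def using L by simp
  thus ?thesis unfolding eigenvalue_def by blast
qed

lemma sum_pairwise_diff_sq:
  fixes z :: "nat \<Rightarrow> real"
  shows "(\<Sum>j<N. \<Sum>k<N. (z j - z k)\<^sup>2) = 2 * real N * inprod N z z - 2 * (\<Sum>j<N. z j)\<^sup>2"
proof -
  have "(\<Sum>j<N. \<Sum>k<N. (z j - z k)\<^sup>2) = (\<Sum>j<N. \<Sum>k<N. z j * z j + z k * z k - 2 * (z j * z k))"
    by (intro sum.cong refl) (simp add: power2_eq_square algebra_simps)
  also have "\<dots> = (\<Sum>j<N. \<Sum>k<N. z j * z j) + (\<Sum>j<N. \<Sum>k<N. z k * z k) - (\<Sum>j<N. \<Sum>k<N. 2 * (z j * z k))"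
    by (simp only: sum.distrib sum_subtractf)
  also have "(\<Sum>j<N. \<Sum>k<N. 2 * (z j * z k)) = 2 * (\<Sum>j<N. \<Sum>k<N. z j * z k)"
    by (simp only: sum_distrib_left)
  also have "(\<Sum>j<N. \<Sum>k<N. z j * z k) = (\<Sum>j<N. z j)\<^sup>2"
    by (simp only: power2_eq_square sum_product)
  also have "(\<Sum>j<N. \<Sum>k<N. z j * z j) + (\<Sum>j<N. \<Sum>k<N. z k * z k) = 2 * real N * inprod N z z"
    by (simp add: inprod_def sum_distrib_left mult.assoc)
  finally show ?thesis .
qed

text \<open>Eigenvectors for eigenvalue 0 are constant and cancel in differences. The others have
  coordinate sum 0, so the sum over pairs reduces to \<open>2 N\<close> times a squared norm. As
  \<open>x\<close> is arbitrary, this serves voltages and source currents alike.\<close>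

lemma disagreement_expansion:
  fixes u :: "nat \<Rightarrow> nat \<Rightarrow> real"
  assumes w: "connected_weights N a"
    and orth: "\<And>i j. i < r \<Longrightarrow> j < r \<Longrightarrow> inprod N (u i) (u j) = (if i = j then 1 else 0)"
    and eig: "\<And>i j. i < r \<Longrightarrow> j < N \<Longrightarrow> matvec N (laplacian_entry N a) (u i) j = lam i * u i j"
    and complete: "\<And>x j. j < N \<Longrightarrow> x j = (\<Sum>i<r. inprod N (u i) x * u i j)"
    and A: "A = {i. i < r \<and> lam i \<noteq> 0}"
  shows "j < N \<Longrightarrow> k < N \<Longrightarrow> x j - x k = (\<Sum>i\<in>A. inprod N (u i) x * (u i j - u i k))"
    "(\<Sum>j<N. \<Sum>k<N. (x j - x k)\<^sup>2) = 2 * real N * (\<Sum>i\<in>A. (inprod N (u i) x)\<^sup>2)"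
proof -
  have const: "u i j = u i k" if "i < r" "lam i = 0" "j < N" "k < N" for i j k
    by (rule laplacian_kernel_constant[OF w]) (use that eig in auto)
  have mean: "(\<Sum>j<N. u i j) = 0" if "i \<in> A" for i
  proof -
    have "lam i * (\<Sum>j<N. u i j) = (\<Sum>j<N. matvec N (laplacian_entry N a) (u i) j)"
      using that eig by (simp add: sum_distrib_left A)
    thus ?thesis using that laplacian_sum_zero[OF w] by (simp add: A)
  qed
  show ex: "x j - x k = (\<Sum>i\<in>A. inprod N (u i) x * (u i j - u i k))" if "j < N" "k < N" for j k
  proof -
    have "x j - x k = (\<Sum>i<r. inprod N (u i) x * (u i j - u i k))"
      using complete[OF that(1), of x] complete[OF that(2), of x]
      by (simp add: right_diff_distrib sum_subtractf)
    also have "\<dots> = (\<Sum>i\<in>A. inprod N (u i) x * (u i j - u i k))"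
    proof (rule sum.mono_neutral_right)
      show "\<forall>i\<in>{..<r} - A. inprod N (u i) x * (u i j - u i k) = 0"
      proof
        fix i assume "i \<in> {..<r} - A"
        with const[of i j k] that show "inprod N (u i) x * (u i j - u i k) = 0" by (simp add: A)
      qed
    qed (auto simp: A)
    finally show ?thesis .
  qed
  define z where "z = (\<lambda>j. \<Sum>i\<in>A. inprod N (u i) x * u i j)"
  have finA: "finite A" by (simp add: A)
  have "(\<Sum>j<N. z j) = (\<Sum>i\<in>A. inprod N (u i) x * (\<Sum>j<N. u i j))"
    unfolding z_def by (subst sum.swap) (simp add: sum_distrib_left)
  hence z0: "(\<Sum>j<N. z j) = 0" using mean by simp
  have uz: "inprod N (u i) z = inprod N (u i) x" if "i \<in> A" for i
  proof -
    have "inprod N (u i) z = (\<Sum>l\<in>A. inprod N (u l) x * inprod N (u i) (u l))" unfolding z_def inprod_sum inprod_scale ..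
    also have "\<dots> = (\<Sum>l\<in>A. if i = l then inprod N (u l) x else 0)"
      using that by (intro sum.cong) (auto simp: orth A)
    also have "\<dots> = inprod N (u i) x" using that finA by (simp add: sum.delta)
    finally show ?thesis .
  qed
  have "inprod N z z = (\<Sum>i\<in>A. inprod N (u i) x * inprod N z (u i))" by (subst (2) z_def) (simp only: inprod_sum inprod_scale)
  also have "\<dots> = (\<Sum>i\<in>A. (inprod N (u i) x)\<^sup>2)"
    by (intro sum.cong refl) (simp add: inprod_comm[of N z] uz power2_eq_square)
  finally have zz: "inprod N z z = (\<Sum>i\<in>A. (inprod N (u i) x)\<^sup>2)" .
  have "(\<Sum>j<N. \<Sum>k<N. (x j - x k)\<^sup>2) = (\<Sum>j<N. \<Sum>k<N. (z j - z k)\<^sup>2)"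
    by (intro sum.cong refl) (simp add: ex z_def right_diff_distrib sum_subtractf)
  thus "(\<Sum>j<N. \<Sum>k<N. (x j - x k)\<^sup>2) = 2 * real N * (\<Sum>i\<in>A. (inprod N (u i) x)\<^sup>2)"
    unfolding sum_pairwise_diff_sq z0 zz by simp
qed

section \<open>Transfer functions of the modes\<close>

lemma tf_const_hom:
  "tf_const (a + b) = tf_const a + tf_const b" "tf_const (a * b) = tf_const a * tf_const b"
  "tf_const 0 = 0" "tf_const 1 = 1"
  by (simp_all add: tf_const_def Zero_fract_def One_fract_def pCons_one mult.commute)

lemma tf_const_sum: "tf_const (\<Sum>i\<in>A. f i) = (\<Sum>i\<in>A. tf_const (f i))"
  by (induction A rule: infinite_finite_induct) (simp_all add: tf_const_hom)

lemma kron_row_eigenvector: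
  assumes K: "kron_reduced N n net = y_shunt \<cdot>\<^sub>m 1\<^sub>m N + y_series \<cdot>\<^sub>m map_mat tf_const (laplacian N a)"
    and eig: "\<And>j. j < N \<Longrightarrow> matvec N (laplacian_entry N a) u j = lam * u j"
  shows "m < N \<Longrightarrow> kron_row N n net u m = (y_shunt + y_series * tf_const lam) * tf_const (u m)"
    "kron_form N n net u = (y_shunt + y_series * tf_const lam) * tf_const (inprod N u u)"
proof -
  show r: "kron_row N n net u m = (y_shunt + y_series * tf_const lam) * tf_const (u m)" if m: "m < N" for m
  proof -
    have "kron_row N n net u m = (\<Sum>k<N. (if m = k then y_shunt * tf_const (u k) else 0) + y_series * tf_const (laplacian_entry N a m k * u k))"
      unfolding kron_row_def K using m
      by (intro sum.cong refl) (auto simp: laplacian_def laplacian_entry_def tf_const_hom algebra_simps)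
    also have "\<dots> = y_shunt * tf_const (u m) + y_series * tf_const (matvec N (laplacian_entry N a) u m)"
      using m by (simp add: sum.distrib matvec_def tf_const_sum sum_distrib_left sum.delta)
    finally show ?thesis using eig[OF m] by (simp add: tf_const_hom algebra_simps)
  qed
  show "kron_form N n net u = (y_shunt + y_series * tf_const lam) * tf_const (inprod N u u)"
    unfolding kron_form_def inprod_def tf_const_sum sum_distrib_left
    by (intro sum.cong refl) (simp add: r tf_const_hom mult_ac)
qed

lemma terminal_adm_kron:
  "kron_row 1 n osc (\<lambda>_. 1) 0 = terminal_adm n osc" "kron_form 1 n osc (\<lambda>_. 1) = terminal_adm n osc"
  by (simp_all add: kron_row_def kron_form_def terminal_adm_def tf_const_hom)

text \<open>Rules out that the division convention \<open>x / 0 = 0\<close> makes the transfer function of the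
  hypothesis vanish.\<close>

lemma sum_nonzero_of_sector:
  assumes "q1 \<noteq> 0"
    and 1: "\<forall>\<^sub>F s in cofinite. Re s > 0 \<longrightarrow> 0 \<le> Re (tf_eval q1 s) \<and> norm (tf_eval q1 s) * Re s \<le> norm s * Re (tf_eval q1 s)"
    and 2: "\<forall>\<^sub>F s in cofinite. Re s > 0 \<longrightarrow> 0 \<le> Re (tf_eval q2 s)"
  shows "q1 + q2 \<noteq> 0"
proof
  assume z: "q1 + q2 = 0"
  have "\<forall>\<^sub>F s in cofinite. Re s > 0 \<longrightarrow> tf_eval q1 s = 0"
    using 1 2 tf_eval_add[of q1 q2]
  proof eventually_elim
    case (elim s)
    show ?case
    proof
      assume s: "Re s > 0"
      have "tf_eval q1 s + tf_eval q2 s = 0" using elim(3) z by simp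
      hence "Re (tf_eval q1 s) + Re (tf_eval q2 s) = 0" by (metis plus_complex.sel(1) zero_complex.sel(1))
      hence "Re (tf_eval q1 s) = 0" using elim(1,2) s by linarith
      \<comment> \<open>Here the sector condition turns a vanishing real part into a vanishing
        value.\<close>
      hence "norm (tf_eval q1 s) * Re s \<le> 0" using elim(1) s by simp
      thus "tf_eval q1 s = 0" using s by (simp add: mult_le_0_iff)
    qed
  qed
  from tf_eq_0_RHP[OF this] assms(1) show False by simp
qed

text \<open>Admittances in parallel add: \<open>z_equiv\<close> is the inverse of
  \<open>q1 + y\<close>, and feedback through \<open>x\<close> adds \<open>x\<close> to the
  admittance. For \<open>y = 0\<close> the separate clause of \<open>z_equiv\<close> agrees with
  this formula.\<close>

lemma lft_eq_inverse:
  assumes "q1 \<noteq> 0" "q1 + y \<noteq> 0" "q1 + (y + x) \<noteq> 0"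
  shows "lft (z_equiv y (inverse q1)) x = inverse (q1 + (y + x))"
proof -
  have z: "z_equiv y (inverse q1) = inverse (q1 + y)"
  proof (cases "y = 0")
    case False
    have "inverse y + inverse q1 = (q1 + y) * (inverse y * inverse q1)"
      using False assms(1) by (simp add: distrib_right mult.left_commute[of q1])
    moreover have "inverse y * inverse q1 \<noteq> 0" using False assms(1) by simp
    moreover have "t / (w * t) = inverse w" if "t \<noteq> 0" for t w :: tf
      using that by (cases "w = 0") (simp_all add: divide_simps)
    ultimately show ?thesis using False by (simp only: z_equiv_def if_False Let_def) auto
  qed (simp add: z_equiv_def)
  have "1 + inverse (q1 + y) * x = (q1 + (y + x)) * inverse (q1 + y)"
    using assms(2) by (simp add: distrib_right flip: add.assoc) (simp add: mult.commute flip: distrib_right)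
  thus ?thesis unfolding z lft_def using assms(2) by (simp add: divide_inverse)
qed

section \<open>Modal decomposition of the coupled system\<close>

lemma terminal_sector:
  assumes "1 \<le> n" "passive_circuit n osc" "invertible_mat (interior_adm 1 n osc)"
  shows "\<forall>\<^sub>F s in cofinite. Re s > 0 \<longrightarrow> 0 \<le> Re (tf_eval (terminal_adm n osc) s) \<and>
    norm (tf_eval (terminal_adm n osc) s) * Re s \<le> norm s * Re (tf_eval (terminal_adm n osc) s)"
  using kron_form_sector[OF assms(2,1,3), of "\<lambda>_. 1"] by (simp only: terminal_adm_kron)

lemma modal_sector:
  assumes P: "passive_circuit n net" and b: "N \<le> n" and inv: "invertible_mat (interior_adm N n net)"
    and K: "kron_reduced N n net = y_shunt \<cdot>\<^sub>m 1\<^sub>m N + y_series \<cdot>\<^sub>m map_mat tf_const (laplacian N a)"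
    and eig: "\<And>j. j < N \<Longrightarrow> matvec N (laplacian_entry N a) u j = lam * u j" and unit: "inprod N u u = 1"
  shows "\<forall>\<^sub>F s in cofinite. Re s > 0 \<longrightarrow> 0 \<le> Re (tf_eval (y_shunt + y_series * tf_const lam) s)"
proof -
  have form: "kron_form N n net u = y_shunt + y_series * tf_const lam"
    using kron_row_eigenvector(2)[where u = u and lam = lam, OF K eig] by (simp add: unit tf_const_hom)
  show ?thesis using kron_form_sector[OF P b inv, of u] unfolding form by eventually_elim blast
qed

lemma modal_lft:
  assumes osc: "1 \<le> n_osc" "passive_circuit n_osc osc" "invertible_mat (interior_adm 1 n_osc osc)" "terminal_adm n_osc osc \<noteq> 0"
    and P: "passive_circuit n net" and b: "N \<le> n" and inv: "invertible_mat (interior_adm N n net)" and w: "connected_weights N a"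
    and K: "kron_reduced N n net = y_shunt \<cdot>\<^sub>m 1\<^sub>m N + y_series \<cdot>\<^sub>m map_mat tf_const (laplacian N a)"
    and eig: "\<And>j. j < N \<Longrightarrow> matvec N (laplacian_entry N a) u j = lam * u j" and unit: "inprod N u u = 1"
  shows "terminal_adm n_osc osc + (y_shunt + y_series * tf_const lam) \<noteq> 0"
    "lft (z_equiv y_shunt (terminal_imp n_osc osc)) (y_series * tf_const lam)
      = inverse (terminal_adm n_osc osc + (y_shunt + y_series * tf_const lam))"
proof -
  note sec = terminal_sector[OF osc(1-3)]
  show 1: "terminal_adm n_osc osc + (y_shunt + y_series * tf_const lam) \<noteq> 0"
    by (rule sum_nonzero_of_sector[OF osc(4) sec modal_sector[OF P b inv K eig unit]])
  have N: "N > 0" using unit by (auto simp: inprod_def intro!: Nat.gr0I)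
  \<comment> \<open>The normalised constant vector is an eigenvector for 0. Its mode sees
    \<open>y_shunt\<close> alone, which yields the sign of the real part of
    \<open>y_shunt\<close>.\<close>
  let ?c = "\<lambda>j::nat. 1 / sqrt (real N)"
  have "matvec N (laplacian_entry N a) ?c j = 0 * ?c j" if "j < N" for j using matvec_laplacian[OF w that, of ?c] by simp
  moreover have "inprod N ?c ?c = 1" using N by (simp add: inprod_def)
  ultimately have "\<forall>\<^sub>F s in cofinite. Re s > 0 \<longrightarrow> 0 \<le> Re (tf_eval (y_shunt + y_series * tf_const 0) s)"
    by (rule modal_sector[OF P b inv K])
  hence "\<forall>\<^sub>F s in cofinite. Re s > 0 \<longrightarrow> 0 \<le> Re (tf_eval y_shunt s)" by (simp add: tf_const_hom)
  hence 2: "terminal_adm n_osc osc + y_shunt \<noteq> 0" by (rule sum_nonzero_of_sector[OF osc(4) sec])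
  show "lft (z_equiv y_shunt (terminal_imp n_osc osc)) (y_series * tf_const lam)
      = inverse (terminal_adm n_osc osc + (y_shunt + y_series * tf_const lam))"
    unfolding terminal_imp_def by (rule lft_eq_inverse[OF osc(4) 2 1])
qed

text \<open>Along an eigenvector of the Laplacian the coupled system is a scalar feedback loop; the
  contribution of the initial (and terminal) states of the storage elements is bounded by the
  supplied energy, which keeps its transform free of poles in the closed right half plane.\<close>

lemma modal_response:
  assumes osc: "1 \<le> n_osc" "passive_circuit n_osc osc" "invertible_mat (interior_adm 1 n_osc osc)" "terminal_adm n_osc osc \<noteq> 0"
    and P: "passive_circuit n net" and b: "N \<le> n" and inv: "invertible_mat (interior_adm N n net)"
    and K: "kron_reduced N n net = y_shunt \<cdot>\<^sub>m 1\<^sub>m N + y_series \<cdot>\<^sub>m map_mat tf_const (laplacian N a)"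
    and eig: "\<And>j. j < N \<Longrightarrow> matvec N (laplacian_entry N a) u j = lam * u j" and unit: "inprod N u u = 1"
    and g: "continuous_on UNIV g"
    and net: "circuit_trajectory n net (\<lambda>m t. if m < N then i m t else 0) e c"
    and ev: "\<And>j t. j < N \<Longrightarrow> t \<ge> 0 \<Longrightarrow> e j t = v j t"
    and tr: "\<And>j. j < N \<Longrightarrow> circuit_trajectory n_osc osc (\<lambda>m t. if m = 0 then - g (v j t) - i j t else 0) (eo j) (co j)"
    and eov: "\<And>j t. j < N \<Longrightarrow> t \<ge> 0 \<Longrightarrow> eo j 0 t = v j t"
    and h: "h = inverse (terminal_adm n_osc osc + (y_shunt + y_series * tf_const lam))"
    and nz: "terminal_adm n_osc osc + (y_shunt + y_series * tf_const lam) \<noteq> 0"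
    and stable: "hinf_defined h"
  shows "\<exists>\<eta>. (\<forall>t. strictly_stable (\<eta> t)) \<and>
    (\<forall>T\<ge>0. \<forall>\<^sub>F s in cofinite. laplace (\<lambda>t. inprod N u (\<lambda>j. v j t)) T s
        = tf_eval h s * laplace (\<lambda>t. - inprod N u (\<lambda>j. g (v j t))) T s + tf_eval (\<eta> 0) s
          - exp (- s * complex_of_real T) * tf_eval (\<eta> T) s)"
proof -
  define q1 where "q1 = terminal_adm n_osc osc"
  define q2 where "q2 = y_shunt + y_series * tf_const lam"
  note netD = circuit_trajectoryD[OF net P]
  have cv: "continuous_on {0..} (v j)" if "j < N" for j
    by (rule continuous_on_eq[OF netD(1)[of j]]) (use that b ev[OF that] in auto)
  have cgv: "continuous_on {0..} (\<lambda>t. g (v j t))" if "j < N" for j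
    by (rule continuous_on_compose2[OF g cv[OF that]]) auto
  \<comment> \<open>A trajectory does not postulate continuity of the injected currents; it follows
    from the current balance at the boundary nodes.\<close>
  have ci: "continuous_on {0..} (i j)" if j: "j < N" for j
  proof -
    have "continuous_on {0..} (\<lambda>t. \<Sum>l<length net. incidence net l j * c l t)"
      using netD(2) by (intro continuous_intros) auto
    moreover have "(\<Sum>l<length net. incidence net l j * c l t) = i j t" if "t \<in> {0..}" for t
      using netD(4)[of j t] j b that by simp
    ultimately show ?thesis by (rule continuous_on_eq)
  qed
  have form: "kron_form N n net u = q2" using kron_row_eigenvector(2)[where u = u and lam = lam, OF K eig] by (simp add: unit tf_const_hom q2_def)
  obtain \<rho>n where \<rho>n: "\<forall>t. \<exists>C. \<forall>\<^sub>F s in cofinite. Re s > 0 \<longrightarrow> (norm (tf_eval (\<rho>n t) s))\<^sup>2 * Re s \<le> C * Re (tf_eval q2 s)"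
    "\<forall>T\<ge>0. \<forall>\<^sub>F s in cofinite. (\<Sum>m<N. complex_of_real (u m) * laplace (i m) T s)
      = (\<Sum>m<N. laplace (e m) T s * tf_eval (kron_row N n net u m) s) + tf_eval (\<rho>n 0) s
        - exp (- s * complex_of_real T) * tf_eval (\<rho>n T) s"
    using circuit_laplace[OF P b inv net, of u] unfolding form by blast
  have "\<exists>\<rho>. (\<forall>t. \<exists>C. \<forall>\<^sub>F s in cofinite. Re s > 0 \<longrightarrow> (norm (tf_eval (\<rho> t) s))\<^sup>2 * Re s \<le> C * Re (tf_eval q1 s)) \<and>
    (\<forall>T\<ge>0. \<forall>\<^sub>F s in cofinite. laplace (\<lambda>t. - g (v j t) - i j t) T s
      = laplace (v j) T s * tf_eval q1 s + tf_eval (\<rho> 0) s - exp (- s * complex_of_real T) * tf_eval (\<rho> T) s)"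
    if j: "j < N" for j
  proof -
    have "circuit_trajectory n_osc osc (\<lambda>m t. if m < 1 then (\<lambda>m t. - g (v j t) - i j t) m t else 0) (eo j) (co j)"
      using tr[OF j] by (simp only: less_one)
    from circuit_laplace[OF osc(2,1,3) this, of "\<lambda>_. 1"]
    have "\<exists>\<rho>. (\<forall>t. \<exists>C. \<forall>\<^sub>F s in cofinite. Re s > 0 \<longrightarrow> (norm (tf_eval (\<rho> t) s))\<^sup>2 * Re s \<le> C * Re (tf_eval q1 s)) \<and>
      (\<forall>T\<ge>0. \<forall>\<^sub>F s in cofinite. (\<Sum>m<(1::nat). complex_of_real 1 * laplace (\<lambda>t. - g (v j t) - i j t) T s)
        = (\<Sum>m<1. laplace (eo j m) T s * tf_eval (kron_row 1 n_osc osc (\<lambda>_. 1) m) s) + tf_eval (\<rho> 0) s - exp (- s * complex_of_real T) * tf_eval (\<rho> T) s)"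
      unfolding terminal_adm_kron q1_def .
    moreover have "laplace (eo j 0) T s = laplace (v j) T s" for T s by (rule laplace_cong) (rule eov[OF j])
    moreover have "kron_row 1 n_osc osc (\<lambda>_. 1) 0 = q1" unfolding q1_def by (rule terminal_adm_kron)
    ultimately show ?thesis by simp
  qed
  hence "\<forall>j. \<exists>\<rho>. j < N \<longrightarrow> (\<forall>t. \<exists>C. \<forall>\<^sub>F s in cofinite. Re s > 0 \<longrightarrow> (norm (tf_eval (\<rho> t) s))\<^sup>2 * Re s \<le> C * Re (tf_eval q1 s)) \<and>
    (\<forall>T\<ge>0. \<forall>\<^sub>F s in cofinite. laplace (\<lambda>t. - g (v j t) - i j t) T s
      = laplace (v j) T s * tf_eval q1 s + tf_eval (\<rho> 0) s - exp (- s * complex_of_real T) * tf_eval (\<rho> T) s)"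
    by blast
  from choice[OF this] obtain \<rho>o where
    \<rho>o: "\<And>j t. j < N \<Longrightarrow> \<exists>C. \<forall>\<^sub>F s in cofinite. Re s > 0 \<longrightarrow> (norm (tf_eval (\<rho>o j t) s))\<^sup>2 * Re s \<le> C * Re (tf_eval q1 s)"
    "\<And>j T. j < N \<Longrightarrow> T \<ge> 0 \<Longrightarrow> \<forall>\<^sub>F s in cofinite. laplace (\<lambda>t. - g (v j t) - i j t) T s
      = laplace (v j) T s * tf_eval q1 s + tf_eval (\<rho>o j 0) s - exp (- s * complex_of_real T) * tf_eval (\<rho>o j T) s"
    by (elim exE) blast
  \<comment> \<open>All stored states as seen by the mode \<open>u\<close>: those of the network and
    those of the oscillators, the latter weighted by \<open>u\<close>.\<close>
  define R where "R = (\<lambda>t. \<rho>n t + (\<Sum>j<N. tf_const (u j) * \<rho>o j t))"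
  have evR: "\<forall>\<^sub>F s in cofinite. tf_eval (R t) s = tf_eval (\<rho>n t) s + (\<Sum>j<N. complex_of_real (u j) * tf_eval (\<rho>o j t) s)" for t
  proof -
    have "\<forall>\<^sub>F s in cofinite. tf_eval (\<Sum>j<N. tf_const (u j) * \<rho>o j t) s = (\<Sum>j<N. tf_eval (tf_const (u j) * \<rho>o j t) s)"
      by (rule tf_eval_sum) simp
    moreover have "\<forall>\<^sub>F s in cofinite. \<forall>j\<in>{..<N}. tf_eval (tf_const (u j) * \<rho>o j t) s = tf_eval (tf_const (u j)) s * tf_eval (\<rho>o j t) s"
      by (intro eventually_ball_finite ballI tf_eval_mult) simp
    moreover have "\<forall>\<^sub>F s in cofinite. tf_eval (R t) s = tf_eval (\<rho>n t) s + tf_eval (\<Sum>j<N. tf_const (u j) * \<rho>o j t) s"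
      unfolding R_def by (rule tf_eval_add)
    ultimately show ?thesis by eventually_elim simp
  qed
  have s1: "\<forall>\<^sub>F s in cofinite. Re s > 0 \<longrightarrow> 0 \<le> Re (tf_eval q1 s)"
    using terminal_sector[OF osc(1-3)] unfolding q1_def by eventually_elim blast
  have s2: "\<forall>\<^sub>F s in cofinite. Re s > 0 \<longrightarrow> 0 \<le> Re (tf_eval q2 s)"
    unfolding q2_def by (rule modal_sector[OF P b inv K eig unit])
  have evh: "\<forall>\<^sub>F s in cofinite. tf_eval h s * (tf_eval q1 s + tf_eval q2 s) = 1"
  proof -
    have "q1 + q2 \<noteq> 0" using nz by (simp add: q1_def q2_def)
    from tf_eval_inverse[of "q1 + q2"] tf_eval_add[of q1 q2] tf_eval_nonzero[OF this] show ?thesis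
      unfolding h q1_def[symmetric] q2_def[symmetric] by eventually_elim simp
  qed
  \<comment> \<open>The sign results from solving the balance
    \<open>F = (q1 + q2) W + R 0 - exp (- s T) R T\<close> for \<open>W\<close>.\<close>
  define \<eta> where "\<eta> = (\<lambda>t. - (h * R t))"
  have ev\<eta>: "\<forall>\<^sub>F s in cofinite. tf_eval (\<eta> t) s = - (tf_eval h s * tf_eval (R t) s)" for t
    unfolding \<eta>_def tf_eval_uminus using tf_eval_mult[of h "R t"] by eventually_elim simp
  have "strictly_stable (\<eta> t)" for t
  proof -
    obtain Cn where Cn: "\<forall>\<^sub>F s in cofinite. Re s > 0 \<longrightarrow> (norm (tf_eval (\<rho>n t) s))\<^sup>2 * Re s \<le> Cn * Re (tf_eval q2 s)"
      using \<rho>n(1) by blast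
    have "\<forall>j. \<exists>C. j < N \<longrightarrow> (\<forall>\<^sub>F s in cofinite. Re s > 0 \<longrightarrow> (norm (tf_eval (\<rho>o j t) s))\<^sup>2 * Re s \<le> C * Re (tf_eval q1 s))"
      using \<rho>o(1) by blast
    from choice[OF this] obtain Co where
      "\<And>j. j < N \<Longrightarrow> \<forall>\<^sub>F s in cofinite. Re s > 0 \<longrightarrow> (norm (tf_eval (\<rho>o j t) s))\<^sup>2 * Re s \<le> Co j * Re (tf_eval q1 s)" by blast
    hence Co: "\<forall>\<^sub>F s in cofinite. \<forall>j\<in>{..<N}. Re s > 0 \<longrightarrow> (norm (tf_eval (\<rho>o j t) s))\<^sup>2 * Re s \<le> Co j * Re (tf_eval q1 s)"
      by (intro eventually_ball_finite) auto
    \<comment> \<open>The factors 2 separate the network from the oscillators; \<open>N\<close>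
      comes from Cauchy--Schwarz over the oscillators.\<close>
    define M where "M = 2 * \<bar>Cn\<bar> + 2 * real N * (\<Sum>j<N. (u j)\<^sup>2 * \<bar>Co j\<bar>)"
    have M2: "2 * \<bar>Cn\<bar> \<le> M" "2 * real N * (\<Sum>j<N. (u j)\<^sup>2 * \<bar>Co j\<bar>) \<le> M"
      by (auto simp: M_def intro!: mult_nonneg_nonneg sum_nonneg)
    have "\<forall>\<^sub>F s in cofinite. Re s > 0 \<longrightarrow> (norm (tf_eval (\<eta> t) s))\<^sup>2 * Re s \<le> M * norm (tf_eval h s)"
      using Cn Co evR[of t] s1 s2 evh ev\<eta>[of t]
    proof eventually_elim
      case (elim s)
      show ?case
      proof
        assume s: "Re s > 0"
        let ?a = "tf_eval (\<rho>n t) s" and ?b = "\<lambda>j. complex_of_real (u j) * tf_eval (\<rho>o j t) s"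
        let ?r1 = "Re (tf_eval q1 s)" and ?r2 = "Re (tf_eval q2 s)"
        have r: "0 \<le> ?r1" "0 \<le> ?r2" using elim(4,5) s by auto
        have "(norm (tf_eval (R t) s))\<^sup>2 \<le> 2 * (norm ?a)\<^sup>2 + 2 * (norm (\<Sum>j<N. ?b j))\<^sup>2"
          unfolding elim(3) using norm_add_sq_le[of 1 ?a "\<Sum>j<N. ?b j"] by simp
        also have "(norm (\<Sum>j<N. ?b j))\<^sup>2 \<le> (\<Sum>j<N. norm (?b j))\<^sup>2"
          by (intro power_mono norm_sum) simp
        also have "\<dots> \<le> (\<Sum>j<N. (norm (?b j))\<^sup>2) * real N"
          using sum_squared_le_sum_of_squares[of "\<lambda>j. norm (?b j)" "{..<N}"] by simp
        finally have "(norm (tf_eval (R t) s))\<^sup>2 * Re s \<le> (2 * (norm ?a)\<^sup>2 + 2 * ((\<Sum>j<N. (norm (?b j))\<^sup>2) * real N)) * Re s"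
          using s by (intro mult_right_mono) auto
        also have "\<dots> = 2 * ((norm ?a)\<^sup>2 * Re s) + 2 * real N * (\<Sum>j<N. (u j)\<^sup>2 * ((norm (tf_eval (\<rho>o j t) s))\<^sup>2 * Re s))"
          by (simp add: norm_mult power_mult_distrib sum_distrib_left sum_distrib_right distrib_left distrib_right mult_ac)
        also have "\<dots> \<le> 2 * (\<bar>Cn\<bar> * ?r2) + 2 * real N * (\<Sum>j<N. (u j)\<^sup>2 * (\<bar>Co j\<bar> * ?r1))"
        proof (intro add_mono mult_left_mono sum_mono)
          show "(norm ?a)\<^sup>2 * Re s \<le> \<bar>Cn\<bar> * ?r2"
            using elim(1) s r by (meson abs_ge_self mult_right_mono order_trans)
          fix j assume "j \<in> {..<N}"
          thus "(norm (tf_eval (\<rho>o j t) s))\<^sup>2 * Re s \<le> \<bar>Co j\<bar> * ?r1"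
            using elim(2) s r by (meson abs_ge_self mult_right_mono order_trans)
        qed auto
        also have "\<dots> = (2 * \<bar>Cn\<bar>) * ?r2 + (2 * real N * (\<Sum>j<N. (u j)\<^sup>2 * \<bar>Co j\<bar>)) * ?r1"
          by (simp add: sum_distrib_left sum_distrib_right mult_ac)
        also have "\<dots> \<le> M * ?r2 + M * ?r1" using M2 r by (intro add_mono mult_right_mono) auto
        also have "\<dots> = M * Re (tf_eval q1 s + tf_eval q2 s)" by (simp add: algebra_simps)
        also have "\<dots> \<le> M * norm (tf_eval q1 s + tf_eval q2 s)"
          using M2(1) by (intro mult_left_mono complex_Re_le_cmod) linarith
        finally have RB: "(norm (tf_eval (R t) s))\<^sup>2 * Re s \<le> M * norm (tf_eval q1 s + tf_eval q2 s)" .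
        have "(norm (tf_eval (\<eta> t) s))\<^sup>2 * Re s = (norm (tf_eval h s))\<^sup>2 * ((norm (tf_eval (R t) s))\<^sup>2 * Re s)"
          unfolding elim(7) by (simp add: norm_mult power_mult_distrib)
        also have "\<dots> \<le> (norm (tf_eval h s))\<^sup>2 * (M * norm (tf_eval q1 s + tf_eval q2 s))"
          using RB by (intro mult_left_mono) auto
        \<comment> \<open>One factor \<open>h\<close> cancels the admittance \<open>q1 + q2\<close>,
          of which it is the inverse; the other survives in the bound.\<close>
        also have "\<dots> = M * norm (tf_eval h s) * norm (tf_eval h s * (tf_eval q1 s + tf_eval q2 s))"
          by (simp only: norm_mult power2_eq_square mult_ac)
        also have "\<dots> = M * norm (tf_eval h s)" unfolding elim(6) by simp
        finally show "(norm (tf_eval (\<eta> t) s))\<^sup>2 * Re s \<le> M * norm (tf_eval h s)" .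
      qed
    qed
    thus ?thesis by (rule strictly_stableI[OF stable])
  qed
  moreover have "\<forall>\<^sub>F s in cofinite. laplace (\<lambda>t. inprod N u (\<lambda>j. v j t)) T s
        = tf_eval h s * laplace (\<lambda>t. - inprod N u (\<lambda>j. g (v j t))) T s + tf_eval (\<eta> 0) s
          - exp (- s * complex_of_real T) * tf_eval (\<eta> T) s" if T: "T \<ge> 0" for T
  proof -
    have o: "\<forall>\<^sub>F s in cofinite. \<forall>j\<in>{..<N}. laplace (\<lambda>t. - g (v j t) - i j t) T s
      = laplace (v j) T s * tf_eval q1 s + tf_eval (\<rho>o j 0) s - exp (- s * complex_of_real T) * tf_eval (\<rho>o j T) s"
      using \<rho>o(2) T by (intro eventually_ball_finite) auto
    have row: "\<forall>\<^sub>F s in cofinite. \<forall>m\<in>{..<N}. tf_eval (kron_row N n net u m) s = tf_eval q2 s * tf_eval (tf_const (u m)) s"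
      unfolding q2_def by (intro eventually_ball_finite ballI) (simp_all only: kron_row_eigenvector(1)[OF K eig] lessThan_iff tf_eval_mult finite_lessThan)
    have nT: "\<forall>\<^sub>F s in cofinite. (\<Sum>m<N. complex_of_real (u m) * laplace (i m) T s)
      = (\<Sum>m<N. laplace (e m) T s * tf_eval (kron_row N n net u m) s) + tf_eval (\<rho>n 0) s
        - exp (- s * complex_of_real T) * tf_eval (\<rho>n T) s" using \<rho>n(2) T by blast
    show ?thesis using o row nT evR[of 0] evR[of T] evh ev\<eta>[of 0] ev\<eta>[of T]
    proof eventually_elim
      case (elim s)
      let ?E = "exp (- s * complex_of_real T)"
      let ?u = "\<lambda>j. complex_of_real (u j)"
      define Wh where "Wh = laplace (\<lambda>t. inprod N u (\<lambda>j. v j t)) T s"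
      define Fh where "Fh = laplace (\<lambda>t. - inprod N u (\<lambda>j. g (v j t))) T s"
      have W: "Wh = (\<Sum>j<N. ?u j * laplace (v j) T s)"
        unfolding Wh_def inprod_def using cv by (subst laplace_sum) (auto simp: laplace_scale intro!: continuous_intros)
      have F: "Fh = - (\<Sum>j<N. ?u j * laplace (\<lambda>t. g (v j t)) T s)"
      proof -
        have "Fh = laplace (\<lambda>t. \<Sum>j<N. (- u j) * g (v j t)) T s"
          unfolding Fh_def inprod_def by (intro laplace_cong) (simp add: sum_negf)
        also have "\<dots> = (\<Sum>j<N. laplace (\<lambda>t. (- u j) * g (v j t)) T s)"
          using cgv by (intro laplace_sum) (auto intro!: continuous_intros)
        finally show ?thesis by (simp only: laplace_scale of_real_minus) (simp add: sum_negf)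
      qed
      have gi: "laplace (\<lambda>t. - g (v j t) - i j t) T s = - laplace (\<lambda>t. g (v j t)) T s - laplace (i j) T s" if "j < N" for j
      proof -
        have "laplace (\<lambda>t. - g (v j t) - i j t) T s = laplace (\<lambda>t. - g (v j t)) T s - laplace (i j) T s"
          using cgv ci that by (intro laplace_diff) (auto intro!: continuous_intros)
        also have "laplace (\<lambda>t. - g (v j t)) T s = - laplace (\<lambda>t. g (v j t)) T s"
          using laplace_scale[of "-1" "\<lambda>t. g (v j t)" T s] by simp
        finally show ?thesis .
      qed
      have el: "laplace (e m) T s = laplace (v m) T s" if "m < N" for m using ev[OF that] by (intro laplace_cong) simp
      have "Fh - (\<Sum>j<N. ?u j * laplace (i j) T s) = (\<Sum>j<N. ?u j * laplace (\<lambda>t. - g (v j t) - i j t) T s)"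
        unfolding F by (simp add: gi right_diff_distrib sum_subtractf sum_negf)
      also have "\<dots> = (\<Sum>j<N. (?u j * laplace (v j) T s) * tf_eval q1 s + ?u j * tf_eval (\<rho>o j 0) s - ?E * (?u j * tf_eval (\<rho>o j T) s))"
        by (intro sum.cong refl, subst bspec[OF elim(1)], assumption) (simp add: algebra_simps)
      also have "\<dots> = Wh * tf_eval q1 s + (\<Sum>j<N. ?u j * tf_eval (\<rho>o j 0) s) - ?E * (\<Sum>j<N. ?u j * tf_eval (\<rho>o j T) s)"
        unfolding W by (simp only: sum.distrib sum_subtractf sum_distrib_left sum_distrib_right)
      finally have 1: "Fh - (\<Sum>j<N. ?u j * laplace (i j) T s) = Wh * tf_eval q1 s + (\<Sum>j<N. ?u j * tf_eval (\<rho>o j 0) s) - ?E * (\<Sum>j<N. ?u j * tf_eval (\<rho>o j T) s)" .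
      have "(\<Sum>m<N. laplace (e m) T s * tf_eval (kron_row N n net u m) s) = (\<Sum>m<N. (?u m * laplace (v m) T s) * tf_eval q2 s)"
        using elim(2) el by (intro sum.cong refl) (simp add: mult_ac)
      also have "\<dots> = Wh * tf_eval q2 s" unfolding W by (simp only: sum_distrib_right)
      finally have 2: "(\<Sum>m<N. laplace (e m) T s * tf_eval (kron_row N n net u m) s) = Wh * tf_eval q2 s" .
      \<comment> \<open>Adding the network balance to the weighted oscillator balances eliminates
        the injected currents.\<close>
      have Fh_eq: "Fh = Wh * (tf_eval q1 s + tf_eval q2 s) + tf_eval (R 0) s - ?E * tf_eval (R T) s"
        using 1 elim(3) unfolding 2 elim(4) elim(5) by (simp add: algebra_simps)
      have "tf_eval h s * Fh = Wh * (tf_eval h s * (tf_eval q1 s + tf_eval q2 s)) + tf_eval h s * tf_eval (R 0) s - ?E * (tf_eval h s * tf_eval (R T) s)"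
        by (subst Fh_eq) (simp add: algebra_simps)
      hence "tf_eval h s * Fh = Wh + tf_eval h s * tf_eval (R 0) s - ?E * (tf_eval h s * tf_eval (R T) s)"
        unfolding elim(6) by simp
      thus ?case unfolding Wh_def[symmetric] Fh_def[symmetric] elim(7) elim(8) by (simp add: algebra_simps)
    qed
  qed
  ultimately show ?thesis by (intro exI[of _ \<eta>]) blast
qed

theorem corollary3:
  fixes N n_net n_osc :: nat
    and net osc :: circuit
    and g :: "real \<Rightarrow> real"
    and \<sigma> :: real
    and a :: "nat \<Rightarrow> nat \<Rightarrow> real"
    and y_shunt y_series z_osc z_eq :: tf
    and L :: "real mat"
  assumes "N \<ge> 2"
    and "n_osc \<ge> 1"
    and "passive_circuit n_osc osc"
    and "invertible_mat (interior_adm 1 n_osc osc)"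
    and "terminal_adm n_osc osc \<noteq> 0"
    and "z_osc = terminal_imp n_osc osc"
    and "piecewise_diff g"
    and "bdd_above (slopes g)"
    and "\<sigma> = Sup (slopes g)"
    and "n_net \<ge> N"
    and "passive_circuit n_net net"
    and "connected_circuit n_net net"
    and "invertible_mat (interior_adm N n_net net)"
    and "connected_weights N a"
    and "L = laplacian N a"
    and "kron_reduced N n_net net =
           y_shunt \<cdot>\<^sub>m 1\<^sub>m N + y_series \<cdot>\<^sub>m map_mat tf_const L"
    and "z_eq = z_equiv y_shunt z_osc"
    and "\<And>lam. eigenvalue L lam \<Longrightarrow> lam \<noteq> 0 \<Longrightarrow>
           hinf_defined (lft z_eq (y_series * tf_const lam)) \<and>
           hinf_norm (lft z_eq (y_series * tf_const lam)) * \<sigma> < 1"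
  shows "\<forall>v. coupled_trajectory N n_net net n_osc osc g v \<longrightarrow>
           (\<forall>j<N. \<forall>k<N. ((\<lambda>t. v j t - v k t) \<longlongrightarrow> 0) at_top)"
proof (intro allI impI)
  fix v and p q :: nat
  assume "coupled_trajectory N n_net net n_osc osc g v" and p: "p < N" and q: "q < N"
  then obtain i e c eo co where traj:
    "circuit_trajectory n_net net (\<lambda>m t. if m < N then i m t else 0) e c \<and> (\<forall>j<N. \<forall>t\<ge>0. e j t = v j t) \<and>
     (\<forall>j<N. circuit_trajectory n_osc osc (\<lambda>m t. if m = 0 then - g (v j t) - i j t else 0) (eo j) (co j) \<and>
       (\<forall>t\<ge>0. eo j 0 t = v j t))"
    unfolding coupled_trajectory_def by (elim exE) (erule that)
  have tr: "circuit_trajectory n_net net (\<lambda>m t. if m < N then i m t else 0) e c"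
    using traj by (rule conjunct1)
  have ev: "\<And>j t. j < N \<Longrightarrow> t \<ge> 0 \<Longrightarrow> e j t = v j t"
    and tro: "\<And>j. j < N \<Longrightarrow> circuit_trajectory n_osc osc (\<lambda>m t. if m = 0 then - g (v j t) - i j t else 0) (eo j) (co j)"
    and eov: "\<And>j t. j < N \<Longrightarrow> t \<ge> 0 \<Longrightarrow> eo j 0 t = v j t"
    using conjunct2[OF traj] by simp_all
  have w: "connected_weights N a" and K: "kron_reduced N n_net net = y_shunt \<cdot>\<^sub>m 1\<^sub>m N + y_series \<cdot>\<^sub>m map_mat tf_const (laplacian N a)"
    using assms(14-16) by simp_all
  have g: "continuous_on UNIV g" using assms(7) by (simp add: piecewise_diff_def)
  have sig: "0 \<le> \<sigma>" "\<And>x y. \<bar>g x - g y\<bar> \<le> \<sigma> * \<bar>x - y\<bar>"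
    using slopes_Lipschitz[OF assms(7,8)] assms(9) by simp_all
  obtain r :: nat and u lam where
    orth: "\<And>l j. l < r \<Longrightarrow> j < r \<Longrightarrow> inprod N (u l) (u j) = (if l = j then 1 else 0)"
    and eig: "\<And>l j. l < r \<Longrightarrow> j < N \<Longrightarrow> matvec N (laplacian_entry N a) (u l) j = lam l * u l j"
    and complete: "\<And>x j. j < N \<Longrightarrow> x j = (\<Sum>l<r. inprod N (u l) x * u l j)"
    by (rule symmetric_orthonormal_eigenbasis[of N "laplacian_entry N a", OF laplacian_entry_sym[OF w]]) blast+
  define A where "A = {l. l < r \<and> lam l \<noteq> 0}"
  define h where "h = (\<lambda>l. lft z_eq (y_series * tf_const (lam l)))"
  \<comment> \<open>One gain for all modes, because the small-gain estimate sums over them. The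
    inserted 0 keeps \<open>Max\<close> meaningful for every \<open>A\<close> and makes
    \<open>\<gamma>\<close> nonnegative.\<close>
  define \<gamma> where "\<gamma> = Max (insert 0 ((\<lambda>l. hinf_norm (h l)) ` A))"
  define W where "W = (\<lambda>l t. inprod N (u l) (\<lambda>j. v j t))"
  define f where "f = (\<lambda>l t. - inprod N (u l) (\<lambda>j. g (v j t)))"
  have finA: "finite A" by (simp add: A_def)
  have hinf: "hinf_defined (h l)" "hinf_norm (h l) * \<sigma> < 1" if "l \<in> A" for l
  proof -
    have "eigenvalue L (lam l)"
      unfolding assms(15) using that eig orth by (intro eigenvalue_laplacian[of N a "u l"]) (auto simp: A_def)
    thus "hinf_defined (h l)" "hinf_norm (h l) * \<sigma> < 1" using assms(18)[of "lam l"] that by (auto simp: A_def h_def)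
  qed
  have le\<gamma>: "hinf_norm (h l) \<le> \<gamma>" if "l \<in> A" for l unfolding \<gamma>_def using finA that by (intro Max_ge) auto
  have \<gamma>0: "0 \<le> \<gamma>" unfolding \<gamma>_def using finA by (intro Max_ge) auto
  have "\<gamma> \<in> insert 0 ((\<lambda>l. hinf_norm (h l)) ` A)" unfolding \<gamma>_def using finA by (intro Max_in) auto
  hence gain: "\<gamma> * \<sigma> < 1" using hinf(2) by auto
  have cv: "continuous_on {0..} (v j)" if "j < N" for j
    by (rule continuous_on_eq[OF circuit_trajectoryD(1)[OF tr assms(11), of j]]) (use that assms(10) ev[OF that] in auto)
  have cgv: "continuous_on {0..} (\<lambda>t. g (v j t))" if "j < N" for j
    by (rule continuous_on_compose2[OF g cv[OF that]]) auto
  have cW: "continuous_on {0..} (W l)" and cf: "continuous_on {0..} (f l)" for l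
    unfolding W_def f_def using cv cgv by (auto intro!: continuous_intros)
  \<comment> \<open>Feedthrough, kernel and free response are packed into one triple, so that a
    single choice over the modes suffices.\<close>
  have "\<exists>x. norm (fst x) \<le> \<gamma> \<and> decaying (fst (snd x)) \<and> decaying (snd (snd x)) \<and>
    (\<forall>t T. 0 < t \<longrightarrow> t < T \<longrightarrow> complex_of_real (W l t) = fst x * complex_of_real (f l t) + conv (fst (snd x)) (truncate (f l) T) t + snd (snd x) t) \<and>
    (\<forall>T\<ge>0. (LINT t|lborel. (norm (fst x * truncate (f l) T t + conv (fst (snd x)) (truncate (f l) T) t))\<^sup>2) \<le> \<gamma>\<^sup>2 * integral {0..T} (\<lambda>t. (f l t)\<^sup>2))"
    if l: "l \<in> A" for l
  proof -
    have l': "l < r" using l by (simp add: A_def)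
    have unit: "inprod N (u l) (u l) = 1" using orth[OF l' l'] by simp
    note modal = assms(2-5) assms(11,10,13)
    have nz: "terminal_adm n_osc osc + (y_shunt + y_series * tf_const (lam l)) \<noteq> 0"
      and hl: "h l = inverse (terminal_adm n_osc osc + (y_shunt + y_series * tf_const (lam l)))"
      using modal_lft[where u = "u l" and lam = "lam l", OF modal w K eig[OF l'] unit] assms(6,17) by (simp_all add: h_def)
    obtain \<eta> where \<eta>: "\<And>t. strictly_stable (\<eta> t)"
      "\<And>T. T \<ge> 0 \<Longrightarrow> \<forall>\<^sub>F s in cofinite. laplace (W l) T s = tf_eval (h l) s * laplace (f l) T s + tf_eval (\<eta> 0) s
          - exp (- s * complex_of_real T) * tf_eval (\<eta> T) s"
      using modal_response[where u = "u l" and lam = "lam l" and v = v, OF modal K eig[OF l'] unit g tr ev tro eov hl nz hinf(1)[OF l]]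
      unfolding W_def f_def by blast
    show ?thesis
    proof (rule response_time_domain[OF hinf(1)[OF l] cW[of l] cf[of l] \<eta>])
      fix D k ee
      assume D: "norm D \<le> hinf_norm (h l)" "decaying k" "decaying ee"
        "\<And>t T. 0 < t \<Longrightarrow> t < T \<Longrightarrow> complex_of_real (W l t) = D * complex_of_real (f l t) + conv k (truncate (f l) T) t + ee t"
        and L2: "\<And>T. T \<ge> 0 \<Longrightarrow> (LINT t|lborel. (norm (D * truncate (f l) T t + conv k (truncate (f l) T) t))\<^sup>2) \<le> (hinf_norm (h l))\<^sup>2 * integral {0..T} (\<lambda>t. (f l t)\<^sup>2)"
      have "(LINT t|lborel. (norm (D * truncate (f l) T t + conv k (truncate (f l) T) t))\<^sup>2) \<le> \<gamma>\<^sup>2 * integral {0..T} (\<lambda>t. (f l t)\<^sup>2)" if "T \<ge> 0" for T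
      proof (rule order_trans[OF L2[OF that]], rule mult_right_mono)
        show "(hinf_norm (h l))\<^sup>2 \<le> \<gamma>\<^sup>2" by (intro power_mono le\<gamma>[OF l] hinf_norm_nonneg[OF hinf(1)[OF l]])
        show "0 \<le> integral {0..T} (\<lambda>t. (f l t)\<^sup>2)"
          by (intro integral_nonneg integrable_continuous_interval continuous_intros continuous_on_subset[OF cf[of l]]) auto
      qed
      thus ?thesis using D(2-4) order_trans[OF D(1) le\<gamma>[OF l]] by (intro exI[of _ "(D, k, ee)"]) simp
    qed
  qed
  hence "\<forall>l\<in>A. \<exists>x. norm (fst x) \<le> \<gamma> \<and> decaying (fst (snd x)) \<and> decaying (snd (snd x)) \<and>
    (\<forall>t T. 0 < t \<longrightarrow> t < T \<longrightarrow> complex_of_real (W l t) = fst x * complex_of_real (f l t) + conv (fst (snd x)) (truncate (f l) T) t + snd (snd x) t) \<and>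
    (\<forall>T\<ge>0. (LINT t|lborel. (norm (fst x * truncate (f l) T t + conv (fst (snd x)) (truncate (f l) T) t))\<^sup>2) \<le> \<gamma>\<^sup>2 * integral {0..T} (\<lambda>t. (f l t)\<^sup>2))"
    by blast
  from bchoice[OF this] obtain X where X: "\<forall>l\<in>A. norm (fst (X l)) \<le> \<gamma> \<and> decaying (fst (snd (X l))) \<and> decaying (snd (snd (X l))) \<and>
    (\<forall>t T. 0 < t \<longrightarrow> t < T \<longrightarrow> complex_of_real (W l t) = fst (X l) * complex_of_real (f l t) + conv (fst (snd (X l))) (truncate (f l) T) t + snd (snd (X l)) t) \<and>
    (\<forall>T\<ge>0. (LINT t|lborel. (norm (fst (X l) * truncate (f l) T t + conv (fst (snd (X l))) (truncate (f l) T) t))\<^sup>2) \<le> \<gamma>\<^sup>2 * integral {0..T} (\<lambda>t. (f l t)\<^sup>2))" ..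
  have modes: "x j - x k = (\<Sum>l\<in>A. inprod N (u l) x * (u l j - u l k))" if "j < N" "k < N" for x j k
    by (rule disagreement_expansion(1)[OF w orth eig complete A_def that])
  have modes_sq: "(\<Sum>j<N. \<Sum>k<N. (x j - x k)\<^sup>2) = 2 * real N * (\<Sum>l\<in>A. (inprod N (u l) x)\<^sup>2)" for x
    by (rule disagreement_expansion(2)[OF w orth eig complete A_def])
  \<comment> \<open>The one place where the modes interact: the pairwise Lipschitz bound is carried
    over by expanding the sum over pairs on both sides.\<close>
  have lip: "(\<Sum>l\<in>A. (f l t)\<^sup>2) \<le> \<sigma>\<^sup>2 * (\<Sum>l\<in>A. (W l t)\<^sup>2)" for t
  proof -
    have "2 * real N * (\<Sum>l\<in>A. (f l t)\<^sup>2) = (\<Sum>j<N. \<Sum>k<N. (g (v j t) - g (v k t))\<^sup>2)"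
      using modes_sq[of "\<lambda>j. g (v j t)"] by (simp add: f_def)
    also have "\<dots> \<le> (\<Sum>j<N. \<Sum>k<N. \<sigma>\<^sup>2 * (v j t - v k t)\<^sup>2)"
    proof (intro sum_mono)
      fix j k
      have "\<bar>g (v j t) - g (v k t)\<bar>\<^sup>2 \<le> (\<sigma> * \<bar>v j t - v k t\<bar>)\<^sup>2" by (intro power_mono sig(2)) simp
      thus "(g (v j t) - g (v k t))\<^sup>2 \<le> \<sigma>\<^sup>2 * (v j t - v k t)\<^sup>2" by (simp add: power_mult_distrib)
    qed
    also have "\<dots> = \<sigma>\<^sup>2 * (\<Sum>j<N. \<Sum>k<N. (v j t - v k t)\<^sup>2)" by (simp only: sum_distrib_left)
    also have "\<dots> = 2 * real N * (\<sigma>\<^sup>2 * (\<Sum>l\<in>A. (W l t)\<^sup>2))"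
      using modes_sq[of "\<lambda>j. v j t"] by (simp add: W_def)
    finally show ?thesis using assms(1) by simp
  qed
  have "(W l \<longlongrightarrow> 0) at_top" if "l \<in> A" for l
    by (rule small_gain[where A = A and W = W and f = f and D = "\<lambda>l. fst (X l)" and k = "\<lambda>l. fst (snd (X l))"
        and e = "\<lambda>l. snd (snd (X l))", OF finA cW cf \<gamma>0 sig(1) gain])
      (use X lip that in blast)+
  hence "((\<lambda>t. \<Sum>l\<in>A. W l t * (u l p - u l q)) \<longlongrightarrow> (\<Sum>l\<in>A. 0 * (u l p - u l q))) at_top"
    by (intro tendsto_sum tendsto_mult_right)
  moreover have "v p t - v q t = (\<Sum>l\<in>A. W l t * (u l p - u l q))" for t
    using modes[OF p q, of "\<lambda>j. v j t"] by (simp add: W_def)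
  ultimately show "((\<lambda>t. v p t - v q t) \<longlongrightarrow> 0) at_top" by simp
qed

end
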